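(* Let $m\in\mathbb Z^+$ and $\mathcal D_{2m}=\{(z,w)\in\mathbb C^2:|z|^2+|w|^{2m}<1\}$. The Fefferman--Szegő kernel $S_{\mathcal D_{2m}}(\zeta,\eta)$ blows up exactly on the boundary diagonal $E=\{(\zeta,\eta)\in\partial\mathcal D_{2m}\times\partial\mathcal D_{2m}:\zeta=\eta\}$. That is, for $P\in\overline{\mathcal D}_{2m}\times\overline{\mathcal D}_{2m}$: if $P\in E$, then $|S_{\mathcal D_{2m}}(\zeta,\eta)|\to\infty$ as $(\zeta,\eta)\to P$ with $(\zeta,\eta)\in\mathcal D_{2m}\times\mathcal D_{2m}$; if $P\notin E$, then $S_{\mathcal D_{2m}}$ is bounded on the intersection of $\mathcal D_{2m}\times\mathcal D_{2m}$ with some neighbourhood of $P$.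
   Context: Put $\rho(z,w)=|z|^2+|w|^{2m}-1$ and let $\sigma_{\mathrm E}$ be the Euclidean surface measure on $\partial\mathcal D_{2m}$. The Fefferman surface area measure is $d\sigma_{\mathrm F}=\varpi_{\mathrm F}\,d\sigma_{\mathrm E}$ with $$\varpi_{\mathrm F}=\frac1{|d\rho|}\left|\det\begin{pmatrix}\rho&\partial_{\bar j}\rho\\ \partial_i\rho&\partial_i\partial_{\bar j}\rho\end{pmatrix}_{1\le i,j\le 2}\right|^{\frac13},\qquad |d\rho|=\big(|\partial_z\rho|^2+|\partial_w\rho|^2\big)^{1/2},$$ i.e. $\varpi_{\mathrm F}(z,w)=\dfrac{(m^2|w|^{2m-2})^{1/3}}{\sqrt{|z|^2+m^2|w|^{4m-2}}}$ on $\partial\mathcal D_{2m}$. For $\xi\in\partial\mathcal D_{2m}$ let $\nu_\xi$ be the outward unit normal and let $\delta_\xi(z)$ be the minimum of the Euclidean distances from $z$ to $\partial\mathcal D_{2m}$ and to the tangent plane of $\partial\mathcal D_{2m}$ at $\xi$. For $\alpha>0$ let $\Gamma_\alpha(\xi)=\{z\in\mathcal D_{2m}:|(\xi-z)\cdot\overline{\nu_\xi}|<(1+\alpha)\delta_\xi(z),\ |\xi-z|^2<\alpha\delta_\xi(z)\}$, where $\cdot$ is the complex bilinear dot product, and let $\mathcal N(f)(\xi)=\sup_{z\in\Gamma_\alpha(\xi)}|f(z)|$. The Fefferman--Hardy space $\mathrm H^2_{\mathrm F}(\partial\mathcal D_{2m})$ is the set of holomorphic $f$ on $\mathcal D_{2m}$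 with $\mathcal N(f)\in L^2(\partial\mathcal D_{2m},\sigma_{\mathrm F})$. Each such $f$ has a non-tangential boundary value $f^*$ $\sigma_{\mathrm F}$-a.e., and with the norm $\big(\int|f^*|^2d\sigma_{\mathrm F}\big)^{1/2}$ the space is a reproducing kernel Hilbert space. Its reproducing kernel $S_{\mathcal D_{2m}}(\zeta,\eta)$, satisfying $f(\zeta)=\int_{\partial\mathcal D_{2m}}S_{\mathcal D_{2m}}(\zeta,\xi)f^*(\xi)\,d\sigma_{\mathrm F}(\xi)$, is the Fefferman--Szegő kernel. *)

theory Defs
  imports "HOL-Analysis.Analysis"
begin

definition dom_D :: "nat \<Rightarrow> (complex \<times> complex) set" where
  "dom_D m = {(z, w). (cmod z)^2 + (cmod w)^(2 * m) < 1}"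

definition rho :: "nat \<Rightarrow> complex \<times> complex \<Rightarrow> real" where
  "rho m = (\<lambda>(z, w). (cmod z)^2 + (cmod w)^(2 * m) - 1)"

definition boundary_diagonal :: "nat \<Rightarrow> ((complex \<times> complex) \<times> (complex \<times> complex)) set" where
  "boundary_diagonal m =
     {(\<zeta>, \<eta>). \<zeta> \<in> frontier (dom_D m) \<and> \<eta> \<in> frontier (dom_D m) \<and> \<zeta> = \<eta>}"


subsection \<open>Euclidean surface measure\<close>

text \<open>Regular parametrizations of pieces of a real hypersurface \<open>M\<close> of \<open>\<complex>\<^sup>2 = \<real>\<^sup>4\<close>: injective
  \<open>C\<^sup>1\<close> immersions of open subsets of \<open>\<real>\<^sup>3\<close>.\<close>

definition regular_chart ::
  "(complex \<times> complex) set \<Rightarrow> (real^3) set \<Rightarrow> (real^3 \<Rightarrow> complex \<times> complex) \<Rightarrow> bool" where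
  "regular_chart M U \<phi> \<longleftrightarrow>
     open U \<and> \<phi> ` U \<subseteq> M \<and> inj_on \<phi> U \<and>
     (\<forall>x\<in>U. \<phi> differentiable (at x)) \<and>
     (\<forall>v. continuous_on U (\<lambda>x. frechet_derivative \<phi> (at x) v)) \<and>
     (\<forall>x\<in>U. inj (frechet_derivative \<phi> (at x)))"

definition area_element :: "(real^3 \<Rightarrow> complex \<times> complex) \<Rightarrow> real^3 \<Rightarrow> real" where
  "area_element \<phi> x =
     sqrt (det (\<chi> i j. frechet_derivative \<phi> (at x) (axis i 1) \<bullet>
                       frechet_derivative \<phi> (at x) (axis j 1)))"

text \<open>The Borel measure on \<open>M\<close> that in every regular parametrization \<open>\<phi>\<close> is given by
  \<open>sqrt (det (D\<phi>\<^sup>T D\<phi>)) dx\<close>. If \<open>M\<close> is a \<open>C\<^sup>1\<close> hypersurface, it is covered by countably many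
  charts, so there is exactly one such measure.\<close>

definition euclidean_surface_measure ::
  "(complex \<times> complex) set \<Rightarrow> (complex \<times> complex) measure \<Rightarrow> bool" where
  "euclidean_surface_measure M \<sigma> \<longleftrightarrow>
     sets \<sigma> = sets (restrict_space borel M) \<and>
     (\<forall>U \<phi>. regular_chart M U \<phi> \<longrightarrow>
        (\<forall>B\<in>sets \<sigma>. emeasure \<sigma> (B \<inter> \<phi> ` U) =
           (\<integral>\<^sup>+x\<in>{x\<in>U. \<phi> x \<in> B}. ennreal (area_element \<phi> x) \<partial>lborel)))"


subsection \<open>Fefferman surface area measure\<close>

text \<open>Wirtinger derivatives \<open>\<partial>\<^sub>z, \<partial>\<^sub>w\<close> (and their conjugates) are obtained from the direction
  vectors \<open>(1, 0)\<close> and \<open>(0, 1)\<close>.\<close>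

definition wirtinger ::
  "complex \<times> complex \<Rightarrow> (complex \<times> complex \<Rightarrow> complex) \<Rightarrow> complex \<times> complex \<Rightarrow> complex" where
  "wirtinger e f p =
     (frechet_derivative f (at p) e
        - \<i> * frechet_derivative f (at p) (\<i> * fst e, \<i> * snd e)) / 2"

definition wirtinger_bar ::
  "complex \<times> complex \<Rightarrow> (complex \<times> complex \<Rightarrow> complex) \<Rightarrow> complex \<times> complex \<Rightarrow> complex" where
  "wirtinger_bar e f p =
     (frechet_derivative f (at p) e
        + \<i> * frechet_derivative f (at p) (\<i> * fst e, \<i> * snd e)) / 2"

definition fefferman_density :: "nat \<Rightarrow> complex \<times> complex \<Rightarrow> real" where
  "fefferman_density m p =
    (let r = (\<lambda>q. complex_of_real (rho m q));
         e1 = (1, 0); e2 = (0, 1);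
         A = (vector [
               vector [r p, wirtinger_bar e1 r p, wirtinger_bar e2 r p],
               vector [wirtinger e1 r p,
                       wirtinger e1 (wirtinger_bar e1 r) p, wirtinger e1 (wirtinger_bar e2 r) p],
               vector [wirtinger e2 r p,
                       wirtinger e2 (wirtinger_bar e1 r) p, wirtinger e2 (wirtinger_bar e2 r) p]]
              :: complex^3^3)
     in 1 / sqrt ((cmod (wirtinger e1 r p))^2 + (cmod (wirtinger e2 r p))^2)
          * (cmod (det A)) powr (1/3))"

definition fefferman_measure ::
  "nat \<Rightarrow> (complex \<times> complex) measure \<Rightarrow> (complex \<times> complex) measure" where
  "fefferman_measure m \<sigma>E = density \<sigma>E (\<lambda>\<xi>. ennreal (fefferman_density m \<xi>))"


subsection \<open>Approach regions\<close>

text \<open>\<open>rho\<close> is negative inside the domain and positive outside its closure, so its gradient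
  points outward.\<close>

definition outward_normal :: "nat \<Rightarrow> complex \<times> complex \<Rightarrow> complex \<times> complex" where
  "outward_normal m \<xi> = sgn (THE D. GDERIV (rho m) \<xi> :> D)"

definition tangent_plane :: "nat \<Rightarrow> complex \<times> complex \<Rightarrow> (complex \<times> complex) set" where
  "tangent_plane m \<xi> = {x. (x - \<xi>) \<bullet> outward_normal m \<xi> = 0}"

definition delta :: "nat \<Rightarrow> complex \<times> complex \<Rightarrow> complex \<times> complex \<Rightarrow> real" where
  "delta m \<xi> z = min (infdist z (frontier (dom_D m))) (infdist z (tangent_plane m \<xi>))"

text \<open>\<open>\<bullet>\<close> is the real inner product; the complex bilinear product \<open>a \<cdot> cnj b\<close> is:\<close>

definition cdot_cnj :: "complex \<times> complex \<Rightarrow> complex \<times> complex \<Rightarrow> complex" where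
  "cdot_cnj a b = fst a * cnj (fst b) + snd a * cnj (snd b)"

definition approach_region ::
  "nat \<Rightarrow> real \<Rightarrow> complex \<times> complex \<Rightarrow> (complex \<times> complex) set" where
  "approach_region m \<alpha> \<xi> =
     {z \<in> dom_D m. cmod (cdot_cnj (\<xi> - z) (outward_normal m \<xi>)) < (1 + \<alpha>) * delta m \<xi> z \<and>
                   (norm (\<xi> - z))^2 < \<alpha> * delta m \<xi> z}"

definition nt_maximal ::
  "nat \<Rightarrow> real \<Rightarrow> (complex \<times> complex \<Rightarrow> complex) \<Rightarrow> complex \<times> complex \<Rightarrow> ennreal" where
  "nt_maximal m \<alpha> f \<xi> = (SUP z\<in>approach_region m \<alpha> \<xi>. ennreal (cmod (f z)))"


subsection \<open>Fefferman--Hardy space and Fefferman--Szego kernel\<close>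

definition holomorphic2_on ::
  "(complex \<times> complex \<Rightarrow> complex) \<Rightarrow> (complex \<times> complex) set \<Rightarrow> bool" where
  "holomorphic2_on f U \<longleftrightarrow>
     (\<forall>p\<in>U. \<exists>a b. (f has_derivative (\<lambda>h. a * fst h + b * snd h)) (at p))"

text \<open>In the following, \<open>\<sigma>E\<close> is the Euclidean surface measure of \<open>frontier (dom_D m)\<close>. Elements
  of the Hardy space matter only through their values on \<open>dom_D m\<close>.\<close>

definition fefferman_hardy ::
  "nat \<Rightarrow> real \<Rightarrow> (complex \<times> complex) measure \<Rightarrow> (complex \<times> complex \<Rightarrow> complex) set" where
  "fefferman_hardy m \<alpha> \<sigma>E =
     {f. holomorphic2_on f (dom_D m) \<and>
         nt_maximal m \<alpha> f \<in> borel_measurable (fefferman_measure m \<sigma>E) \<and>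
         (\<integral>\<^sup>+\<xi>. (nt_maximal m \<alpha> f \<xi>)^2 \<partial>fefferman_measure m \<sigma>E) < \<infinity>}"

definition nt_boundary_value ::
  "nat \<Rightarrow> real \<Rightarrow> (complex \<times> complex) measure \<Rightarrow>
   (complex \<times> complex \<Rightarrow> complex) \<Rightarrow> (complex \<times> complex \<Rightarrow> complex) \<Rightarrow> bool" where
  "nt_boundary_value m \<alpha> \<sigma>E f g \<longleftrightarrow>
     g \<in> borel_measurable (fefferman_measure m \<sigma>E) \<and>
     (AE \<xi> in fefferman_measure m \<sigma>E. (f \<longlongrightarrow> g \<xi>) (at \<xi> within approach_region m \<alpha> \<xi>))"

text \<open>The reproducing kernel of the Hardy space with inner product
  \<open>\<integral> f\<^sup>* cnj g\<^sup>* d\<sigma>F\<close>: the function \<open>cnj (S \<zeta> \<cdot>)\<close> lies in the space, and pairing with its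
  boundary value reproduces the value at \<open>\<zeta>\<close>. Here \<open>s\<close> is the boundary value of \<open>S \<zeta> \<cdot>\<close>,
  which gives meaning to \<open>S \<zeta> \<xi>\<close> for \<open>\<xi>\<close> in the boundary.\<close>

definition fefferman_szego_kernel ::
  "nat \<Rightarrow> real \<Rightarrow> (complex \<times> complex) measure \<Rightarrow>
   (complex \<times> complex \<Rightarrow> complex \<times> complex \<Rightarrow> complex) \<Rightarrow> bool" where
  "fefferman_szego_kernel m \<alpha> \<sigma>E S \<longleftrightarrow>
     (\<forall>\<zeta>\<in>dom_D m.
        (\<lambda>\<eta>. cnj (S \<zeta> \<eta>)) \<in> fefferman_hardy m \<alpha> \<sigma>E \<and>
        (\<exists>s. nt_boundary_value m \<alpha> \<sigma>E (S \<zeta>) s \<and>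
             (\<forall>f\<in>fefferman_hardy m \<alpha> \<sigma>E. \<forall>g. nt_boundary_value m \<alpha> \<sigma>E f g \<longrightarrow>
                has_bochner_integral (fefferman_measure m \<sigma>E) (\<lambda>\<xi>. s \<xi> * g \<xi>) (f \<zeta>))))"

end

theory Submission
  imports Defs "HOL-Complex_Analysis.Complex_Analysis"
begin

text \<open>In the coordinates \<open>z = sqrt (1 - r^(2m)) e^(is)\<close>, \<open>w = r e^(it)\<close> the area element cancels against
  the denominator of the Fefferman density, and the measure becomes \<open>m^(2/3) r^((2m+1)/3) dr ds dt\<close>.
  Hence the monomials \<open>z^j w^k\<close> are orthogonal with norms given by Beta integrals. Pairing the
  boundary value of \<open>S \<zeta> \<cdot>\<close> with them determines its Taylor coefficients, because on almost every
  torus the maximal function dominates the radial approach to the boundary. Summing the series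
  (binomial in \<open>z\<close>, geometric in \<open>w\<close>) shows that \<open>S\<close> is, up to conjugation and a positive constant,
  \<open>(1 - x)^(-1-c) ((m + 2) - (m - 1) q) / (1 - q)^2\<close> with \<open>x = z cnj z'\<close>, \<open>q = w cnj w' (1 - x)^(-1/m)\<close>
  and \<open>c = (m + 2) / (3m)\<close>. Since \<open>|q| < 1\<close>, the numerator has modulus at least \<open>3\<close>; on the closure
  the denominator vanishes only if \<open>x = 1\<close> or \<open>q = 1\<close>, and both force equal boundary points.\<close>

section \<open>Power series on the domain\<close>

text \<open>The definition only says that \<open>S\<close> reproduces. Applied to monomials alone,
  the reproducing identity fixes all Taylor coefficients of \<open>cnj (S \<zeta> \<eta>)\<close> in
  \<eta>, so every \<open>S\<close> allowed by the hypotheses equals one explicit function on the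
  domain and the blow-up becomes calculus. The obstacle is the boundary: boundary values are only
  almost everywhere non-tangential limits, and the surface measure is prescribed only through
  charts. Hence limits are taken torus by torus, and the circles \<open>z = 0\<close> and
  \<open>w = 0\<close>, which polar coordinates miss, are shown to be null through separate charts.
  Origin of c: the squared norm of \<open>z^j w^k\<close> contains the Beta integral of
  \<open>r^((2m+1)/3 + 2k) (1 - r^(2m))^j\<close>, whose first parameter is
  \<open>((2m+4)/3 + 2k) / (2m) = c + k/m\<close>. Summing over j gives the exponent
  \<open>-(1 + c + k/m)\<close>, so each unit of k contributes a factor
  \<open>(1 - x)^(-1/m)\<close>, which is how q arises; the linear prefactor \<open>c + k/m\<close>
  turns the geometric series into one with a double pole.\<close>

lemma holomorphic_on_integral_parameter:
  fixes F :: "complex \<Rightarrow> real \<Rightarrow> complex"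
  assumes S: "open S" and cont: "continuous_on (S \<times> {a..b}) (\<lambda>(z, t). F z t)"
    and hol: "\<And>t. t \<in> {a..b} \<Longrightarrow> (\<lambda>z. F z t) holomorphic_on S"
  shows "(\<lambda>z. integral {a..b} (F z)) holomorphic_on S"
proof -
  let ?H = "\<lambda>z. integral {a..b} (F z)"
  have contH: "continuous_on S ?H"
    using integral_continuous_on_param[of S a b F] cont by simp
  have swap: "contour_integral (linepath u v) ?H =
        integral {a..b} (\<lambda>t. contour_integral (linepath u v) (\<lambda>z. F z t))"
    and int: "(\<lambda>t. contour_integral (linepath u v) (\<lambda>z. F z t)) integrable_on {a..b}"
    if uv: "closed_segment u v \<subseteq> S" for u v
  proof -
    let ?G = "\<lambda>x t. F (linepath u v x) t * (v - u)"
    have lp: "linepath u v x \<in> S" if "x \<in> {0..1}" for x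
      using uv that linepath_in_path[of x u v] by auto
    have c: "continuous_on ({0..1} \<times> {a..b}) (\<lambda>(x, t). ?G x t)"
    proof -
      have "continuous_on ({0..1} \<times> {a..b}) (\<lambda>y. (linepath u v (fst y), snd y))"
        unfolding linepath_def by (intro continuous_intros)
      then have "continuous_on ({0..1} \<times> {a..b}) (\<lambda>y. (\<lambda>(z, t). F z t) (linepath u v (fst y), snd y))"
        by (rule continuous_on_compose2[OF cont]) (auto intro: lp)
      then show ?thesis
        by (auto simp: case_prod_beta intro!: continuous_intros)
    qed
    have "contour_integral (linepath u v) ?H = integral {0..1} (\<lambda>x. integral {a..b} (?G x))"
      by (simp add: contour_integral_integral)
    also have "\<dots> = integral {a..b} (\<lambda>t. integral {0..1} (\<lambda>x. ?G x t))"
      using integral_swap_continuous[of 0 a 1 b ?G] c by (simp add: cbox_Pair_eq)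
    finally show "contour_integral (linepath u v) ?H =
        integral {a..b} (\<lambda>t. contour_integral (linepath u v) (\<lambda>z. F z t))"
      by (simp add: contour_integral_integral)
    have "continuous_on ({a..b} \<times> {0..1}) (\<lambda>(t, x). ?G x t)"
      using continuous_on_swap_args[OF c] by (simp add: case_prod_beta)
    then have "continuous_on {a..b} (\<lambda>t. integral {0..1} (\<lambda>x. ?G x t))"
      using integral_continuous_on_param[of "{a..b}" 0 1 "\<lambda>t x. ?G x t"] by simp
    then show "(\<lambda>t. contour_integral (linepath u v) (\<lambda>z. F z t)) integrable_on {a..b}"
      by (simp add: contour_integral_integral integrable_continuous_real)
  qed
  \<comment> \<open>Morera's criterion: by \<open>swap\<close> the integral of \<open>?H\<close>
    around a triangle is the parameter integral of the contour integrals of \<open>F z t\<close> at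
    fixed t, and these vanish by Cauchy's theorem.\<close>
  have "?H analytic_on S"
  proof (rule Morera_triangle[OF contH S], intro impI)
    fix u v w :: complex
    assume tri: "convex hull {u, v, w} \<subseteq> S"
    have seg: "closed_segment u v \<subseteq> S" "closed_segment v w \<subseteq> S" "closed_segment w u \<subseteq> S"
      using tri segments_subset_convex_hull[of u v w] segments_subset_convex_hull[of v w u]
        segments_subset_convex_hull[of w u v]
      by (auto simp: insert_commute)
    have zero: "contour_integral (linepath u v) (\<lambda>z. F z t) + contour_integral (linepath v w) (\<lambda>z. F z t)
            + contour_integral (linepath w u) (\<lambda>z. F z t) = 0" if "t \<in> {a..b}" for t
    proof -
      have h: "(\<lambda>z. F z t) holomorphic_on convex hull {u, v, w}"
        using hol[OF that] tri holomorphic_on_subset by blast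
      have ci: "(\<lambda>z. F z t) contour_integrable_on linepath u v"
        "(\<lambda>z. F z t) contour_integrable_on linepath v w"
        "(\<lambda>z. F z t) contour_integrable_on linepath w u"
        using seg hol[OF that, THEN holomorphic_on_imp_continuous_on]
        by (auto intro!: contour_integrable_continuous_linepath intro: continuous_on_subset)
      show ?thesis
        using Cauchy_theorem_triangle[OF h, THEN contour_integral_unique] ci
        by (simp add: contour_integrable_join contour_integral_join add.assoc)
    qed
    show "contour_integral (linepath u v) ?H + contour_integral (linepath v w) ?H
            + contour_integral (linepath w u) ?H = 0"
      unfolding swap[OF seg(1)] swap[OF seg(2)] swap[OF seg(3)]
        integral_add[symmetric, OF int[OF seg(1)] int[OF seg(2)]]
        integral_add[symmetric, OF integrable_add[OF int[OF seg(1)] int[OF seg(2)]] int[OF seg(3)]]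
      using integral_cong[of "{a..b}", OF zero] by simp
  qed
  then show ?thesis
    by (rule analytic_imp_holomorphic)
qed

text \<open>Cauchy's formula for the k-th derivative on a circle, read as a Fourier coefficient.
  Fourier coefficients on tori, unlike derivatives at 0, can be followed to the limit as the torus
  moves to the boundary.\<close>

lemma circle_coefficient:
  fixes g :: "complex \<Rightarrow> complex"
  assumes hol: "g holomorphic_on ball 0 R" and \<rho>: "0 < \<rho>" "\<rho> < R"
  shows "integral {0..2 * pi} (\<lambda>t. g (of_real \<rho> * cis t) * cis (- (real k * t))) =
         2 * pi * ((deriv ^^ k) g 0 / fact k) * of_real \<rho> ^ k"
proof -
  have "((\<lambda>u. g u / (u - 0) ^ Suc k) has_contour_integral
        complex_of_real (2 * pi) * \<i> / fact k * (deriv ^^ k) g 0) (circlepath 0 \<rho>)"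
    by (rule Cauchy_has_contour_integral_higher_derivative_circlepath)
      (use \<rho> in \<open>auto intro!: holomorphic_on_imp_continuous_on holomorphic_on_subset[OF hol]\<close>)
  then have "((\<lambda>t. g (of_real \<rho> * cis t) / (of_real \<rho> * cis t) ^ Suc k * of_real \<rho> * \<i> * cis t)
      has_integral complex_of_real (2 * pi) * \<i> / fact k * (deriv ^^ k) g 0) {0..2 * pi}"
    by (simp add: circlepath_def has_contour_integral_part_circlepath_iff)
  \<comment> \<open>The factor turns \<open>g u / u ^ Suc k\<close> times the derivative of the path
    into \<open>g u\<close> times the character \<open>cis (- (real k * t))\<close>.\<close>
  from has_integral_mult_left[OF this, of "of_real \<rho> ^ k / \<i>"]
  have "((\<lambda>t. g (of_real \<rho> * cis t) / (of_real \<rho> * cis t) ^ Suc k * of_real \<rho> * \<i> * cis t * (of_real \<rho> ^ k / \<i>))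
      has_integral 2 * pi * ((deriv ^^ k) g 0 / fact k) * of_real \<rho> ^ k) {0..2 * pi}"
    by (simp add: mult_ac)
  moreover have "g (of_real \<rho> * cis t) / (of_real \<rho> * cis t) ^ Suc k * of_real \<rho> * \<i> * cis t * (of_real \<rho> ^ k / \<i>)
     = g (of_real \<rho> * cis t) * cis (- (real k * t))" for t
  proof -
    have "cis (- (real k * t)) * cis t ^ k = 1"
      by (simp add: Complex.DeMoivre cis_mult)
    then have "cis (- (real k * t)) = 1 / cis t ^ k"
      by (simp add: eq_divide_eq)
    then show ?thesis
      using \<rho> by (simp add: power_mult_distrib)
  qed
  ultimately show ?thesis
    by (simp add: integral_unique)
qed

lemma dom_D_iff_root:
  assumes "m \<ge> 1" "cmod z < 1"
  shows "(z, w) \<in> dom_D m \<longleftrightarrow> cmod w < root (2 * m) (1 - (cmod z)\<^sup>2)"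
proof -
  have p: "0 \<le> 1 - (cmod z)\<^sup>2"
    using assms(2) by (simp add: abs_square_le_1)
  have "cmod w ^ (2 * m) < 1 - (cmod z)\<^sup>2 \<longleftrightarrow> root (2 * m) (cmod w ^ (2 * m)) < root (2 * m) (1 - (cmod z)\<^sup>2)"
    using assms(1) by (intro real_root_less_iff[symmetric]) simp
  also have "root (2 * m) (cmod w ^ (2 * m)) = cmod w"
    using assms(1) by (intro real_root_power_cancel) auto
  finally show ?thesis
    by (auto simp: dom_D_def)
qed

lemma dom_D_fst_less_1: "(z, w) \<in> dom_D m \<Longrightarrow> cmod z < 1"
proof -
  assume "(z, w) \<in> dom_D m"
  then have "(cmod z)\<^sup>2 + cmod w ^ (2 * m) < 1" by (simp add: dom_D_def)
  with zero_le_power[OF norm_ge_zero[of w], of "2 * m"] have "(cmod z)\<^sup>2 < 1" by linarith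
  then show ?thesis by (simp add: abs_square_less_1)
qed

text \<open>The domain is a complete Reinhardt domain: with a point it contains the closed polydisc
  about 0 which that point spans.\<close>

lemma dom_D_mono:
  assumes "(z, w) \<in> dom_D m" "cmod z' \<le> cmod z" "cmod w' \<le> cmod w"
  shows "(z', w') \<in> dom_D m"
proof -
  have "(cmod z')\<^sup>2 \<le> (cmod z)\<^sup>2" "cmod w' ^ (2 * m) \<le> cmod w ^ (2 * m)"
    using assms by (auto intro: power_mono)
  moreover have "(cmod z)\<^sup>2 + cmod w ^ (2 * m) < 1" using assms(1) by (simp add: dom_D_def)
  ultimately have "(cmod z')\<^sup>2 + cmod w' ^ (2 * m) < 1" by linarith
  then show ?thesis by (simp add: dom_D_def)
qed

lemma open_dom_D: "open (dom_D m)"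
proof -
  have "dom_D m = (\<lambda>p. (cmod (fst p))\<^sup>2 + cmod (snd p) ^ (2 * m)) -` {..<1}"
    by (auto simp: dom_D_def)
  then show ?thesis
    by (simp, intro open_vimage open_lessThan continuous_intros)
qed

lemma holomorphic2_on_imp_continuous_on: "holomorphic2_on f U \<Longrightarrow> continuous_on U f"
  unfolding holomorphic2_on_def
  by (meson continuous_at_imp_continuous_on has_derivative_continuous)

lemma holomorphic2_on_compose_holomorphic:
  assumes f: "holomorphic2_on f U" and g: "g holomorphic_on S" "h holomorphic_on S"
    and S: "open S" and sub: "\<And>z. z \<in> S \<Longrightarrow> (g z, h z) \<in> U"
  shows "(\<lambda>z. f (g z, h z)) holomorphic_on S"
  unfolding holomorphic_on_open[OF S]
proof
  fix z assume z: "z \<in> S"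
  obtain a b where ab: "(f has_derivative (\<lambda>h. a * fst h + b * snd h)) (at (g z, h z))"
    using f sub[OF z] unfolding holomorphic2_on_def by blast
  obtain g' h' where "(g has_field_derivative g') (at z)" "(h has_field_derivative h') (at z)"
    using g z unfolding holomorphic_on_open[OF S] by blast
  then have "((\<lambda>z. (g z, h z)) has_derivative (\<lambda>x. (g' * x, h' * x))) (at z)"
    by (auto intro!: has_derivative_Pair simp: has_field_derivative_def)
  from has_derivative_compose[OF this ab]
  moreover have "(\<lambda>x. a * fst (g' * x, h' * x) + b * snd (g' * x, h' * x)) = (*) (a * g' + b * h')"
    by (auto simp: distrib_right mult.assoc)
  ultimately have "((\<lambda>z. f (g z, h z)) has_derivative (*) (a * g' + b * h')) (at z)"
    by simp
  then show "\<exists>f'. ((\<lambda>z. f (g z, h z)) has_field_derivative f') (at z)"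
    unfolding has_field_derivative_def by blast
qed

text \<open>Over the unit disc the slices in \<open>w\<close> are discs about 0, so the one-variable
  theorem is applied twice: a Taylor series in \<open>w\<close> at fixed \<open>z\<close>, then one
  in \<open>z\<close> for each coefficient. The series is accordingly an iterated one. The torus
  formula recovers its coefficients by integrating over the two angles in turn.\<close>

lemma dom_D_power_series:
  assumes m: "m \<ge> 1" and f: "holomorphic2_on f (dom_D m)"
  obtains a :: "nat \<Rightarrow> nat \<Rightarrow> complex"
  where "\<And>z w. (z, w) \<in> dom_D m \<Longrightarrow> (\<lambda>k. (\<Sum>j. a j k * z ^ j) * w ^ k) sums f (z, w)"
    and "\<And>p q j k. 0 < p \<Longrightarrow> 0 < q \<Longrightarrow> (of_real p, of_real q) \<in> dom_D m \<Longrightarrow>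
        integral {0..2 * pi} (\<lambda>s. integral {0..2 * pi}
          (\<lambda>t. f (of_real p * cis s, of_real q * cis t) * cis (- (real k * t))) * cis (- (real j * s))) =
        4 * pi\<^sup>2 * a j k * of_real p ^ j * of_real q ^ k"
proof -
  define R where "R = (\<lambda>z::complex. root (2 * m) (1 - (cmod z)\<^sup>2))"
  define B where "B = (\<lambda>k z. (deriv ^^ k) (\<lambda>w. f (z, w)) 0 / fact k)"
  have dom: "(z, w) \<in> dom_D m \<longleftrightarrow> cmod w < R z" if "cmod z < 1" for z w
    using dom_D_iff_root[OF m that] by (simp add: R_def)
  have slice: "(\<lambda>w. f (z, w)) holomorphic_on ball 0 (R z)" if "cmod z < 1" for z
    by (rule holomorphic2_on_compose_holomorphic[OF f]) (use dom that in \<open>auto intro: holomorphic_intros\<close>)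
  have Bint: "integral {0..2 * pi} (\<lambda>t. f (z, of_real q * cis t) * cis (- (real k * t))) =
         2 * pi * B k z * of_real q ^ k" if "(z, of_real q) \<in> dom_D m" "0 < q" for z q k
    using circle_coefficient[OF slice, of z q k] that dom[of z q] dom_D_fst_less_1[OF that(1)]
    by (simp add: B_def)
  \<comment> \<open>The slice radius \<open>R z\<close> shrinks as \<open>z\<close> nears the unit
    circle, so a circle \<open>cmod w = q\<close> lying in all slices exists only over a smaller
    disc \<open>ball 0 s\<close>. There \<open>B k\<close> is an integral over this fixed circle,
    with \<open>z\<close> as a holomorphic parameter.\<close>
  have Bhol: "B k holomorphic_on ball 0 1" for k
  proof -
    have "\<exists>U. open U \<and> z0 \<in> U \<and> B k holomorphic_on U" if "z0 \<in> ball 0 1" for z0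
    proof -
      obtain s where s: "cmod z0 < s" "s < 1"
        using dense[of "cmod z0" 1] \<open>z0 \<in> ball 0 1\<close> by auto
      have s0: "0 < s" using s(1) norm_ge_zero[of z0] by linarith
      have "s\<^sup>2 < 1" using s s0 by (simp add: abs_square_less_1)
      then have "0 < R (of_real s)"
        using s0 m by (simp add: R_def)
      then obtain q where q: "0 < q" "q < R (of_real s)"
        using dense by blast
      have sq: "(of_real s, of_real q) \<in> dom_D m"
        using dom[of "of_real s" "of_real q"] q s s0 by simp
      have mem: "(z, of_real q * cis t) \<in> dom_D m" if "z \<in> ball 0 s" for z t
        using dom_D_mono[OF sq, of z "of_real q * cis t"] that q s0 by (simp add: norm_mult)
      have "(\<lambda>z. integral {0..2 * pi} (\<lambda>t. f (z, of_real q * cis t) * cis (- (real k * t)))) holomorphic_on ball 0 s"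
      proof (rule holomorphic_on_integral_parameter)
        have "continuous_on (ball 0 s \<times> {0..2 * pi}) (\<lambda>y. f (fst y, of_real q * cis (snd y)))"
          by (rule continuous_on_compose2[OF holomorphic2_on_imp_continuous_on[OF f]])
            (auto intro!: continuous_intros mem)
        then show "continuous_on (ball 0 s \<times> {0..2 * pi}) (\<lambda>(z, t). f (z, of_real q * cis t) * cis (- (real k * t)))"
          by (auto simp: case_prod_beta intro!: continuous_intros)
        show "(\<lambda>z. f (z, of_real q * cis t) * cis (- (real k * t))) holomorphic_on ball 0 s" for t
          by (intro holomorphic_intros holomorphic2_on_compose_holomorphic[OF f]) (auto intro: mem)
      qed auto
      then have "(\<lambda>z. integral {0..2 * pi} (\<lambda>t. f (z, of_real q * cis t) * cis (- (real k * t))) / (2 * pi * of_real q ^ k))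
           holomorphic_on ball 0 s"
        using q by (intro holomorphic_intros) auto
      moreover have "integral {0..2 * pi} (\<lambda>t. f (z, of_real q * cis t) * cis (- (real k * t))) / (2 * pi * of_real q ^ k) = B k z"
        if "z \<in> ball 0 s" for z
        using Bint[of z q k] mem[OF that, of 0] q by simp
      ultimately have "B k holomorphic_on ball 0 s"
        by (rule holomorphic_transform)
      then show ?thesis
        using s by (intro exI[of _ "ball 0 s"]) auto
    qed
    then show ?thesis
      unfolding holomorphic_on_open[OF open_ball] by (metis holomorphic_on_open)
  qed
  define a where "a = (\<lambda>j k. (deriv ^^ j) (B k) 0 / fact j)"
  have aB: "(\<lambda>j. a j k * z ^ j) sums B k z" if "cmod z < 1" for z k
    using holomorphic_power_series[OF Bhol, of z k] that by (simp add: a_def)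
  show thesis
  proof (rule that[of a])
    show "(\<lambda>k. (\<Sum>j. a j k * z ^ j) * w ^ k) sums f (z, w)" if zw: "(z, w) \<in> dom_D m" for z w
    proof -
      have "w \<in> ball 0 (R z)"
        using dom zw dom_D_fst_less_1[OF zw] by simp
      from holomorphic_power_series[OF slice[OF dom_D_fst_less_1[OF zw]] this]
      have "(\<lambda>k. B k z * w ^ k) sums f (z, w)"
        by (simp add: B_def)
      then show ?thesis
        unfolding sums_unique[OF aB[OF dom_D_fst_less_1[OF zw]]] .
    qed
    fix p q :: real and j k :: nat
    assume pq: "0 < p" "0 < q" "(of_real p, of_real q) \<in> dom_D m"
    have "(of_real p * cis s, of_real q) \<in> dom_D m" for s
      using dom_D_mono[OF pq(3), of "of_real p * cis s" "of_real q"] by (simp add: norm_mult)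
    from Bint[OF this pq(2)]
    have "integral {0..2 * pi} (\<lambda>s. integral {0..2 * pi}
          (\<lambda>t. f (of_real p * cis s, of_real q * cis t) * cis (- (real k * t))) * cis (- (real j * s))) =
        integral {0..2 * pi} (\<lambda>s. (2 * pi * of_real q ^ k) * (B k (of_real p * cis s) * cis (- (real j * s))))"
      by (simp add: mult_ac)
    also have "\<dots> = 2 * pi * of_real q ^ k * integral {0..2 * pi} (\<lambda>s. B k (of_real p * cis s) * cis (- (real j * s)))"
      by (rule integral_mult_right)
    also have "integral {0..2 * pi} (\<lambda>s. B k (of_real p * cis s) * cis (- (real j * s))) = 2 * pi * a j k * of_real p ^ j"
      using circle_coefficient[OF Bhol pq(1), of k j] dom_D_fst_less_1[OF pq(3)] pq
      by (simp add: a_def)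
    finally show "integral {0..2 * pi} (\<lambda>s. integral {0..2 * pi}
          (\<lambda>t. f (of_real p * cis s, of_real q * cis t) * cis (- (real k * t))) * cis (- (real j * s))) =
        4 * pi\<^sup>2 * a j k * of_real p ^ j * of_real q ^ k"
      by (simp add: power2_eq_square mult_ac)
  qed
qed

section \<open>The kernel in closed form\<close>

text \<open>With u = r^(2m) this is the Beta function at \<open>(b / (2 * m), j + 1)\<close> divided
  by \<open>2 * m\<close>. Induction on j replaces the substitution: one further factor 1 - u splits
  the integrand into two of the previous kind, the second with b raised by \<open>2 * m\<close>;
  hence b is generalised.\<close>

lemma has_bochner_integral_beta_power:
  fixes b :: real
  assumes m: "m \<ge> 1" and b: "b > 0"
  shows "has_bochner_integral lborel (\<lambda>r. indicator {0<..<1} r *\<^sub>R (r powr (b - 1) * (1 - r ^ (2 * m)) ^ j))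
    (fact j / (2 * m * pochhammer (b / (2 * m)) (Suc j)))"
  using b
proof (induction j arbitrary: b)
  case 0
  have "((\<lambda>x. x powr (b - 1)) has_integral (1 / b)) {0..1}"
    using has_integral_powr_from_0[of "b - 1" 1] 0 by simp
  from nn_integral_has_integral_lebesgue[OF _ this]
  have "(\<integral>\<^sup>+x. ennreal (indicator {0..1} x * x powr (b - 1)) \<partial>lborel) = ennreal (1 / b)"
    by simp
  moreover have "(\<integral>\<^sup>+x. ennreal (indicator {0..1} x * x powr (b - 1)) \<partial>lborel) =
      (\<integral>\<^sup>+x. ennreal (indicator {0<..<1} x *\<^sub>R x powr (b - 1)) \<partial>lborel)"
    by (intro nn_integral_cong_AE, use AE_lborel_singleton[of 0] AE_lborel_singleton[of 1] in eventually_elim)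
       (auto split: split_indicator)
  ultimately have "has_bochner_integral lborel (\<lambda>r. indicator {0<..<1} r *\<^sub>R r powr (b - 1)) (1 / b)"
    using 0 by (intro has_bochner_integral_nn_integral) auto
  then show ?case
    using m by simp
next
  case (Suc j)
  let ?M = "2 * real m"
  have eq: "indicator {0<..<1} r *\<^sub>R (r powr (b - 1) * (1 - r ^ (2 * m)) ^ j) -
        indicator {0<..<1} r *\<^sub>R (r powr (b + ?M - 1) * (1 - r ^ (2 * m)) ^ j) =
        indicator {0<..<1} r *\<^sub>R (r powr (b - 1) * (1 - r ^ (2 * m)) ^ Suc j)" for r :: real
  proof (cases "r \<in> {0<..<1}")
    case True
    have "r powr (b + ?M - 1) = r powr (b - 1) * r powr ?M"
      by (simp add: powr_add[symmetric] algebra_simps)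
    also have "r powr ?M = r ^ (2 * m)"
      using True powr_realpow[of r "2 * m"] by simp
    finally show ?thesis using True by (simp add: algebra_simps)
  qed simp
  define a where "a = b / ?M"
  have a: "a > 0" "(b + ?M) / ?M = a + 1"
    using m Suc.prems by (auto simp: a_def field_simps)
  have P: "pochhammer (a + 1) (Suc j) > 0" "pochhammer (a + 1) j > 0"
    using a by (auto intro!: pochhammer_pos simp del: pochhammer_Suc)
  have "fact j / (?M * pochhammer a (Suc j)) - fact j / (?M * pochhammer (a + 1) (Suc j))
     = fact (Suc j) / (?M * pochhammer a (Suc (Suc j)))"
  proof -
    have 1: "pochhammer a (Suc j) = a * pochhammer (a + 1) j"
      "pochhammer (a + 1) (Suc j) = pochhammer (a + 1) j * (a + 1 + j)"
      "pochhammer a (Suc (Suc j)) = a * (pochhammer (a + 1) j * (a + 1 + j))"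
      by (rule pochhammer_rec, rule pochhammer_Suc)
        (simp only: pochhammer_rec[of a "Suc j"] pochhammer_Suc[of "a + 1" j])
    have g: "a + 1 + j \<noteq> 0" using a by linarith
    show ?thesis unfolding 1
      using P a m g by (simp add: divide_simps) (simp add: algebra_simps)
  qed
  then have val: "fact j / (?M * pochhammer (b / ?M) (Suc j)) - fact j / (?M * pochhammer ((b + ?M) / ?M) (Suc j)) =
      fact (Suc j) / (?M * pochhammer (b / ?M) (Suc (Suc j)))"
    unfolding a(2) a_def[symmetric] .
  have "b + ?M > 0" using Suc.prems by simp
  from has_bochner_integral_diff[OF Suc.IH[OF Suc.prems] Suc.IH[OF this]]
  show ?case unfolding eq by (simp only: val of_nat_mult of_nat_numeral)
qed

text \<open>As \<open>pochhammer a (Suc j) = a * pochhammer (a + 1) j\<close>, this is a times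
  Newton's binomial series with exponent -(a + 1). The shifted index is the one that the reciprocal
  of the Beta integral produces.\<close>

lemma pochhammer_binomial_sums:
  fixes a x :: complex
  assumes "cmod x < 1"
  shows "(\<lambda>j. pochhammer a (Suc j) / fact j * x ^ j) sums (a * (1 - x) powr (- (a + 1)))"
proof -
  have "(\<lambda>j. (- (a + 1) gchoose j) * (- x) ^ j) sums (1 + (- x)) powr (- (a + 1))"
    using assms by (intro gen_binomial_complex) simp
  then have "(\<lambda>j. a * ((- (a + 1) gchoose j) * (- x) ^ j)) sums (a * (1 - x) powr (- (a + 1)))"
    using sums_mult by fastforce
  moreover have "a * ((- (a + 1) gchoose j) * (- x) ^ j) = pochhammer a (Suc j) / fact j * x ^ j" for j
  proof -
    have "(- (a + 1) gchoose j) * (- x) ^ j = ((- 1) ^ j * (- x) ^ j) * (pochhammer (a + 1) j / fact j)"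
      by (simp only: gbinomial_pochhammer minus_minus) simp
    also have "(- 1) ^ j * (- x) ^ j = x ^ j"
      by (simp only: power_mult_distrib[symmetric]) simp
    finally show ?thesis
      by (simp only: pochhammer_rec) simp
  qed
  ultimately show ?thesis by simp
qed

text \<open>Writing a + k b as b (k + 1) + (a - b) leaves the geometric series and its derivative;
  the latter brings in the double pole at q = 1.\<close>

lemma affine_geometric_sums:
  fixes q :: complex
  assumes "cmod q < 1"
  shows "(\<lambda>k. (a + of_nat k * b) * q ^ k) sums ((a + (b - a) * q) / (1 - q)\<^sup>2)"
proof -
  have "(\<lambda>k. b * (of_nat (Suc k) * q ^ k) + (a - b) * q ^ k) sums (b * (1 / (1 - q)\<^sup>2) + (a - b) * (1 / (1 - q)))"
    by (intro sums_add sums_mult geometric_deriv_sums geometric_sums assms)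
  moreover have "b * (1 / (1 - q)\<^sup>2) + (a - b) * (1 / (1 - q)) = (a + (b - a) * q) / (1 - q)\<^sup>2"
    using assms by (auto simp: divide_simps power2_eq_square) (auto simp: algebra_simps)
  ultimately show ?thesis by (simp add: algebra_simps)
qed

text \<open>Measures how far \<open>z * cnj u\<close> stays from 1. It bounds the geometric ratio q
  inside the domain, and its last summand forces equal first coordinates when the bound is attained
  on the closure.\<close>

lemma one_minus_mult_cnj_norm_identity:
  "(cmod (1 - z * cnj u))\<^sup>2 = (1 - (cmod z)\<^sup>2) * (1 - (cmod u)\<^sup>2) + (cmod (z - u))\<^sup>2"
  unfolding cmod_power2 by (simp add: power2_eq_square algebra_simps)

text \<open>The complex conjugate of the kernel, so that it is holomorphic in \<open>\<eta>\<close>.\<close>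

definition szego_form :: "nat \<Rightarrow> complex \<times> complex \<Rightarrow> complex \<times> complex \<Rightarrow> complex" where
  "szego_form m \<zeta> \<eta> =
    (let x = fst \<eta> * cnj (fst \<zeta>);
         q = snd \<eta> * cnj (snd \<zeta>) * (1 - x) powr (- 1 / of_nat m)
     in of_real (2 * m / (4 * pi\<^sup>2 * m powr (2/3))) * (1 - x) powr (- of_real (1 + (m + 2) / (3 * m)))
        * ((of_nat m + 2 - (of_nat m - 1) * q) / (3 * of_nat m * (1 - q)\<^sup>2)))"

text \<open>The two defining inequalities multiply to a bound of
  \<open>(cmod w * cmod w0) ^ (2 * m)\<close> by a product which, by the identity above, is at most
  the square of \<open>cmod (1 - z * cnj z0)\<close>. Taking roots explains the exponent
  -1/m.\<close>

lemma dom_D_quotient_less_1: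
  assumes m: "m \<ge> 1" and "(z, w) \<in> dom_D m" "(z0, w0) \<in> dom_D m"
  shows "cmod (w * cnj w0 * (1 - z * cnj z0) powr (- 1 / of_nat m)) < 1"
proof -
  let ?n = "cmod (1 - z * cnj z0)"
  have zw: "cmod w ^ (2 * m) < 1 - (cmod z)\<^sup>2" "cmod w0 ^ (2 * m) < 1 - (cmod z0)\<^sup>2"
    using assms by (auto simp: dom_D_def)
  have "cmod w ^ (2 * m) * cmod w0 ^ (2 * m) < (1 - (cmod z)\<^sup>2) * (1 - (cmod z0)\<^sup>2)"
    using zw by (intro mult_strict_mono') auto
  also have "\<dots> \<le> ?n\<^sup>2"
    unfolding one_minus_mult_cnj_norm_identity by simp
  finally have "((cmod w * cmod w0) ^ m)\<^sup>2 < ?n\<^sup>2"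
    by (simp add: power_mult_distrib power_mult[symmetric] mult.commute)
  then have lt: "(cmod w * cmod w0) ^ m < ?n"
    by (rule power_less_imp_less_base) simp
  moreover have "0 \<le> (cmod w * cmod w0) ^ m" by simp
  ultimately have n: "?n > 0" by linarith
  have "(?n powr (1 / m)) ^ m = ?n"
    using n m by (simp add: powr_power)
  with lt have "cmod w * cmod w0 < ?n powr (1 / m)"
    by (metis power_less_imp_less_base powr_ge_zero)
  then have "cmod w * cmod w0 * ?n powr (- 1 / m) < ?n powr (1 / m) * ?n powr (- 1 / m)"
    using n by (intro mult_strict_right_mono) auto
  also have "\<dots> = 1"
    using n by (simp add: powr_add[symmetric])
  also have "?n powr (- 1 / m) = cmod ((1 - z * cnj z0) powr (- 1 / of_nat m))"
    using norm_powr_real_powr'[of "- 1 / of_nat m" "1 - z * cnj z0"] by simp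
  finally show ?thesis
    by (simp add: norm_mult)
qed

text \<open>The coefficients in the hypothesis are the reciprocal squared norms of the monomials
  times the conjugated monomials at \<open>(z0, w0)\<close>. The sum over j is a binomial series
  with exponent \<open>- (A k + 1)\<close>; because \<open>A k\<close> is affine in k with slope
  1/m, the remaining sum over k is affine-geometric in q.\<close>

lemma szego_form_sums:
  assumes m: "m \<ge> 1" and D: "(z, w) \<in> dom_D m" "(z0, w0) \<in> dom_D m"
    and a: "\<And>j k. a j k = of_real (2 * real m / (4 * pi\<^sup>2 * real m powr (2/3)) *
        (pochhammer ((3 * real k + real m + 2) / (3 * real m)) (Suc j) / fact j)) * (cnj z0 ^ j * cnj w0 ^ k)"
  shows "(\<lambda>k. (\<Sum>j. a j k * z ^ j) * w ^ k) sums szego_form m (z0, w0) (z, w)"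
proof -
  define K where "K = complex_of_real (2 * m / (4 * pi\<^sup>2 * m powr (2/3)))"
  define x where "x = z * cnj z0"
  define q where "q = w * cnj w0 * (1 - x) powr (- 1 / of_nat m)"
  define c where "c = complex_of_real ((m + 2) / (3 * m))"
  define A where "A = (\<lambda>k. complex_of_real ((3 * k + m + 2) / (3 * m)))"
  have Ac: "A k = c + of_nat k / of_nat m" for k
    using m by (simp add: A_def c_def field_simps)
  have "cmod z < 1" "cmod z0 < 1"
    using D dom_D_fst_less_1 by blast+
  then have x1: "cmod x < 1"
    using mult_strict_mono'[of "cmod z" 1 "cmod z0" 1] by (simp add: x_def norm_mult)
  then have x: "1 - x \<noteq> 0" by auto
  have q1: "cmod q < 1"
    unfolding q_def x_def by (rule dom_D_quotient_less_1[OF m D])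
  have inner: "(\<Sum>j. a j k * z ^ j) = K * cnj w0 ^ k * (A k * (1 - x) powr (- (A k + 1)))" for k
  proof -
    have "(\<lambda>j. K * cnj w0 ^ k * (pochhammer (A k) (Suc j) / fact j * x ^ j)) sums
        (K * cnj w0 ^ k * (A k * (1 - x) powr (- (A k + 1))))"
      by (intro sums_mult pochhammer_binomial_sums x1)
    moreover have "K * cnj w0 ^ k * (pochhammer (A k) (Suc j) / fact j * x ^ j) = a j k * z ^ j" for j
    proof -
      have "a j k = K * (pochhammer (A k) (Suc j) / fact j) * (cnj z0 ^ j * cnj w0 ^ k)"
        unfolding a A_def pochhammer_of_real K_def by (simp add: mult_ac add_ac del: pochhammer_Suc)
      then show ?thesis
        by (simp add: x_def power_mult_distrib mult_ac del: pochhammer_Suc)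
    qed
    ultimately show ?thesis by (simp add: sums_iff)
  qed
  have summand: "(\<Sum>j. a j k * z ^ j) * w ^ k = K * (1 - x) powr (- (1 + c)) * ((c + of_nat k * (1 / of_nat m)) * q ^ k)" for k
  proof -
    have "(1 - x) powr (- (A k + 1)) = (1 - x) powr (- (1 + c)) * (1 - x) powr (of_nat k * (- 1 / of_nat m))"
      by (simp add: powr_add[symmetric] Ac algebra_simps)
    also have "(1 - x) powr (of_nat k * (- 1 / of_nat m)) = ((1 - x) powr (- 1 / of_nat m)) ^ k"
      using x by (simp add: powr_def exp_of_nat_mult[symmetric] mult_ac)
    finally show ?thesis
      unfolding inner by (simp add: q_def power_mult_distrib Ac mult_ac)
  qed
  have "(\<lambda>k. K * (1 - x) powr (- (1 + c)) * ((c + of_nat k * (1 / of_nat m)) * q ^ k)) sums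
     (K * (1 - x) powr (- (1 + c)) * ((c + (1 / of_nat m - c) * q) / (1 - q)\<^sup>2))"
    by (intro sums_mult affine_geometric_sums q1)
  moreover have "c + (1 / of_nat m - c) * q = (of_nat m + 2 - (of_nat m - 1) * q) / (3 * of_nat m)"
    using m by (simp add: c_def field_simps)
  moreover have "szego_form m (z0, w0) (z, w) =
      K * (1 - x) powr (- (1 + c)) * ((of_nat m + 2 - (of_nat m - 1) * q) / (3 * of_nat m * (1 - q)\<^sup>2))"
    by (simp add: szego_form_def Let_def K_def x_def q_def c_def add_ac)
  ultimately show ?thesis
    unfolding summand by (simp only: divide_divide_eq_left)
qed

section \<open>Boundary behaviour of the closed form\<close>

text \<open>For m positive, \<open>t ^ (2 * m) \<le> t\<^sup>2\<close>, so the scaling shrinks both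
  terms by at least the factor \<open>t\<^sup>2 < 1\<close>.\<close>

lemma scaled_mem_dom_D:
  assumes "rho m p \<le> 0" "0 \<le> t" "t < 1" "m \<ge> 1"
  shows "t *\<^sub>R p \<in> dom_D m"
proof -
  obtain z w where p: "p = (z, w)" by force
  have t: "t\<^sup>2 < 1" "t ^ (2 * m) \<le> t\<^sup>2"
    using assms power_decreasing[of 2 "2 * m" t] by (auto simp: abs_square_less_1)
  have "(cmod (t *\<^sub>R z))\<^sup>2 + cmod (t *\<^sub>R w) ^ (2 * m) = t\<^sup>2 * (cmod z)\<^sup>2 + t ^ (2 * m) * cmod w ^ (2 * m)"
    using assms by (simp add: power_mult_distrib)
  also have "\<dots> \<le> t\<^sup>2 * (cmod z)\<^sup>2 + t\<^sup>2 * cmod w ^ (2 * m)"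
    using t by (intro add_left_mono mult_right_mono) auto
  also have "\<dots> = t\<^sup>2 * ((cmod z)\<^sup>2 + cmod w ^ (2 * m))"
    by (simp add: distrib_left)
  also have "\<dots> \<le> t\<^sup>2 * 1"
    using assms(1) p by (intro mult_left_mono) (auto simp: rho_def)
  finally show ?thesis
    using t p by (simp add: dom_D_def)
qed

lemma continuous_on_rho [continuous_intros]: "continuous_on A (rho m)"
  unfolding rho_def case_prod_beta by (intro continuous_intros)

text \<open>One inclusion holds because the condition is closed. For the other, a point with
  \<open>rho m p \<le> 0\<close> is the limit of its contractions towards 0, which lie in the
  domain.\<close>

lemma closure_dom_D:
  assumes "m \<ge> 1"
  shows "closure (dom_D m) = {p. rho m p \<le> 0}"
proof
  have "closed (rho m -` {..0})"
    by (intro closed_vimage closed_atMost continuous_on_rho)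
  moreover have "dom_D m \<subseteq> rho m -` {..0}"
    by (auto simp: dom_D_def rho_def)
  ultimately show "closure (dom_D m) \<subseteq> {p. rho m p \<le> 0}"
    using closure_minimal[of "dom_D m" "rho m -` {..0}"] by auto
  show "{p. rho m p \<le> 0} \<subseteq> closure (dom_D m)"
  proof clarify
    fix p assume p: "rho m p \<le> 0"
    let ?t = "\<lambda>n. 1 - 1 / of_nat (Suc n) :: real"
    have "(\<lambda>n. ?t n *\<^sub>R p) \<longlonglongrightarrow> (1 - 0) *\<^sub>R p"
      by (intro tendsto_intros) (rule LIMSEQ_Suc[OF lim_1_over_n])
    moreover have "?t n *\<^sub>R p \<in> dom_D m" for n
      by (rule scaled_mem_dom_D[OF p _ _ assms]) auto
    ultimately show "p \<in> closure (dom_D m)"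
      unfolding closure_sequential by (intro exI[of _ "\<lambda>n. ?t n *\<^sub>R p"]) auto
  qed
qed

lemma frontier_dom_D:
  assumes "m \<ge> 1"
  shows "frontier (dom_D m) = {p. rho m p = 0}"
proof -
  have "dom_D m = {p. rho m p < 0}"
    by (auto simp: dom_D_def rho_def)
  then show ?thesis
    unfolding frontier_def closure_dom_D[OF assms] interior_open[OF open_dom_D] by auto
qed

text \<open>At a point off the boundary diagonal the closed form is continuous in the whole space,
  not only from inside the domain: \<open>1 - x\<close> avoids the branch cut of \<open>powr\<close>
  and \<open>1 - q\<close> does not vanish. So a full ball serves as \<open>V\<close>.\<close>

lemma szego_form_bounded_near:
  assumes m: "m \<ge> 1" and cl: "p \<in> closure (dom_D m)" "u \<in> closure (dom_D m)"
    and nd: "(p, u) \<notin> boundary_diagonal m"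
  obtains V where "open V" "(p, u) \<in> V" "bounded ((\<lambda>(\<zeta>, \<eta>). szego_form m \<zeta> \<eta>) ` V)"
proof -
  obtain z w z' w' where pu: "p = (z, w)" "u = (z', w')"
    by (metis surj_pair)
  have le: "(cmod z)\<^sup>2 + cmod w ^ (2 * m) \<le> 1" "(cmod z')\<^sup>2 + cmod w' ^ (2 * m) \<le> 1"
    using cl unfolding closure_dom_D[OF m] pu by (auto simp: rho_def)
  define x where "x = z' * cnj z"
  define q where "q = w' * cnj w * (1 - x) powr (- 1 / of_nat m)"
  have w0: "0 \<le> cmod w ^ (2 * m)" "0 \<le> cmod w' ^ (2 * m)" by auto
  have zz: "0 \<le> 1 - (cmod z)\<^sup>2" "0 \<le> 1 - (cmod z')\<^sup>2" using le w0 by linarith+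
  have diag: "z = z' \<Longrightarrow> w = w' \<Longrightarrow> (cmod z)\<^sup>2 + cmod w ^ (2 * m) = 1 \<Longrightarrow> False"
    using nd unfolding boundary_diagonal_def frontier_dom_D[OF m] pu by (auto simp: rho_def)
  note id = one_minus_mult_cnj_norm_identity[of z' z, folded x_def]
  \<comment> \<open>If x = 1, both nonnegative summands of the identity vanish. Then z' = z has
    modulus 1, which leaves no room for w and w', and the two points are one boundary point.\<close>
  have x1: "x \<noteq> 1"
  proof
    assume "x = 1"
    with id have e: "(1 - (cmod z')\<^sup>2) * (1 - (cmod z)\<^sup>2) + (cmod (z' - z))\<^sup>2 = 0" by simp
    moreover have "(1 - (cmod z')\<^sup>2) * (1 - (cmod z)\<^sup>2) \<ge> 0" using zz by simp
    moreover have "(cmod (z' - z))\<^sup>2 \<ge> 0" by simp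
    ultimately have "(cmod (z' - z))\<^sup>2 = 0" by linarith
    then have zz': "z' = z" by simp
    with e have z1: "(cmod z)\<^sup>2 = 1" by simp
    then have "cmod w ^ (2 * m) = 0" "cmod w' ^ (2 * m) = 0"
      using le w0 zz' by auto
    then have "w = 0" "w' = 0" by auto
    then show False using diag zz' z1 m by simp
  qed
  have "(cmod z)\<^sup>2 \<le> 1" "(cmod z')\<^sup>2 \<le> 1" using zz by auto
  then have "cmod z \<le> 1" "cmod z' \<le> 1"
    by (simp_all add: abs_square_le_1)
  then have "cmod x \<le> 1"
    using mult_mono[of "cmod z'" 1 "cmod z" 1] by (simp add: x_def norm_mult)
  \<comment> \<open>The principal branch of \<open>powr\<close> is continuous off this ray. As x has
    modulus at most 1, \<open>1 - x\<close> lies in the closed right half-plane and could meet the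
    ray only at 0.\<close>
  have nonpos: "1 - x \<notin> \<real>\<^sub>\<le>\<^sub>0"
  proof
    assume "1 - x \<in> \<real>\<^sub>\<le>\<^sub>0"
    then have "Im x = 0" "Re x \<ge> 1" by (auto simp: complex_nonpos_Reals_iff)
    moreover have "Re x \<le> 1" using \<open>cmod x \<le> 1\<close> complex_Re_le_cmod[of x] by linarith
    ultimately show False using x1 by (auto simp: complex_eq_iff)
  qed
  \<comment> \<open>If q = 1, there is equality throughout in |w' w|^(2m) \<le> (1 - |z'|^2) (1 -
    |z|^2) \<le> |1 - x|^2. The second equality gives z' = z, the first puts both points on the
    boundary, so w and w' have equal modulus. Finally \<open>w' * cnj w\<close> is a positive real,
    so w and w' also have the same argument.\<close>
  have q1: "q \<noteq> 1"
  proof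
    assume q: "q = 1"
    let ?n = "cmod (1 - x)"
    have n: "?n > 0" using x1 by simp
    have "cmod q = cmod w' * cmod w * ?n powr (- 1 / m)"
      using norm_powr_real_powr'[of "- 1 / of_nat m" "1 - x"] by (simp add: q_def norm_mult)
    then have "cmod w' * cmod w * ?n powr (- 1 / m) * ?n powr (1 / m) = ?n powr (1 / m)"
      using q by simp
    then have ww: "cmod w' * cmod w = ?n powr (1 / m)"
      using n by (simp add: mult.assoc powr_add[symmetric])
    have "(cmod w' * cmod w) ^ m = ?n"
      unfolding ww using n m by (simp add: powr_power)
    moreover have "((cmod w' * cmod w) ^ m)\<^sup>2 = cmod w' ^ (2 * m) * cmod w ^ (2 * m)"
      by (simp add: power_mult_distrib power_mult[symmetric] mult.commute)
    ultimately have sq: "cmod w' ^ (2 * m) * cmod w ^ (2 * m) = ?n\<^sup>2"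
      by simp
    have "cmod w' ^ (2 * m) * cmod w ^ (2 * m) \<le> (1 - (cmod z')\<^sup>2) * (1 - (cmod z)\<^sup>2)"
      using le w0 zz by (intro mult_mono) auto
    with sq id have d: "(cmod (z' - z))\<^sup>2 \<le> 0"
      and eq: "(1 - (cmod z')\<^sup>2) * (1 - (cmod z)\<^sup>2) \<le> cmod w' ^ (2 * m) * cmod w ^ (2 * m) + 0"
      by auto
    from d have zz': "z' = z" by simp
    have xr: "x = of_real ((cmod z)\<^sup>2)"
      by (simp only: x_def zz' complex_norm_square)
    define y where "y = 1 - (cmod z)\<^sup>2"
    have x_y: "1 - x = of_real y" and y: "y > 0"
      using zz x1 by (auto simp: y_def xr) (metis of_real_1 of_real_power order_less_le)
    have "w' * cnj w = of_real (y powr (1 / m))"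
    proof -
      have "(1 - x) powr (- 1 / of_nat m) = of_real (y powr (- 1 / m))"
        unfolding x_y using y powr_of_real[of y "- 1 / m"] by simp
      then have "w' * cnj w * of_real (y powr (- 1 / m)) * of_real (y powr (1 / m)) = of_real (y powr (1 / m))"
        using q by (simp add: q_def)
      then have "w' * cnj w * of_real (y powr (- 1 / m) * y powr (1 / m)) = of_real (y powr (1 / m))"
        by (simp only: of_real_mult mult.assoc)
      then show ?thesis
        using y by (simp add: powr_add[symmetric])
    qed
    moreover
    have wy: "cmod w' ^ (2 * m) * cmod w ^ (2 * m) = y * y" "cmod w ^ (2 * m) \<le> y" "cmod w' ^ (2 * m) \<le> y"
      using sq le zz' y unfolding x_y norm_of_real by (auto simp: power2_eq_square[of "1 - (cmod z)\<^sup>2"] y_def)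
    have "cmod w ^ (2 * m) = y"
    proof (rule ccontr)
      assume "cmod w ^ (2 * m) \<noteq> y"
      with wy have "cmod w ^ (2 * m) < y" by simp
      then have "y * cmod w ^ (2 * m) < y * y"
        using y by simp
      moreover have "cmod w' ^ (2 * m) * cmod w ^ (2 * m) \<le> y * cmod w ^ (2 * m)"
        using wy w0 by (intro mult_right_mono) auto
      ultimately have "cmod w' ^ (2 * m) * cmod w ^ (2 * m) < y * y" by linarith
      then show False using wy by simp
    qed
    moreover from this wy y have "cmod w' ^ (2 * m) = y" by simp
    ultimately have "cmod w = cmod w'" "w' * cnj w = of_real (y powr (1 / m))"
      using power_eq_imp_eq_base[of "cmod w" "2 * m" "cmod w'"] m by auto
    moreover have "w' * cnj w' = of_real ((cmod w')\<^sup>2)" by (simp only: complex_norm_square)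
    ultimately have "w' * cnj w = w' * cnj w'"
      by (metis abs_of_nonneg mult.commute norm_mult norm_of_real power2_eq_square complex_mod_cnj norm_ge_zero powr_ge_zero)
    moreover have "w' \<noteq> 0"
    proof
      assume "w' = 0"
      then have "cmod w' ^ (2 * m) = 0" using m by simp
      then show False using \<open>cmod w' ^ (2 * m) = y\<close> y by linarith
    qed
    ultimately have "w = w'" by simp
    with diag zz' \<open>cmod w ^ (2 * m) = y\<close> show False by (simp add: y_def)
  qed
  have nz: "3 * of_nat m * (1 - q)\<^sup>2 \<noteq> 0" using q1 m by simp
  have "isCont (\<lambda>y. szego_form m (fst y) (snd y)) (p, u)"
    unfolding isCont_def szego_form_def Let_def
    using nonpos nz unfolding x_def q_def pu
    by (intro tendsto_intros) auto
  then obtain d where d: "d > 0" "\<And>y. dist y (p, u) < d \<Longrightarrow>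
      dist (szego_form m (fst y) (snd y)) (szego_form m p u) < 1"
    unfolding continuous_at_eps_delta by (metis fst_conv snd_conv zero_less_one)
  have "(\<lambda>(\<zeta>, \<eta>). szego_form m \<zeta> \<eta>) ` ball (p, u) d \<subseteq> ball (szego_form m p u) 1"
    using d(2) by (force simp: dist_commute)
  then show thesis
    using d(1) by (intro that[of "ball (p, u) d"]) (auto intro: bounded_subset[OF bounded_ball])
qed

text \<open>The modulus is \<open>K\<close> times that of the numerator, divided by
  \<open>A\<close>; as the numerator is bounded below, it remains to show that \<open>A\<close>
  tends to 0. If w is nonzero, \<open>1 - x\<close> has a positive limit and q tends to 1. If w = 0,
  x tends to 1 while q may fail to converge, but \<open>1 - q\<close> stays bounded by 2 and the
  positive power of \<open>1 - x\<close> decides.\<close>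

lemma szego_form_at_top:
  assumes m: "m \<ge> 1" and p: "p \<in> frontier (dom_D m)"
  shows "filterlim (\<lambda>(\<zeta>, \<eta>). cmod (szego_form m \<zeta> \<eta>)) at_top (at (p, p) within dom_D m \<times> dom_D m)"
proof -
  obtain z w where pzw: "p = (z, w)" by force
  have p1: "(cmod z)\<^sup>2 + cmod w ^ (2 * m) = 1"
    using p unfolding frontier_dom_D[OF m] pzw by (auto simp: rho_def)
  let ?F = "at (p, p) within dom_D m \<times> dom_D m"
  define x where "x = (\<lambda>y :: (complex \<times> complex) \<times> (complex \<times> complex). fst (snd y) * cnj (fst (fst y)))"
  define q where "q = (\<lambda>y. snd (snd y) * cnj (snd (fst y)) * (1 - x y) powr (- 1 / of_nat m))"
  define e where "e = 1 + (real m + 2) / (3 * real m)"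
  have e: "e > 0" by (simp add: e_def add_pos_nonneg)
  define K where "K = 2 * m / (4 * pi\<^sup>2 * m powr (2/3)) / (3 * m)"
  have K: "K > 0" using m by (simp add: K_def)
  define A where "A = (\<lambda>y. cmod (1 - x y) powr e * (cmod (1 - q y))\<^sup>2)"
  have fstp: "(fst \<longlongrightarrow> p) ?F" "(snd \<longlongrightarrow> p) ?F"
    by (auto intro!: tendsto_eq_intros)
  have xlim: "((\<lambda>y. 1 - x y) \<longlongrightarrow> 1 - z * cnj z) ?F"
    unfolding x_def by (intro tendsto_intros fstp tendsto_eq_intros) (auto simp: pzw intro: fstp tendsto_eq_intros)
  have zz: "1 - z * cnj z = of_real (cmod w ^ (2 * m))"
    using p1 by (simp add: complex_norm_square[symmetric]) (metis add_diff_cancel_left' of_real_1 of_real_diff of_real_power)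
  have ev: "eventually (\<lambda>y. y \<in> dom_D m \<times> dom_D m) ?F"
    by (simp add: eventually_at_filter)
  have x1: "cmod (x y) < 1" and q1: "cmod (q y) < 1" if y: "y \<in> dom_D m \<times> dom_D m" for y
  proof -
    have D: "fst y \<in> dom_D m" "snd y \<in> dom_D m" using y by auto
    have "cmod (fst (fst y)) < 1" "cmod (fst (snd y)) < 1"
      using D dom_D_fst_less_1 by (metis prod.collapse)+
    then show "cmod (x y) < 1"
      using mult_strict_mono'[of "cmod (fst (snd y))" 1 "cmod (fst (fst y))" 1] by (simp add: x_def norm_mult)
    show "cmod (q y) < 1"
      unfolding q_def x_def using D dom_D_quotient_less_1[OF m] by (metis prod.collapse)
  qed
  have Alim: "(A \<longlongrightarrow> 0) ?F"
  proof (cases "w = 0")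
    case False
    let ?y = "cmod w ^ (2 * m)"
    have y: "?y > 0" using False by simp
    then have np: "complex_of_real (cmod w) ^ (2 * m) \<notin> \<real>\<^sub>\<le>\<^sub>0"
      unfolding of_real_power[symmetric] by (simp add: complex_nonpos_Reals_iff del: of_real_power)
    have "(q \<longlongrightarrow> w * cnj w * of_real ?y powr (- 1 / of_nat m)) ?F"
      unfolding q_def using y xlim unfolding zz
      by (intro tendsto_intros) (use np in \<open>auto simp: pzw intro!: tendsto_eq_intros fstp\<close>)
    moreover have "w * cnj w * of_real ?y powr (- 1 / of_nat m) = 1"
    proof -
      have "?y powr (- 1 / m) = (cmod w powr (2 * m)) powr (- 1 / m)"
        using False powr_realpow[of "cmod w" "2 * m"] by simp
      also have "\<dots> = 1 / (cmod w)\<^sup>2"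
        using m False by (simp add: powr_powr powr_minus_divide)
      finally have "of_real ?y powr (- 1 / of_nat m) = complex_of_real (1 / (cmod w)\<^sup>2)"
        using powr_of_real[of ?y "- 1 / m"] y by simp
      moreover have "complex_of_real ((cmod w)\<^sup>2) * complex_of_real (1 / (cmod w)\<^sup>2) = 1"
        unfolding of_real_mult[symmetric] using False by simp
      ultimately show ?thesis
        unfolding complex_norm_square[symmetric] by simp
    qed
    ultimately have "(q \<longlongrightarrow> 1) ?F" by simp
    then have "(A \<longlongrightarrow> cmod (of_real ?y) powr e * (cmod (1 - 1))\<^sup>2) ?F"
      unfolding A_def using e xlim unfolding zz
      by (intro tendsto_intros) auto
    then show ?thesis by simp
  next
    case True
    then have "((\<lambda>y. 1 - x y) \<longlongrightarrow> 0) ?F" using xlim m unfolding zz by (simp add: zero_power)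
    then have lim: "((\<lambda>y. 4 * cmod (1 - x y) powr e) \<longlongrightarrow> 4 * 0) ?F"
      by (intro tendsto_mult tendsto_const tendsto_powr'[where a = 0 and b = e, simplified, OF tendsto_norm_zero])
        (use e in auto)
    show ?thesis
    proof (rule tendsto_sandwich[OF _ _ tendsto_const lim[simplified]])
      show "eventually (\<lambda>y. 0 \<le> A y) ?F" by (simp add: A_def)
      show "eventually (\<lambda>y. A y \<le> 4 * cmod (1 - x y) powr e) ?F"
        using ev
      proof eventually_elim
        case (elim y)
        have "cmod (1 - q y) \<le> 2"
          using q1[OF elim] norm_triangle_ineq4[of 1 "q y"] by simp
        then have "(cmod (1 - q y))\<^sup>2 \<le> 2\<^sup>2" by (intro power_mono) auto
        then show ?case
          using mult_left_mono[of "(cmod (1 - q y))\<^sup>2" 4 "cmod (1 - x y) powr e"] by (simp add: A_def mult.commute)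
      qed
    qed
  qed
  have bound: "eventually (\<lambda>y. K * 3 * inverse (A y) \<le> (\<lambda>(\<zeta>, \<eta>). cmod (szego_form m \<zeta> \<eta>)) y) ?F"
    using ev
  proof eventually_elim
    case (elim y)
    have n: "cmod (1 - x y) > 0" using x1[OF elim] by auto
    have "cmod (of_nat m - 1) = cmod (of_nat (m - 1))"
      using m by simp
    also have "\<dots> = real m - 1"
      unfolding norm_of_nat using m by simp
    finally have "cmod ((of_nat m - 1) * q y) \<le> (real m - 1) * 1"
      unfolding norm_mult using q1[OF elim] m by (intro mult_mono) auto
    moreover have "cmod (of_nat m + 2) = real m + 2"
      by (metis norm_of_nat of_nat_add of_nat_numeral)
    ultimately have "3 \<le> cmod (of_nat m + 2) - cmod ((of_nat m - 1) * q y)"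
      by (simp only:) simp
    then have num: "3 \<le> cmod (of_nat m + 2 - (of_nat m - 1) * q y)"
      using norm_triangle_ineq2 order_trans by blast
    have "cmod ((1 - x y) powr (- of_real e)) = cmod (1 - x y) powr (- e)"
      using norm_powr_real_powr'[of "- of_real e" "1 - x y"] by simp
    moreover define N where "N = of_nat m + 2 - (of_nat m - 1) * q y"
    moreover have "szego_form m (fst y) (snd y) = of_real (2 * m / (4 * pi\<^sup>2 * m powr (2/3))) *
        (1 - x y) powr (- of_real e) * (N / (3 * of_nat m * (1 - q y)\<^sup>2))"
      by (simp only: szego_form_def Let_def x_def q_def e_def N_def of_nat_mult of_nat_numeral)
    ultimately have "cmod (szego_form m (fst y) (snd y)) =
        2 * m / (4 * pi\<^sup>2 * m powr (2/3)) * cmod (1 - x y) powr (- e) * (cmod N / (3 * m * (cmod (1 - q y))\<^sup>2))"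
      by (simp add: norm_mult norm_divide norm_power)
    then have "cmod (szego_form m (fst y) (snd y)) =
       K * (cmod (of_nat m + 2 - (of_nat m - 1) * q y)) * inverse (A y)"
      unfolding A_def K_def N_def[symmetric] powr_minus divide_inverse inverse_mult_distrib
      by (simp only: mult_ac)
    moreover have "K * 3 * inverse (A y) \<le> K * (cmod (of_nat m + 2 - (of_nat m - 1) * q y)) * inverse (A y)"
      using num K by (intro mult_right_mono mult_left_mono) (auto simp: A_def)
    ultimately show ?case by (simp add: case_prod_beta)
  qed
  have "filterlim (\<lambda>y. inverse (A y)) at_top ?F"
  proof (rule filterlim_inverse_at_top[OF Alim])
    show "eventually (\<lambda>y. 0 < A y) ?F"
      using ev
    proof eventually_elim
      case (elim y)
      have "x y \<noteq> 1" "q y \<noteq> 1" using x1[OF elim] q1[OF elim] by auto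
      then show ?case by (simp add: A_def)
    qed
  qed
  then have "filterlim (\<lambda>y. K * 3 * inverse (A y)) at_top ?F"
    using K by (intro filterlim_tendsto_pos_mult_at_top[OF tendsto_const]) auto
  then show ?thesis
    by (rule filterlim_at_top_mono[OF _ bound])
qed

section \<open>Approach regions\<close>

text \<open>The gradient for the real inner product. It is written with a power of
  \<open>(cmod (snd p))\<^sup>2\<close> because \<open>rho m\<close> is polynomial in
  \<open>snd p \<bullet> snd p\<close>, hence differentiable also where \<open>snd p\<close>
  vanishes.\<close>

definition rho_gradient :: "nat \<Rightarrow> complex \<times> complex \<Rightarrow> complex \<times> complex" where
  "rho_gradient m p = (2 *\<^sub>R fst p, (2 * real m * (cmod (snd p))\<^sup>2 ^ (m - 1)) *\<^sub>R snd p)"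

lemma has_derivative_rho: "(rho m has_derivative (\<lambda>h. h \<bullet> rho_gradient m p)) (at p)"
proof -
  have "rho m = (\<lambda>p. fst p \<bullet> fst p + (snd p \<bullet> snd p) ^ m - 1)"
    by (auto simp: rho_def power_mult power2_norm_eq_inner)
  then show ?thesis
    unfolding rho_gradient_def
    by (auto intro!: derivative_eq_intros simp: inner_prod_def power2_norm_eq_inner inner_commute)
qed

lemma outward_normal_eq: "outward_normal m p = sgn (rho_gradient m p)"
proof -
  have "(THE D. GDERIV (rho m) p :> D) = rho_gradient m p"
  proof (rule the_equality)
    show "GDERIV (rho m) p :> rho_gradient m p"
      unfolding gderiv_def by (rule has_derivative_rho)
    fix D assume "GDERIV (rho m) p :> D"
    then have "(\<lambda>h. h \<bullet> D) = (\<lambda>h. h \<bullet> rho_gradient m p)"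
      unfolding gderiv_def by (rule has_derivative_unique) (rule has_derivative_rho)
    then show "D = rho_gradient m p"
      by (metis inner_commute vector_eq_rdot)
  qed
  then show ?thesis by (simp add: outward_normal_def)
qed

text \<open>By homogeneity in each variable the product is 2 (|z|^2 + m |w|^(2m)), which is at least
  2 on the boundary. So the gradient does not vanish and the radius is transversal to the boundary;
  this is what makes radial approach non-tangential.\<close>

lemma inner_rho_gradient_pos:
  assumes "m \<ge> 1" "rho m p = 0"
  shows "p \<bullet> rho_gradient m p > 0"
proof -
  obtain z w where p: "p = (z, w)" by force
  have eq: "p \<bullet> rho_gradient m p = 2 * ((cmod z)\<^sup>2 + m * (cmod w)\<^sup>2 ^ m)"
    using assms(1) by (cases m) (simp_all add: p rho_gradient_def power2_norm_eq_inner)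
  have "1 = (cmod z)\<^sup>2 + 1 * (cmod w)\<^sup>2 ^ m"
    using assms(2) by (simp add: p rho_def power_mult)
  also have "\<dots> \<le> (cmod z)\<^sup>2 + m * (cmod w)\<^sup>2 ^ m"
    using assms(1) by (intro add_left_mono mult_right_mono) auto
  finally show ?thesis unfolding eq by simp
qed

lemma norm_outward_normal:
  assumes "m \<ge> 1" "rho m p = 0"
  shows "norm (outward_normal m p) = 1"
  using inner_rho_gradient_pos[OF assms] by (auto simp: outward_normal_eq norm_sgn)

lemma continuous_on_outward_normal:
  assumes "m \<ge> 1"
  shows "continuous_on {p. rho m p = 0} (outward_normal m)"
proof -
  have "continuous_on {p. rho m p = 0} (\<lambda>p. sgn (rho_gradient m p))"
    unfolding sgn_div_norm rho_gradient_def
    using inner_rho_gradient_pos[OF assms]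
    by (intro continuous_intros) (fastforce simp: rho_gradient_def)
  then show ?thesis by (simp add: outward_normal_eq[abs_def])
qed

lemma infdist_hyperplane:
  fixes n :: "'a :: euclidean_space"
  assumes "norm n = 1"
  shows "infdist z {x. (x - p) \<bullet> n = 0} = \<bar>(z - p) \<bullet> n\<bar>"
proof (rule antisym)
  let ?H = "{x. (x - p) \<bullet> n = 0}"
  have nn: "n \<bullet> n = 1" using assms by (simp add: norm_eq_1)
  have "z - ((z - p) \<bullet> n) *\<^sub>R n \<in> ?H"
    using nn by (simp add: inner_diff_left)
  from infdist_le[OF this, of z] show "infdist z ?H \<le> \<bar>(z - p) \<bullet> n\<bar>"
    using assms by (simp add: dist_norm)
  have "\<bar>(z - p) \<bullet> n\<bar> \<le> dist z x" if "x \<in> ?H" for x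
  proof -
    have "(z - p) \<bullet> n = (z - x) \<bullet> n" using that by (simp add: inner_diff_left)
    then show ?thesis using Cauchy_Schwarz_ineq2[of "z - x" n] assms by (simp add: dist_norm)
  qed
  moreover have "?H \<noteq> {}"
    by (rule ex_in_conv[THEN iffD1]) (auto intro: exI[of _ p])
  ultimately show "\<bar>(z - p) \<bullet> n\<bar> \<le> infdist z ?H"
    by (simp only: infdist_def if_False) (rule cINF_greatest)
qed

text \<open>The maximal function is lower semicontinuous, because \<open>z \<in> approach_region m \<alpha> \<xi>\<close> is an
  open condition on \<open>\<xi>\<close> for fixed \<open>z\<close>.\<close>

lemma nt_maximal_measurable:
  assumes m: "m \<ge> 1"
  shows "nt_maximal m \<alpha> f \<in> borel_measurable (restrict_space borel (frontier (dom_D m)))"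
proof (rule borel_measurableI_greater)
  let ?M = "frontier (dom_D m)"
  fix c :: ennreal
  have cont: "continuous_on ?M (outward_normal m)"
    using continuous_on_outward_normal[OF m] by (simp add: frontier_dom_D[OF m])
  have inf: "infdist z (tangent_plane m \<xi>) = \<bar>(z - \<xi>) \<bullet> outward_normal m \<xi>\<bar>" if "\<xi> \<in> ?M" for z \<xi>
    unfolding tangent_plane_def
    using that by (intro infdist_hyperplane norm_outward_normal m) (simp add: frontier_dom_D[OF m])
  have op: "\<exists>T. open T \<and> {\<xi> \<in> ?M. z \<in> approach_region m \<alpha> \<xi>} = T \<inter> ?M" if "z \<in> dom_D m" for z
  proof -
    let ?d = "\<lambda>\<xi>. min (infdist z ?M) \<bar>(z - \<xi>) \<bullet> outward_normal m \<xi>\<bar>"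
    let ?g = "\<lambda>\<xi>. min ((1 + \<alpha>) * ?d \<xi> - cmod (cdot_cnj (\<xi> - z) (outward_normal m \<xi>))) (\<alpha> * ?d \<xi> - (norm (\<xi> - z))\<^sup>2)"
    have eq: "{\<xi> \<in> ?M. z \<in> approach_region m \<alpha> \<xi>} = ?M \<inter> ?g -` {0<..}"
      using that by (auto simp: approach_region_def delta_def inf)
    have d: "continuous_on ?M ?d"
      by (intro continuous_on_min continuous_on_const continuous_on_rabs continuous_on_inner
          continuous_on_diff continuous_on_id cont)
    have "continuous_on ?M (\<lambda>\<xi>. cdot_cnj (\<xi> - z) (outward_normal m \<xi>))"
      unfolding cdot_cnj_def
      by (intro continuous_on_add continuous_on_mult continuous_on_cnj continuous_on_fst continuous_on_snd
          continuous_on_diff continuous_on_const continuous_on_id cont)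
    then have "continuous_on ?M ?g"
      by (intro continuous_on_min continuous_on_diff continuous_on_mult continuous_on_const d
          continuous_on_norm continuous_on_power continuous_on_id)
    then have "openin (top_of_set ?M) (?M \<inter> ?g -` {0<..})"
      by (simp add: continuous_openin_preimage_gen)
    then show ?thesis unfolding eq by (auto simp: openin_open)
  qed
  then obtain T where T: "\<And>z. z \<in> dom_D m \<Longrightarrow> open (T z) \<and> {\<xi> \<in> ?M. z \<in> approach_region m \<alpha> \<xi>} = T z \<inter> ?M"
    by metis
  \<comment> \<open>The union over z is uncountable, so it is the relative openness of each piece,
    not its measurability, that makes the superlevel set Borel.\<close>
  have "{\<xi> \<in> space (restrict_space borel ?M). c < nt_maximal m \<alpha> f \<xi>} =
      (\<Union>z\<in>{z \<in> dom_D m. c < ennreal (cmod (f z))}. {\<xi> \<in> ?M. z \<in> approach_region m \<alpha> \<xi>})"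
    by (auto simp: nt_maximal_def less_SUP_iff approach_region_def space_restrict_space)
  also have "\<dots> = ?M \<inter> (\<Union>z\<in>{z \<in> dom_D m. c < ennreal (cmod (f z))}. T z)"
    using T by auto
  also have "\<dots> \<in> sets (restrict_space borel ?M)"
    unfolding sets_restrict_space using T by (intro imageI borel_open open_UN) auto
  finally show "{\<xi> \<in> space (restrict_space borel ?M). c < nt_maximal m \<alpha> f \<xi>} \<in> sets (restrict_space borel ?M)" .
qed

section \<open>Torus symmetry and radial approach to the boundary\<close>

definition torus_rotation :: "real \<Rightarrow> real \<Rightarrow> complex \<times> complex \<Rightarrow> complex \<times> complex" where
  "torus_rotation s t p = (cis s * fst p, cis t * snd p)"

lemma norm_torus_rotation [simp]: "norm (torus_rotation s t p) = norm p"
  by (simp add: torus_rotation_def norm_prod_def norm_mult)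

lemma torus_rotation_diff: "torus_rotation s t (p - u) = torus_rotation s t p - torus_rotation s t u"
  by (simp add: torus_rotation_def algebra_simps)

lemma torus_rotation_scaleR: "torus_rotation s t (r *\<^sub>R p) = r *\<^sub>R torus_rotation s t p"
  by (simp add: torus_rotation_def)

lemma torus_rotation_inverse: "torus_rotation s t (torus_rotation (- s) (- t) p) = p"
  by (simp add: torus_rotation_def mult.assoc[symmetric] cis_mult)

lemma inner_torus_rotation [simp]: "torus_rotation s t p \<bullet> torus_rotation s t u = p \<bullet> u"
proof -
  have "(cis a * x) \<bullet> (cis a * y) = x \<bullet> y" for a x y
  proof -
    have "(cis a * x) \<bullet> (cis a * y) = ((cos a)\<^sup>2 + (sin a)\<^sup>2) * (x \<bullet> y)"
      by (simp only: inner_complex_def times_complex.sel cis.sel) algebra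
    then show ?thesis by simp
  qed
  then show ?thesis by (simp add: torus_rotation_def inner_prod_def)
qed

lemma rho_torus_rotation [simp]: "rho m (torus_rotation s t p) = rho m p"
  by (simp add: rho_def torus_rotation_def norm_mult case_prod_beta)

lemma outward_normal_torus_rotation:
  "outward_normal m (torus_rotation s t p) = torus_rotation s t (outward_normal m p)"
proof -
  have "rho_gradient m (torus_rotation s t p) = torus_rotation s t (rho_gradient m p)"
    by (simp add: rho_gradient_def torus_rotation_def norm_mult)
  then show ?thesis
    by (simp add: outward_normal_eq sgn_div_norm torus_rotation_scaleR)
qed

text \<open>Each component of the normal at p is a real multiple of the same component of p, so the
  complex product is real. Along the radius the first approach condition therefore compares the
  distance to the tangent plane with \<open>delta\<close>.\<close>

lemma cdot_cnj_outward_normal: "cdot_cnj p (outward_normal m p) = of_real (p \<bullet> outward_normal m p)"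
proof -
  have "x * cnj (a *\<^sub>R x) = of_real (x \<bullet> (a *\<^sub>R x))" for a x
    by (simp add: complex_eq_iff inner_complex_def algebra_simps)
  then show ?thesis
    by (simp add: cdot_cnj_def outward_normal_eq sgn_div_norm rho_gradient_def inner_prod_def)
qed

text \<open>The point \<open>r \<xi>\<close> has distance \<open>(1 - r) (\<xi> \<bullet> \<nu>)\<close> from the tangent plane; the factor
  \<open>(1 + \<alpha> / 2) / (1 + \<alpha>) < 1\<close> by which the ball is smaller leaves room for the strict inequality
  with \<open>1 + \<alpha>\<close>.\<close>

lemma scaled_mem_approach_region:
  assumes m: "m \<ge> 1" and \<alpha>: "\<alpha> > 0" and p: "rho m p = 0"
    and r: "0 \<le> r" "r < 1"
    and small: "(1 - r) * (norm p)\<^sup>2 * (1 + \<alpha>) < \<alpha> * (p \<bullet> outward_normal m p)"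
    and ball: "ball (r *\<^sub>R p) ((1 - r) * (p \<bullet> outward_normal m p) * (1 + \<alpha> / 2) / (1 + \<alpha>)) \<subseteq> dom_D m"
  shows "r *\<^sub>R p \<in> approach_region m \<alpha> p"
proof -
  define \<kappa> where "\<kappa> = p \<bullet> outward_normal m p"
  have \<kappa>: "\<kappa> > 0"
    using inner_rho_gradient_pos[OF m p] unfolding \<kappa>_def outward_normal_eq sgn_div_norm
    by (auto intro!: mult_pos_pos)
  define s where "s = (1 - r) * \<kappa> * (1 + \<alpha> / 2) / (1 + \<alpha>)"
  have s: "s > 0" using r \<kappa> \<alpha> by (simp add: s_def)
  have D: "r *\<^sub>R p \<in> dom_D m"
    using scaled_mem_dom_D[of m p r] p r m by simp
  have diff: "p - r *\<^sub>R p = (1 - r) *\<^sub>R p" "r *\<^sub>R p - p = - ((1 - r) *\<^sub>R p)"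
    by (simp_all add: algebra_simps)
  have pM: "p \<in> frontier (dom_D m)" using p by (simp add: frontier_dom_D[OF m])
  have "s \<le> dist (r *\<^sub>R p) x" if "x \<in> frontier (dom_D m)" for x
  proof (rule ccontr)
    assume "\<not> s \<le> dist (r *\<^sub>R p) x"
    then have "x \<in> dom_D m" using ball by (auto simp: s_def \<kappa>_def)
    then show False using that open_dom_D[of m] by (simp add: frontier_def interior_open)
  qed
  then have 1: "s \<le> infdist (r *\<^sub>R p) (frontier (dom_D m))"
    using pM unfolding infdist_def by (auto intro!: cINF_greatest)
  have "infdist (r *\<^sub>R p) (tangent_plane m p) = (1 - r) * \<kappa>"
    unfolding tangent_plane_def infdist_hyperplane[OF norm_outward_normal[OF m p]] diff
    using r \<kappa> by (simp add: \<kappa>_def abs_mult)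
  moreover have "(1 - r) * \<kappa> * ((1 + \<alpha> / 2) / (1 + \<alpha>)) \<le> (1 - r) * \<kappa> * 1"
    using r \<kappa> \<alpha> by (intro mult_left_mono) auto
  ultimately have \<delta>: "s \<le> delta m p (r *\<^sub>R p)"
    using 1 by (simp add: delta_def s_def)
  have "cdot_cnj (p - r *\<^sub>R p) (outward_normal m p) = of_real (1 - r) * cdot_cnj p (outward_normal m p)"
    by (simp only: diff cdot_cnj_def fst_scaleR snd_scaleR scaleR_conv_of_real distrib_left mult.assoc)
  then have "cmod (cdot_cnj (p - r *\<^sub>R p) (outward_normal m p)) = (1 - r) * \<kappa>"
    using r \<kappa> by (simp only: cdot_cnj_outward_normal norm_mult \<kappa>_def[symmetric] norm_of_real)
  also have "\<dots> * 1 < (1 - r) * \<kappa> * (1 + \<alpha> / 2)"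
    using r \<kappa> \<alpha> by (intro mult_strict_left_mono) auto
  then have "(1 - r) * \<kappa> < (1 + \<alpha>) * s"
    using \<alpha> by (simp add: s_def)
  also have "\<dots> \<le> (1 + \<alpha>) * delta m p (r *\<^sub>R p)" using \<delta> \<alpha> by simp
  finally have c1: "cmod (cdot_cnj (p - r *\<^sub>R p) (outward_normal m p)) < (1 + \<alpha>) * delta m p (r *\<^sub>R p)" .
  \<comment> \<open>Quadratic in \<open>1 - r\<close> against a bound linear in
    \<open>1 - r\<close>; this is where \<open>small\<close> enters.\<close>
  have "(norm (p - r *\<^sub>R p))\<^sup>2 = (1 - r) * ((1 - r) * (norm p)\<^sup>2)"
    using r by (simp add: diff power_mult_distrib power2_eq_square)
  also have "\<dots> < (1 - r) * (\<alpha> * \<kappa> / (1 + \<alpha>))"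
    using small r \<alpha> by (intro mult_strict_left_mono) (auto simp: \<kappa>_def field_simps)
  also have "\<dots> \<le> \<alpha> * s"
  proof -
    have "(1 - r) * (\<alpha> * \<kappa> / (1 + \<alpha>)) * 1 \<le> (1 - r) * (\<alpha> * \<kappa> / (1 + \<alpha>)) * (1 + \<alpha> / 2)"
      using r \<kappa> \<alpha> by (intro mult_left_mono) auto
    then show ?thesis by (simp add: s_def mult_ac)
  qed
  also have "\<dots> \<le> \<alpha> * delta m p (r *\<^sub>R p)" using \<delta> \<alpha> by simp
  finally show ?thesis
    using c1 D by (simp add: approach_region_def)
qed

text \<open>The bound \<open>r0\<close> is uniform over the torus through \<open>p\<close>, which makes dominated convergence on the
  whole torus possible.\<close>

lemma radial_approach:
  assumes m: "m \<ge> 1" and \<alpha>: "\<alpha> > 0" and p: "rho m p = 0"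
  obtains r0 where "0 \<le> r0" "r0 < 1"
    "\<And>r s t. r0 < r \<Longrightarrow> r < 1 \<Longrightarrow> r *\<^sub>R torus_rotation s t p \<in> approach_region m \<alpha> (torus_rotation s t p)"
proof -
  define n where "n = outward_normal m p"
  define g where "g = norm (rho_gradient m p)"
  define \<kappa> where "\<kappa> = p \<bullet> n"
  define \<beta> where "\<beta> = (1 + \<alpha> / 2) / (1 + \<alpha>)"
  have \<kappa>: "\<kappa> > 0"
    using inner_rho_gradient_pos[OF m p] unfolding \<kappa>_def n_def outward_normal_eq sgn_div_norm
    by (auto intro!: mult_pos_pos)
  have g: "g > 0" using inner_rho_gradient_pos[OF m p] by (auto simp: g_def)
  have gn: "rho_gradient m p = g *\<^sub>R n"
    using g by (simp add: n_def outward_normal_eq sgn_div_norm g_def)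
  have n1: "norm n = 1" unfolding n_def by (rule norm_outward_normal[OF m p])
  have \<beta>: "0 < \<beta>" "\<beta> < 1" using \<alpha> by (auto simp: \<beta>_def)
  \<comment> \<open>On the ball about \<open>r *\<^sub>R p\<close> the distance to p is below
    \<open>(1 - r) * L\<close>. The constant \<open>e\<close> is then chosen so that the Taylor
    error \<open>e * ((1 - r) * L)\<close> equals the decrease
    \<open>g * ((1 - r) * \<kappa> * (1 - \<beta>))\<close> secured by the linear term.\<close>
  define L where "L = norm p + \<kappa>"
  have L: "L > 0" using \<kappa> by (simp add: L_def add_nonneg_pos)
  define e where "e = g * \<kappa> * (1 - \<beta>) / L"
  have e: "e > 0" using g \<kappa> \<beta> L by (simp add: e_def)
  obtain d where d: "d > 0" "\<And>y. norm (y - p) < d \<Longrightarrow> \<bar>rho m y - rho m p - (y - p) \<bullet> rho_gradient m p\<bar> \<le> e * norm (y - p)"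
    using has_derivative_rho[of m p] e unfolding has_derivative_at_alt real_norm_def by blast
  \<comment> \<open>Threshold on \<open>1 - r\<close> for the hypothesis \<open>small\<close> of
    \<open>scaled_mem_approach_region\<close>; the summand 1 keeps the denominator positive.\<close>
  define Q where "Q = \<alpha> * \<kappa> / ((norm p)\<^sup>2 * (1 + \<alpha>) + 1)"
  have "(norm p)\<^sup>2 * (1 + \<alpha>) + 1 > 0"
    using \<alpha> by (intro add_nonneg_pos) auto
  then have Q: "Q > 0"
    unfolding Q_def using \<alpha> \<kappa> by (intro divide_pos_pos mult_pos_pos) auto
  define r0 where "r0 = max 0 (max (1 - d / L) (1 - Q))"
  have r0: "0 \<le> r0" "r0 < 1" "1 - d / L \<le> r0" "1 - Q \<le> r0"
    using d(1) L Q by (simp_all add: r0_def)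
  show thesis
  proof (rule that[OF r0(1,2)])
    fix r s t assume r: "r0 < r" "r < 1"
    let ?T = "torus_rotation s t"
    \<comment> \<open>First-order expansion of \<open>rho m\<close> at p: the centre lies at depth
      \<open>(1 - r) * \<kappa>\<close> in the normal direction, and the ball uses up only the
      fraction \<beta> of it.\<close>
    have inD: "y \<in> dom_D m" if y: "norm (y - r *\<^sub>R p) < (1 - r) * \<kappa> * \<beta>" for y
    proof -
      define h where "h = y - r *\<^sub>R p"
      have yp: "y - p = h - (1 - r) *\<^sub>R p" by (simp add: h_def algebra_simps)
      have hn: "norm h < (1 - r) * \<kappa> * \<beta>" using y by (simp add: h_def)
      also have "\<dots> \<le> (1 - r) * \<kappa> * 1" using r \<kappa> \<beta> by (intro mult_left_mono) auto
      finally have "norm h + (1 - r) * norm p < (1 - r) * L"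
        by (simp add: L_def distrib_left)
      moreover have "norm (y - p) \<le> norm h + (1 - r) * norm p"
        using norm_triangle_ineq4[of h "(1 - r) *\<^sub>R p"] r by (simp only: yp norm_scaleR)
      ultimately have "norm (y - p) < (1 - r) * L" by linarith
      moreover have "1 - r < d / L" using r r0 by linarith
      then have "(1 - r) * L < d"
        using L by (simp add: pos_less_divide_eq)
      ultimately have 1: "\<bar>rho m y - (y - p) \<bullet> rho_gradient m p\<bar> \<le> e * norm (y - p)"
        and 2: "e * norm (y - p) \<le> e * ((1 - r) * L)"
        using d(2)[of y] p e by auto
      have "(y - p) \<bullet> n = h \<bullet> n - (1 - r) * \<kappa>"
        by (simp add: yp inner_diff_left \<kappa>_def)
      also have "h \<bullet> n < (1 - r) * \<kappa> * \<beta>"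
        using norm_cauchy_schwarz[of h n] hn n1 by simp
      also have "(1 - r) * \<kappa> * \<beta> - (1 - r) * \<kappa> = - ((1 - r) * \<kappa> * (1 - \<beta>))"
        by (simp only: right_diff_distrib mult_1_right minus_diff_eq)
      finally have "(y - p) \<bullet> n < - ((1 - r) * \<kappa> * (1 - \<beta>))" by simp
      then have "(y - p) \<bullet> rho_gradient m p < g * - ((1 - r) * \<kappa> * (1 - \<beta>))"
        unfolding gn inner_scaleR_right using g by (intro mult_strict_left_mono) auto
      also have "\<dots> = - (e * ((1 - r) * L))" using L by (simp add: e_def)
      finally have "rho m y < 0" using 1 2 by linarith
      then show ?thesis by (auto simp: rho_def dom_D_def case_prod_beta)
    qed
    have ball: "ball (r *\<^sub>R ?T p) ((1 - r) * \<kappa> * (1 + \<alpha> / 2) / (1 + \<alpha>)) \<subseteq> dom_D m"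
    proof
      fix y assume "y \<in> ball (r *\<^sub>R ?T p) ((1 - r) * \<kappa> * (1 + \<alpha> / 2) / (1 + \<alpha>))"
      then have "norm (y - r *\<^sub>R ?T p) < (1 - r) * \<kappa> * \<beta>"
        by (simp add: dist_norm norm_minus_commute \<beta>_def)
      \<comment> \<open>Rotating back: rotations are isometries that preserve \<open>rho m\<close>,
        so the estimate at p serves every point of its torus.\<close>
      also have "y - r *\<^sub>R ?T p = ?T (torus_rotation (- s) (- t) y - r *\<^sub>R p)"
        by (simp add: torus_rotation_diff torus_rotation_scaleR torus_rotation_inverse)
      finally have "rho m (torus_rotation (- s) (- t) y) < 0"
        using inD by (simp add: dom_D_def rho_def case_prod_beta)
      then show "y \<in> dom_D m"
        by (simp add: dom_D_def rho_def case_prod_beta torus_rotation_def norm_mult)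
    qed
    have \<kappa>T: "?T p \<bullet> outward_normal m (?T p) = \<kappa>"
      by (simp add: outward_normal_torus_rotation \<kappa>_def n_def)
    have "(1 - r) * (norm p)\<^sup>2 * (1 + \<alpha>) < \<alpha> * \<kappa>"
    proof -
      let ?N = "(norm p)\<^sup>2 * (1 + \<alpha>) + 1"
      have N: "?N > 0" using \<alpha> by (intro add_nonneg_pos) auto
      have "(1 - r) < \<alpha> * \<kappa> / ?N" using r r0 unfolding Q_def by linarith
      then have "(1 - r) * ?N < \<alpha> * \<kappa>" using N by (simp add: pos_less_divide_eq)
      moreover have "(1 - r) * ?N = (1 - r) * (norm p)\<^sup>2 * (1 + \<alpha>) + (1 - r)"
        by (simp only: distrib_left mult_1_right mult.assoc)
      ultimately show ?thesis using r by linarith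
    qed
    then show "r *\<^sub>R ?T p \<in> approach_region m \<alpha> (?T p)"
      using r r0 p ball by (intro scaled_mem_approach_region[OF m \<alpha>]) (simp_all add: \<kappa>T)
  qed
qed

section \<open>The Fefferman measure in polar coordinates\<close>

text \<open>A real derivative written in terms of dz, dw and their conjugates displays the Wirtinger
  derivatives as its coefficients, so they can be read off without evaluating limits.\<close>

lemma wirtinger_of_has_derivative:
  assumes "(f has_derivative (\<lambda>h. a * fst h + b * cnj (fst h) + c * snd h + d * cnj (snd h))) (at p)"
  shows "wirtinger (1, 0) f p = a" "wirtinger_bar (1, 0) f p = b"
    "wirtinger (0, 1) f p = c" "wirtinger_bar (0, 1) f p = d"
  unfolding wirtinger_def wirtinger_bar_def frechet_derivative_at[OF assms, symmetric]
  by (simp_all add: algebra_simps)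

text \<open>In terms of z, w and their conjugates \<open>rho m\<close> is a polynomial. On the
  boundary the corner entry of the bordered matrix vanishes, and its determinant becomes -m^2
  |w|^(2m-2) (|z|^2 + |w|^(2m)), where the bracket equals 1.\<close>

lemma fefferman_density_eq:
  assumes m: "m \<ge> 1" and p: "rho m (z, w) = 0"
  shows "fefferman_density m (z, w) =
    ((real m)\<^sup>2 * cmod w ^ (2 * (m - 1))) powr (1/3) / sqrt ((cmod z)\<^sup>2 + (real m)\<^sup>2 * cmod w ^ (2 * (2 * m - 1)))"
proof -
  define r where "r = (\<lambda>q. complex_of_real (rho m q))"
  have r_eq: "r = (\<lambda>q. fst q * cnj (fst q) + snd q ^ m * cnj (snd q) ^ m - 1)"
  proof
    fix q :: "complex \<times> complex"
    have "r q = of_real ((cmod (fst q))\<^sup>2) + of_real ((cmod (snd q))\<^sup>2) ^ m - 1"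
      by (simp add: r_def rho_def power_mult case_prod_beta)
    then show "r q = fst q * cnj (fst q) + snd q ^ m * cnj (snd q) ^ m - 1"
      by (simp only: complex_norm_square power_mult_distrib)
  qed
  have dr: "(r has_derivative (\<lambda>h. cnj (fst q) * fst h + fst q * cnj (fst h) +
      (of_nat m * snd q ^ (m - 1) * cnj (snd q) ^ m) * snd h +
      (of_nat m * snd q ^ m * cnj (snd q) ^ (m - 1)) * cnj (snd h))) (at q)" for q
    unfolding r_eq by (auto intro!: derivative_eq_intros simp: algebra_simps)
  note w1 = wirtinger_of_has_derivative[OF dr]
  have wb: "wirtinger_bar (1, 0) r = fst"
    "wirtinger_bar (0, 1) r = (\<lambda>q. of_nat m * snd q ^ m * cnj (snd q) ^ (m - 1))"
    using w1 by auto
  have d1: "(fst has_derivative (\<lambda>h. 1 * fst h + 0 * cnj (fst h) + 0 * snd h + 0 * cnj (snd h))) (at q)"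
    for q :: "complex \<times> complex"
    by (auto intro!: derivative_eq_intros)
  \<comment> \<open>For m = 1 the truncated exponent \<open>m - 1 - 1\<close> does no harm, since
    its factor \<open>of_nat (m - 1)\<close> is 0.\<close>
  have d2: "((\<lambda>q. of_nat m * snd q ^ m * cnj (snd q) ^ (m - 1)) has_derivative
     (\<lambda>h. 0 * fst h + 0 * cnj (fst h) +
       (of_nat m * of_nat m * snd q ^ (m - 1) * cnj (snd q) ^ (m - 1)) * snd h +
       (of_nat m * snd q ^ m * (of_nat (m - 1) * cnj (snd q) ^ (m - 1 - 1))) * cnj (snd h))) (at q)"
    for q :: "complex \<times> complex"
    by (auto intro!: derivative_eq_intros simp: algebra_simps)
  note w2 = wirtinger_of_has_derivative[OF d1] wirtinger_of_has_derivative[OF d2]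
  let ?B = "of_nat m * w ^ m * cnj w ^ (m - 1)" and ?C = "of_nat m * of_nat m * w ^ (m - 1) * cnj w ^ (m - 1)"
  have m': "w ^ m = w * w ^ (m - 1)" "cnj w ^ m = cnj w * cnj w ^ (m - 1)"
    using m by (cases m; simp)+
  define y where "y = cmod w ^ (m - 1)"
  have yy: "w ^ (m - 1) * cnj w ^ (m - 1) = of_real (y\<^sup>2)"
    by (simp add: y_def power_mult_distrib[symmetric] complex_norm_square[symmetric] power_mult[symmetric] mult.commute)
  have rz: "rho m (z, w) = (cmod z)\<^sup>2 + (cmod w)\<^sup>2 * y\<^sup>2 - 1"
    using m by (cases m) (simp_all add: rho_def y_def mult_2 power_add power2_eq_square)
  have "- (z * (cnj z * ?C) + ?B * (of_nat m * w ^ (m - 1) * cnj w ^ m)) =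
      - (of_nat m * of_nat m * (w ^ (m - 1) * cnj w ^ (m - 1)) * (z * cnj z + (w * cnj w) * (w ^ (m - 1) * cnj w ^ (m - 1))))"
    unfolding m' by (simp add: algebra_simps)
  also have "\<dots> = - of_real ((real m)\<^sup>2 * y\<^sup>2 * ((cmod z)\<^sup>2 + (cmod w)\<^sup>2 * y\<^sup>2))"
    unfolding yy by (simp add: complex_norm_square[symmetric] power2_eq_square)
  also have "(cmod z)\<^sup>2 + (cmod w)\<^sup>2 * y\<^sup>2 = 1" using p rz by simp
  finally have det: "- (z * (cnj z * ?C) + ?B * (of_nat m * w ^ (m - 1) * cnj w ^ m)) = - of_real ((real m)\<^sup>2 * y\<^sup>2)"
    by simp
  have r0: "r (z, w) = 0" using p by (simp add: r_def)
  have "cmod (of_nat m * w ^ (m - 1) * cnj w ^ m) = m * cmod w ^ (2 * m - 1)"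
    unfolding norm_mult norm_power norm_of_nat complex_mod_cnj
    using m by (cases m) (simp_all add: power_add mult_2)
  then have sq: "(cmod (of_nat m * w ^ (m - 1) * cnj w ^ m))\<^sup>2 = (real m)\<^sup>2 * cmod w ^ (2 * (2 * m - 1))"
    by (simp add: power_mult_distrib power_mult[symmetric] mult.commute)
  have det_A: "det (vector [vector [0, z, b], vector [cnj z, 1, 0], vector [b', 0, c]] :: complex ^ 3 ^ 3) =
      - (z * (cnj z * c) + b * b')" for b b' c
    by (simp add: det_3 algebra_simps)
  have "cmod (- of_real ((real m)\<^sup>2 * y\<^sup>2)) = (real m)\<^sup>2 * cmod w ^ (2 * (m - 1))"
    unfolding norm_minus_cancel norm_of_real by (simp add: y_def power_mult[symmetric] mult.commute)
  then show ?thesis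
    unfolding fefferman_density_def r_def[symmetric] Let_def wb w1 w2 fst_conv snd_conv r0 det_A det sq
    by (simp only: complex_mod_cnj times_divide_eq_left mult_1_left)
qed

lemma fefferman_density_measurable:
  assumes m: "m \<ge> 1"
  shows "fefferman_density m \<in> borel_measurable (restrict_space borel (frontier (dom_D m)))"
proof -
  have "(\<lambda>p. ((real m)\<^sup>2 * cmod (snd p) ^ (2 * (m - 1))) powr (1/3) /
      sqrt ((cmod (fst p))\<^sup>2 + (real m)\<^sup>2 * cmod (snd p) ^ (2 * (2 * m - 1)))) \<in>
      borel_measurable (restrict_space borel (frontier (dom_D m)))"
  proof (rule measurable_restrict_space1)
    have [measurable]: "(\<lambda>p::complex \<times> complex. (real m)\<^sup>2 * cmod (snd p) ^ (2 * (m - 1))) \<in> borel_measurable borel"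
      "(\<lambda>p::complex \<times> complex. (cmod (fst p))\<^sup>2 + (real m)\<^sup>2 * cmod (snd p) ^ (2 * (2 * m - 1))) \<in> borel_measurable borel"
      by (intro borel_measurable_continuous_onI continuous_intros)+
    show "(\<lambda>p. ((real m)\<^sup>2 * cmod (snd p) ^ (2 * (m - 1))) powr (1/3) /
      sqrt ((cmod (fst p))\<^sup>2 + (real m)\<^sup>2 * cmod (snd p) ^ (2 * (2 * m - 1)))) \<in> borel_measurable borel"
      by measurable
  qed
  then show ?thesis
    by (subst measurable_cong[where g = "\<lambda>p. ((real m)\<^sup>2 * cmod (snd p) ^ (2 * (m - 1))) powr (1/3) /
      sqrt ((cmod (fst p))\<^sup>2 + (real m)\<^sup>2 * cmod (snd p) ^ (2 * (2 * m - 1)))"])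
      (auto simp: space_restrict_space frontier_dom_D[OF m] fefferman_density_eq[OF m])
qed

section \<open>Charts of the boundary hypersurface\<close>

lemma has_derivative_of_real_mult_cis:
  assumes "(h has_derivative h') (at x)" "(k has_derivative k') (at x)"
  shows "((\<lambda>x. of_real (h x) * cis (k x)) has_derivative
    (\<lambda>v. of_real (h' v) * cis (k x) + of_real (h x * k' v) * (\<i> * cis (k x)))) (at x)"
proof -
  have "((\<lambda>x. \<i> * of_real (k x)) has_derivative (\<lambda>v. \<i> * of_real (k' v))) (at x)"
    by (auto intro!: derivative_eq_intros assms)
  from has_derivative_compose[OF this DERIV_exp[unfolded has_field_derivative_def]]
  have "((\<lambda>x. cis (k x)) has_derivative (\<lambda>v. cis (k x) * (\<i> * of_real (k' v)))) (at x)"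
    unfolding cis_conv_exp .
  then show ?thesis
    by (auto intro!: derivative_eq_intros assms simp: algebra_simps scaleR_conv_of_real)
qed

lemma has_derivative_vec_nth: "((\<lambda>x. x $ i) has_derivative (\<lambda>v. v $ i)) (at x)"
  by (rule bounded_linear_imp_has_derivative) (rule bounded_linear_vec_nth)

text \<open>With an explicit derivative \<open>D\<close> the conditions on
  \<open>frechet_derivative\<close> become concrete, and by linearity injectivity reduces to a
  trivial kernel.\<close>

lemma regular_chartI:
  assumes U: "open U" and M: "\<And>x. x \<in> U \<Longrightarrow> \<phi> x \<in> M" and inj: "inj_on \<phi> U"
    and D: "\<And>x. x \<in> U \<Longrightarrow> (\<phi> has_derivative D x) (at x)"
    and cont: "\<And>v. continuous_on U (\<lambda>x. D x v)"
    and D0: "\<And>x v. x \<in> U \<Longrightarrow> D x v = 0 \<Longrightarrow> v = 0"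
  shows "regular_chart M U \<phi>"
proof -
  have eq: "frechet_derivative \<phi> (at x) = D x" if "x \<in> U" for x
    using frechet_derivative_at[OF D[OF that]] by simp
  have "inj (D x)" if "x \<in> U" for x
    using D0[OF that] linear_injective_0[OF has_derivative_linear[OF D[OF that]]] by blast
  moreover have "continuous_on U (\<lambda>x. frechet_derivative \<phi> (at x) v)" for v
    using cont[of v] by (rule continuous_on_eq) (simp add: eq)
  moreover have "\<phi> differentiable (at x)" if "x \<in> U" for x
    using D[OF that] unfolding differentiable_def by blast
  ultimately show ?thesis
    unfolding regular_chart_def using U M inj by (auto simp: eq)
qed

lemma cis_inj_interval:
  assumes "cis s = cis t" "a < s" "s < a + 2 * pi" "a < t" "t < a + 2 * pi"
  shows "s = t"
proof -
  have "sin s = sin t \<and> cos s = cos t" using assms(1) by (simp add: complex_eq_iff)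
  then obtain n :: int where n: "s = t + 2 * pi * n" unfolding sin_cos_eq_iff by blast
  then have "\<bar>2 * pi * n\<bar> < 2 * pi" using assms by linarith
  then have "\<bar>real_of_int n\<bar> < 1" by (simp add: abs_mult)
  then have "n = 0" by linarith
  then show ?thesis using n by simp
qed

lemma polar_eq_cancel:
  assumes "complex_of_real a * cis s = of_real b * cis t" "a \<ge> 0" "b \<ge> 0"
  shows "a = b"
  using arg_cong[OF assms(1), of cmod] assms(2,3) by (simp add: norm_mult)

definition polar_chart :: "nat \<Rightarrow> real ^ 3 \<Rightarrow> complex \<times> complex" where
  "polar_chart m x = (of_real (sqrt (1 - x $ 1 ^ (2 * m))) * cis (x $ 2), of_real (x $ 1) * cis (x $ 3))"

text \<open>The offsets a and b move the open angular windows; starting them at 0 and at -pi covers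
  all angles while each window stays injective. The bounds on the radius exclude the circles
  \<open>z = 0\<close> and \<open>w = 0\<close>, where the polar parametrization
  degenerates.\<close>

definition polar_dom :: "real \<Rightarrow> real \<Rightarrow> (real ^ 3) set" where
  "polar_dom a b = {x. 0 < x $ 1 \<and> x $ 1 < 1 \<and> a < x $ 2 \<and> x $ 2 < a + 2 * pi \<and> b < x $ 3 \<and> x $ 3 < b + 2 * pi}"

definition polar_deriv :: "nat \<Rightarrow> real ^ 3 \<Rightarrow> real ^ 3 \<Rightarrow> complex \<times> complex" where
  "polar_deriv m x v =
    (of_real (- (m * x $ 1 ^ (2 * m - 1) / sqrt (1 - x $ 1 ^ (2 * m))) * v $ 1) * cis (x $ 2)
       + of_real (sqrt (1 - x $ 1 ^ (2 * m)) * v $ 2) * (\<i> * cis (x $ 2)),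
     of_real (v $ 1) * cis (x $ 3) + of_real (x $ 1 * v $ 3) * (\<i> * cis (x $ 3)))"

lemma polar_chart_rho:
  fixes x :: "real ^ 3"
  assumes "0 \<le> x $ 1" "x $ 1 \<le> 1"
  shows "rho m (polar_chart m x) = 0"
  using assms power_le_one[of "x $ 1" "2 * m"] by (simp add: rho_def polar_chart_def norm_mult)

lemma polar_chart_has_derivative:
  fixes x :: "real ^ 3"
  assumes "m \<ge> 1" "0 < x $ 1" "x $ 1 < 1"
  shows "(polar_chart m has_derivative polar_deriv m x) (at x)"
proof -
  have pos: "0 < 1 - x $ 1 ^ (2 * m)"
    using assms power_Suc_less_one[of "x $ 1" "2 * m - 1"] by simp
  have "((\<lambda>r. sqrt (1 - r ^ (2 * m))) has_real_derivative - (m * x $ 1 ^ (2 * m - 1) / sqrt (1 - x $ 1 ^ (2 * m)))) (at (x $ 1))"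
    using pos by (auto intro!: derivative_eq_intros simp: field_simps)
  from has_derivative_compose[OF has_derivative_vec_nth this[unfolded has_field_derivative_def]]
  have "((\<lambda>x. sqrt (1 - x $ 1 ^ (2 * m))) has_derivative
      (\<lambda>v. - (m * x $ 1 ^ (2 * m - 1) / sqrt (1 - x $ 1 ^ (2 * m))) * v $ 1)) (at x)"
    by simp
  from has_derivative_of_real_mult_cis[OF this has_derivative_vec_nth[of 2]]
    has_derivative_of_real_mult_cis[OF has_derivative_vec_nth[of 1] has_derivative_vec_nth[of 3], of x]
  show ?thesis
    unfolding polar_chart_def[abs_def] polar_deriv_def[abs_def]
    by (rule has_derivative_Pair)
qed

lemma of_real_cis_orthogonal_eq_0:
  assumes "of_real a * cis s + of_real b * (\<i> * cis s) = 0"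
  shows "a = 0 \<and> b = 0"
proof -
  have "(of_real a + of_real b * \<i>) * cis s = 0" using assms by (simp add: algebra_simps)
  then have "of_real a + of_real b * \<i> = 0" by simp
  then show ?thesis by (simp add: complex_eq_iff)
qed

lemma regular_chart_polar:
  assumes m: "m \<ge> 1"
  shows "regular_chart (frontier (dom_D m)) (polar_dom a b) (polar_chart m)"
proof (rule regular_chartI)
  show "open (polar_dom a b)"
    unfolding polar_dom_def by (intro open_Collect_conj open_Collect_less continuous_intros)
  show "polar_chart m x \<in> frontier (dom_D m)" if "x \<in> polar_dom a b" for x
    using that by (simp add: frontier_dom_D[OF m] polar_dom_def polar_chart_rho)
  have pos: "0 < 1 - x $ 1 ^ (2 * m)" if "x \<in> polar_dom a b" for x :: "real ^ 3"
    using m that power_Suc_less_one[of "x $ 1" "2 * m - 1"] by (simp add: polar_dom_def)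
  show "inj_on (polar_chart m) (polar_dom a b)"
  proof (rule inj_onI)
    fix x y assume x: "x \<in> polar_dom a b" and y: "y \<in> polar_dom a b" and eq: "polar_chart m x = polar_chart m y"
    have 1: "x $ 1 = y $ 1"
      using polar_eq_cancel[of "x $ 1" "x $ 3" "y $ 1" "y $ 3"] eq x y by (simp add: polar_chart_def polar_dom_def)
    have "cis (x $ 2) = cis (y $ 2)" "cis (x $ 3) = cis (y $ 3)"
      using eq pos[OF x] pos[OF y] x y unfolding polar_chart_def 1 by (auto simp: polar_dom_def)
    then have "x $ 2 = y $ 2" "x $ 3 = y $ 3"
      using cis_inj_interval x y by (auto simp: polar_dom_def)
    with 1 show "x = y" by (simp add: vec_eq_iff forall_3)
  qed
  show "(polar_chart m has_derivative polar_deriv m x) (at x)" if "x \<in> polar_dom a b" for x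
    using that by (intro polar_chart_has_derivative m) (auto simp: polar_dom_def)
  show "continuous_on (polar_dom a b) (\<lambda>x. polar_deriv m x v)" for v
    unfolding polar_deriv_def using pos by (intro continuous_intros) force
  show "v = 0" if x: "x \<in> polar_dom a b" and "polar_deriv m x v = 0" for x v
  proof -
    have "v $ 1 = 0" "x $ 1 * v $ 3 = 0" "sqrt (1 - x $ 1 ^ (2 * m)) * v $ 2 = 0"
      using that(2) by (auto simp: polar_deriv_def zero_prod_def simp del: of_real_mult dest!: of_real_cis_orthogonal_eq_0)
    then show ?thesis
      using x pos[OF x] by (simp add: vec_eq_iff forall_3 polar_dom_def)
  qed
qed

text \<open>The coordinate vectors are pairwise orthogonal, so the Gram determinant is the product
  of their squared lengths \<open>R' * R' + 1\<close>, R and r^2, where R = |z|^2 and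
  \<open>R'\<close> is the derivative of sqrt R. The resulting square root is the denominator of
  \<open>fefferman_density_eq\<close>.\<close>

lemma area_element_polar:
  fixes x :: "real ^ 3"
  assumes m: "m \<ge> 1" and x: "0 < x $ 1" "x $ 1 < 1"
  shows "area_element (polar_chart m) x =
    x $ 1 * sqrt (1 - x $ 1 ^ (2 * m) + (real m)\<^sup>2 * x $ 1 ^ (2 * (2 * m - 1)))"
proof -
  have eq: "frechet_derivative (polar_chart m) (at x) = polar_deriv m x"
    using frechet_derivative_at[OF polar_chart_has_derivative[OF assms]] by simp
  define R where "R = 1 - x $ 1 ^ (2 * m)"
  have R: "R > 0"
    using m x power_Suc_less_one[of "x $ 1" "2 * m - 1"] by (simp add: R_def)
  define R' where "R' = - (m * x $ 1 ^ (2 * m - 1) / sqrt R)"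
  have cs: "sin s * sin s + cos s * cos s = 1" for s :: real
    using sin_cos_squared_add[of s] by (simp add: power2_eq_square)
  have basis: "polar_deriv m x (axis 1 1) = (of_real R' * cis (x $ 2), cis (x $ 3))"
    "polar_deriv m x (axis 2 1) = (of_real (sqrt R) * (\<i> * cis (x $ 2)), 0)"
    "polar_deriv m x (axis 3 1) = (0, of_real (x $ 1) * (\<i> * cis (x $ 3)))"
    by (simp_all add: polar_deriv_def axis_def R_def R'_def)
  have o: "(of_real a * cis s) \<bullet> (of_real b * (\<i> * cis s)) = 0" "(of_real b * (\<i> * cis s)) \<bullet> (of_real a * cis s) = 0"
    "(of_real a * cis s) \<bullet> (of_real b * cis s) = a * b" "(of_real a * (\<i> * cis s)) \<bullet> (of_real b * (\<i> * cis s)) = a * b" for a b s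
    using cs[of s] by (simp_all add: inner_complex_def) algebra+
  note o1 = o[of 1, simplified] o(1,2)[of _ _ 1, simplified] o(3)[of 1 _ 1, simplified]
  have "det (\<chi> i j. polar_deriv m x (axis i 1) \<bullet> polar_deriv m x (axis j 1) :: real ^ 3 ^ 3) =
      (R' * R' + 1) * (sqrt R * sqrt R) * (x $ 1 * x $ 1)"
    unfolding det_3 by (simp add: basis inner_prod_def o o1)
  also have "\<dots> = (x $ 1)\<^sup>2 * (R + (real m)\<^sup>2 * x $ 1 ^ (2 * (2 * m - 1)))"
    using R by (simp add: R'_def field_simps power2_eq_square mult_2 power_add)
  finally show ?thesis
    using x by (simp add: area_element_def eq real_sqrt_mult R_def)
qed

text \<open>The boundary as a circle bundle over a disc. The radius of the fibre is a function of
  the squared modulus so that the chart is differentiable at the centre as well. The central fibres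
  are exactly the circles that the polar charts miss; interchanging the coordinates handles the
  second one.\<close>

definition graph_chart :: "(real \<Rightarrow> real) \<Rightarrow> real ^ 3 \<Rightarrow> complex \<times> complex" where
  "graph_chart g x = (Complex (x $ 1) (x $ 2), of_real (g ((x $ 1)\<^sup>2 + (x $ 2)\<^sup>2)) * cis (x $ 3))"

definition graph_dom :: "real \<Rightarrow> (real ^ 3) set" where
  "graph_dom a = {x. (x $ 1)\<^sup>2 + (x $ 2)\<^sup>2 < 1 \<and> a < x $ 3 \<and> x $ 3 < a + 2 * pi}"

lemma regular_chart_graph:
  assumes g: "\<And>u. 0 \<le> u \<Longrightarrow> u < 1 \<Longrightarrow> (g has_real_derivative g' u) (at u)"
    and g': "continuous_on {0..<1} g'" and pos: "\<And>u. 0 \<le> u \<Longrightarrow> u < 1 \<Longrightarrow> g u > 0"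
    and M: "\<And>z t. cmod z < 1 \<Longrightarrow> (z, of_real (g ((cmod z)\<^sup>2)) * cis t) \<in> M"
  shows "regular_chart M (graph_dom a) (graph_chart g)"
proof -
  let ?n = "\<lambda>x::real ^ 3. (x $ 1)\<^sup>2 + (x $ 2)\<^sup>2"
  define D where "D = (\<lambda>x v::real ^ 3. (Complex (v $ 1) (v $ 2),
      of_real (g' (?n x) * (2 * x $ 1 * v $ 1 + 2 * x $ 2 * v $ 2)) * cis (x $ 3)
        + of_real (g (?n x) * v $ 3) * (\<i> * cis (x $ 3))))"
  have n: "0 \<le> ?n x" "?n x < 1" if "x \<in> graph_dom a" for x :: "real ^ 3"
    using that by (auto simp: graph_dom_def)
  show ?thesis
  proof (rule regular_chartI)
    show "open (graph_dom a)"
      unfolding graph_dom_def by (intro open_Collect_conj open_Collect_less continuous_intros)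
    show "graph_chart g x \<in> M" if "x \<in> graph_dom a" for x
      using M[of "Complex (x $ 1) (x $ 2)" "x $ 3"] n[OF that]
      by (simp add: graph_chart_def cmod_def real_less_lsqrt)
    show "inj_on (graph_chart g) (graph_dom a)"
    proof (rule inj_onI)
      fix x y assume x: "x \<in> graph_dom a" and y: "y \<in> graph_dom a" and eq: "graph_chart g x = graph_chart g y"
      have 1: "x $ 1 = y $ 1" "x $ 2 = y $ 2"
        using eq by (auto simp: graph_chart_def)
      have "cis (x $ 3) = cis (y $ 3)"
        using eq pos[OF n[OF y]] unfolding graph_chart_def 1 by auto
      then have "x $ 3 = y $ 3"
        using cis_inj_interval x y by (auto simp: graph_dom_def)
      with 1 show "x = y" by (simp add: vec_eq_iff forall_3)
    qed
    show "(graph_chart g has_derivative D x) (at x)" if x: "x \<in> graph_dom a" for x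
    proof -
      have 1: "(?n has_derivative (\<lambda>v. 2 * x $ 1 * v $ 1 + 2 * x $ 2 * v $ 2)) (at x)"
        by (auto intro!: derivative_eq_intros has_derivative_vec_nth simp: algebra_simps)
      have 2: "((\<lambda>x. g (?n x)) has_derivative (\<lambda>v. g' (?n x) * (2 * x $ 1 * v $ 1 + 2 * x $ 2 * v $ 2))) (at x)"
        using has_derivative_compose[OF 1 g[OF n[OF x], unfolded has_field_derivative_def]] .
      have 3: "((\<lambda>x. Complex (x $ 1) (x $ 2)) has_derivative (\<lambda>v. Complex (v $ 1) (v $ 2))) (at x)"
        unfolding Complex_eq by (auto intro!: derivative_eq_intros has_derivative_vec_nth)
      show ?thesis
        unfolding graph_chart_def[abs_def] D_def
        by (intro has_derivative_Pair 3 has_derivative_of_real_mult_cis 2 has_derivative_vec_nth)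
    qed
    have nc: "continuous_on (graph_dom a) ?n"
      by (intro continuous_intros)
    have "continuous_on (graph_dom a) (\<lambda>x. g' (?n x))"
      by (rule continuous_on_compose2[OF g' nc]) (use n in auto)
    moreover have "continuous_on {0..<1} g"
      by (rule continuous_at_imp_continuous_on) (use g DERIV_isCont in force)
    then have "continuous_on (graph_dom a) (\<lambda>x. g (?n x))"
      by (rule continuous_on_compose2[OF _ nc]) (use n in auto)
    ultimately show "continuous_on (graph_dom a) (\<lambda>x. D x v)" for v
      unfolding D_def by (intro continuous_intros)
    show "v = 0" if x: "x \<in> graph_dom a" and "D x v = 0" for x v
    proof -
      have 1: "v $ 1 = 0" "v $ 2 = 0" and
        "of_real (g' (?n x) * (2 * x $ 1 * v $ 1 + 2 * x $ 2 * v $ 2)) * cis (x $ 3)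
        + of_real (g (?n x) * v $ 3) * (\<i> * cis (x $ 3)) = 0"
        using that(2) by (auto simp: D_def zero_prod_def complex_eq_iff simp del: of_real_mult)
      from of_real_cis_orthogonal_eq_0[OF this(3)] have "v $ 3 = 0"
        using pos[OF n[OF x]] by simp
      with 1 show ?thesis by (simp add: vec_eq_iff forall_3)
    qed
  qed
qed

lemma regular_chart_swap:
  assumes "regular_chart M U \<phi>"
  shows "regular_chart (prod.swap ` M) U (\<lambda>x. prod.swap (\<phi> x))"
proof (rule regular_chartI)
  let ?D = "\<lambda>x. frechet_derivative \<phi> (at x)"
  note ch = assms[unfolded regular_chart_def]
  show "open U" using ch by blast
  show "prod.swap (\<phi> x) \<in> prod.swap ` M" if "x \<in> U" for x using ch that by blast
  show "inj_on (\<lambda>x. prod.swap (\<phi> x)) U"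
    using ch by (auto simp: inj_on_def prod.swap_def prod_eq_iff)
  show "((\<lambda>x. prod.swap (\<phi> x)) has_derivative (\<lambda>v. prod.swap (?D x v))) (at x)" if "x \<in> U" for x
  proof -
    have "(\<phi> has_derivative ?D x) (at x)" using ch that frechet_derivative_works by blast
    then show ?thesis
      unfolding prod.swap_def by (intro has_derivative_Pair has_derivative_fst has_derivative_snd)
  qed
  show "continuous_on U (\<lambda>x. prod.swap (?D x v))" for v
    unfolding prod.swap_def using ch by (intro continuous_intros) auto
  show "v = 0" if x: "x \<in> U" and eq: "prod.swap (?D x v) = 0" for x v
  proof -
    have "?D x v = 0" using eq by (auto simp: prod.swap_def zero_prod_def prod_eq_iff)
    moreover have "?D x 0 = 0"
      using ch x frechet_derivative_works has_derivative_linear linear_0 by blast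
    ultimately show ?thesis using ch x by (metis injD)
  qed
qed

lemma regular_chart_graph_fst:
  assumes m: "m \<ge> 1"
  shows "regular_chart (frontier (dom_D m)) (graph_dom a) (graph_chart (\<lambda>u. (1 - u) powr (1 / (2 * real m))))"
proof (rule regular_chart_graph)
  show "((\<lambda>u. (1 - u) powr (1 / (2 * real m))) has_real_derivative - (1 / (2 * real m) * (1 - u) powr (1 / (2 * real m) - 1))) (at u)"
    if "0 \<le> u" "u < 1" for u :: real
    using that by (auto intro!: derivative_eq_intros simp: powr_diff)
  show "continuous_on {0..<1} (\<lambda>u::real. - (1 / (2 * real m) * (1 - u) powr (1 / (2 * real m) - 1)))"
    by (intro continuous_intros) auto
  show "(z, of_real ((1 - (cmod z)\<^sup>2) powr (1 / (2 * real m))) * cis t) \<in> frontier (dom_D m)" if z: "cmod z < 1" for z t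
  proof -
    have "1 - (cmod z)\<^sup>2 > 0" using z by (simp add: abs_square_less_1)
    then have "((1 - (cmod z)\<^sup>2) powr (1 / (2 * real m))) ^ (2 * m) = 1 - (cmod z)\<^sup>2"
      using m by (simp add: powr_power)
    then show ?thesis
      by (simp add: frontier_dom_D[OF m] rho_def norm_mult)
  qed
qed auto

lemma regular_chart_graph_snd:
  assumes m: "m \<ge> 1"
  shows "regular_chart (frontier (dom_D m)) (graph_dom a) (\<lambda>x. prod.swap (graph_chart (\<lambda>u. sqrt (1 - u ^ m)) x))"
proof -
  have lt: "u ^ m < 1" if "0 \<le> u" "u < 1" for u :: real
    using that m power_less_one_iff[of u m] by simp
  have "regular_chart (prod.swap -` frontier (dom_D m)) (graph_dom a) (graph_chart (\<lambda>u. sqrt (1 - u ^ m)))"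
  proof (rule regular_chart_graph)
    show "((\<lambda>u. sqrt (1 - u ^ m)) has_real_derivative - (m * u ^ (m - 1) / (2 * sqrt (1 - u ^ m)))) (at u)"
      if "0 \<le> u" "u < 1" for u :: real
      using lt[OF that] by (auto intro!: derivative_eq_intros simp: field_simps)
    show "continuous_on {0..<1} (\<lambda>u::real. - (m * u ^ (m - 1) / (2 * sqrt (1 - u ^ m))))"
      using lt by (intro continuous_intros) force
    show "sqrt (1 - u ^ m) > 0" if "0 \<le> u" "u < 1" for u :: real
      using lt[OF that] by simp
    show "(w, of_real (sqrt (1 - (cmod w)\<^sup>2 ^ m)) * cis t) \<in> prod.swap -` frontier (dom_D m)" if "cmod w < 1" for w t
    proof -
      have "(cmod w)\<^sup>2 ^ m < 1" using lt[of "(cmod w)\<^sup>2"] that by (simp add: abs_square_less_1)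
      then show ?thesis
        by (simp add: frontier_dom_D[OF m] rho_def norm_mult power_mult)
    qed
  qed
  from regular_chart_swap[OF this] show ?thesis
    by (simp add: surj_image_vimage_eq)
qed

text \<open>Of the two windows, the one from 0 omits only the argument 0, which the one from -pi
  contains. For z = 0 the angle is arbitrary and 0 is taken.\<close>

lemma polar_form_interval:
  obtains a s where "a \<in> {0, - pi}" "a < s" "s < a + 2 * pi" "z = of_real (cmod z) * cis s"
proof (cases "Arg2pi z = 0")
  case True
  then show thesis
    using Arg2pi_eq[of z] by (intro that[of "- pi" 0]) (auto simp: cis_conv_exp)
next
  case False
  then show thesis
    using Arg2pi_eq[of z] Arg2pi[of z] by (intro that[of 0 "Arg2pi z"]) (auto simp: cis_conv_exp mult.commute)
qed

lemma mem_polar_chart: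
  assumes "rho m (of_real u * cis s, of_real r * cis t) = 0" "0 < r" "0 < u" "m \<ge> 1"
    "a < s" "s < a + 2 * pi" "b < t" "t < b + 2 * pi"
  shows "(of_real u * cis s, of_real r * cis t) \<in> polar_chart m ` polar_dom a b"
proof -
  have eq: "u\<^sup>2 = 1 - r ^ (2 * m)" using assms by (simp add: rho_def norm_mult)
  then have "r ^ (2 * m) < 1" using assms(3) by (smt (verit) zero_less_power)
  then have "r < 1" using assms by (metis linorder_not_less one_le_power)
  moreover have "sqrt (1 - r ^ (2 * m)) = u" using eq assms(3) by (simp flip: eq)
  ultimately show ?thesis
    using assms by (intro image_eqI[of _ _ "vector [r, s, t]"]) (auto simp: polar_chart_def polar_dom_def)
qed

text \<open>Polar charts reach the points with both coordinates nonzero, while points on the two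
  exceptional circles are centres of graph charts, with the argument of the other coordinate as the
  third parameter.\<close>

lemma frontier_dom_D_charts:
  assumes m: "m \<ge> 1" and p: "p \<in> frontier (dom_D m)"
  obtains U \<phi> where "(U, \<phi>) \<in> {(polar_dom a b, polar_chart m) | a b. a \<in> {0, - pi} \<and> b \<in> {0, - pi}} \<union>
    {(graph_dom a, graph_chart (\<lambda>u. (1 - u) powr (1 / (2 * real m)))) | a. a \<in> {0, - pi}} \<union>
    {(graph_dom a, \<lambda>x. prod.swap (graph_chart (\<lambda>u. sqrt (1 - u ^ m)) x)) | a. a \<in> {0, - pi}}"
    "p \<in> \<phi> ` U"
proof -
  obtain z w where pzw: "p = (z, w)" by force
  have rho: "rho m (z, w) = 0" using p by (simp add: frontier_dom_D[OF m] pzw)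
  obtain a s where s: "a \<in> {0, - pi}" "a < s" "s < a + 2 * pi" "z = of_real (cmod z) * cis s"
    by (rule polar_form_interval)
  obtain b t where t: "b \<in> {0, - pi}" "b < t" "t < b + 2 * pi" "w = of_real (cmod w) * cis t"
    by (rule polar_form_interval)
  consider "z = 0" | "w = 0" | "z \<noteq> 0" "w \<noteq> 0" by blast
  then show thesis
  proof cases
    case 1
    then have "cmod w ^ (2 * m) = 1 ^ (2 * m)" using rho by (simp add: rho_def)
    then have "cmod w = 1" using m power_eq_imp_eq_base[of "cmod w" "2 * m" 1] by simp
    then have "p = graph_chart (\<lambda>u. (1 - u) powr (1 / (2 * real m))) (vector [0, 0, t])"
      using 1 t by (simp add: pzw graph_chart_def complex_eq_iff)
    moreover have "vector [0, 0, t] \<in> graph_dom b" using t by (simp add: graph_dom_def)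
    ultimately show thesis
      using t(1) by (intro that[of "graph_dom b" "graph_chart (\<lambda>u. (1 - u) powr (1 / (2 * real m)))"]) auto
  next
    case 2
    then have "(cmod z)\<^sup>2 = 1\<^sup>2" using rho m by (simp add: rho_def zero_power)
    then have "cmod z = 1" using power2_eq_imp_eq[of "cmod z" 1] by simp
    then have "p = prod.swap (graph_chart (\<lambda>u. sqrt (1 - u ^ m)) (vector [0, 0, s]))"
      using 2 s m by (simp add: pzw graph_chart_def complex_eq_iff zero_power)
    moreover have "vector [0, 0, s] \<in> graph_dom a" using s by (simp add: graph_dom_def)
    ultimately show thesis
      using s(1) by (intro that[of "graph_dom a" "\<lambda>x. prod.swap (graph_chart (\<lambda>u. sqrt (1 - u ^ m)) x)"]) auto
  next
    case 3
    have "p \<in> polar_chart m ` polar_dom a b"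
      using mem_polar_chart[of m "cmod z" s "cmod w" t a b] rho 3 s t m by (simp add: pzw)
    then show thesis
      using s(1) t(1) by (intro that[of "polar_dom a b" "polar_chart m"]) auto
  qed
qed

section \<open>Null sets seen through charts\<close>

text \<open>An open set is a countable union of compact boxes, so its image is a countable union of
  compact sets. For an arbitrary Borel set in place of \<open>U\<close> this argument would break
  down.\<close>

lemma borel_image_open:
  fixes \<phi> :: "'a :: euclidean_space \<Rightarrow> 'b :: t2_space"
  assumes "open U" "continuous_on U \<phi>"
  shows "\<phi> ` U \<in> sets borel"
proof -
  obtain \<D> where \<D>: "countable \<D>" "\<And>X. X \<in> \<D> \<Longrightarrow> \<exists>a b. X = cbox a b" "\<Union>\<D> = U"
    by (rule open_countable_Union_open_cbox[OF assms(1)]) blast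
  then have D: "countable \<D>" "\<And>X. X \<in> \<D> \<Longrightarrow> compact X" "\<Union>\<D> = U"
    by force+
  have "\<phi> ` U = (\<Union>X\<in>\<D>. \<phi> ` X)" using D(3) by blast
  moreover have "\<phi> ` X \<in> sets borel" if "X \<in> \<D>" for X
    using D that by (intro borel_compact compact_continuous_image continuous_on_subset[OF assms(2)]) auto
  ultimately show ?thesis
    using D(1) by (auto intro: sets.countable_UN'')
qed

lemma AE_vec_nth_neq: "AE x in lborel. (x :: real ^ 'n) $ k \<noteq> c"
proof -
  have "negligible {x :: real ^ 'n. x \<bullet> axis k 1 = c}"
    by (rule negligible_standard_hyperplane) (auto simp: Basis_vec_def)
  then have "{x :: real ^ 'n. x $ k = c} \<in> null_sets lebesgue"
    by (simp add: negligible_iff_null_sets inner_axis)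
  moreover have "closed {x :: real ^ 'n. x $ k = c}"
    by (intro closed_Collect_eq continuous_intros)
  ultimately have "{x :: real ^ 'n. x $ k = c} \<in> null_sets lborel"
    using null_sets_completion_iff[of _ "lborel :: (real ^ 'n) measure"] by (simp add: borel_closed)
  from AE_not_in[OF this] show ?thesis by simp
qed

lemma AE_sin_vec_nth_neq_0: "AE x in lborel. sin ((x :: real ^ 'n) $ k) \<noteq> 0"
proof -
  have "AE x in lborel. \<forall>i::int. (x :: real ^ 'n) $ k \<noteq> i * pi"
    unfolding AE_all_countable by (intro allI AE_vec_nth_neq)
  then show ?thesis
    by eventually_elim (auto simp: sin_zero_iff_int2)
qed

lemma sets_euclidean_surface_measure:
  assumes "euclidean_surface_measure M \<sigma>"
  shows "sets \<sigma> = sets (restrict_space borel M)" "space \<sigma> = M"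
proof -
  show eq: "sets \<sigma> = sets (restrict_space borel M)"
    using assms by (simp add: euclidean_surface_measure_def)
  show "space \<sigma> = M"
    using sets_eq_imp_space_eq[OF eq] by (simp add: space_restrict_space)
qed

lemma regular_chart_image_sets:
  assumes \<sigma>: "euclidean_surface_measure M \<sigma>" and ch: "regular_chart M U \<phi>" and B: "B \<in> sets \<sigma>"
  shows "B \<inter> \<phi> ` U \<in> sets \<sigma>"
proof -
  have "continuous_on U \<phi>"
    using ch unfolding regular_chart_def
    by (intro continuous_at_imp_continuous_on) (auto intro: differentiable_imp_continuous_within)
  then have "\<phi> ` U \<in> sets borel"
    using ch by (intro borel_image_open) (auto simp: regular_chart_def)
  moreover have "\<phi> ` U = M \<inter> \<phi> ` U" using ch by (auto simp: regular_chart_def)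
  ultimately have "\<phi> ` U \<in> sets \<sigma>"
    unfolding sets_euclidean_surface_measure[OF \<sigma>] sets_restrict_space by blast
  with B show ?thesis by blast
qed

lemma null_in_regular_chart:
  assumes \<sigma>: "euclidean_surface_measure M \<sigma>" and ch: "regular_chart M U \<phi>" and B: "B \<in> sets \<sigma>"
    and AE: "AE x in lborel. x \<in> U \<longrightarrow> \<phi> x \<notin> B"
  shows "B \<inter> \<phi> ` U \<in> null_sets \<sigma>"
proof (rule null_setsI)
  show "B \<inter> \<phi> ` U \<in> sets \<sigma>" by (rule regular_chart_image_sets[OF \<sigma> ch B])
  have "emeasure \<sigma> (B \<inter> \<phi> ` U) = (\<integral>\<^sup>+x\<in>{x\<in>U. \<phi> x \<in> B}. ennreal (area_element \<phi> x) \<partial>lborel)"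
    using \<sigma> ch B by (simp add: euclidean_surface_measure_def)
  also have "\<dots> = (\<integral>\<^sup>+x. 0 \<partial>(lborel :: (real ^ 3) measure))"
    by (rule nn_integral_cong_AE) (use AE in eventually_elim, auto)
  finally show "emeasure \<sigma> (B \<inter> \<phi> ` U) = 0" by simp
qed

lemma graph_chart_AE:
  assumes "\<And>u. 0 \<le> u \<Longrightarrow> u < 1 \<Longrightarrow> g u > 0"
  shows "AE x in lborel. x \<in> graph_dom a \<longrightarrow> Im (fst (graph_chart g x)) \<noteq> 0 \<and> Im (snd (graph_chart g x)) \<noteq> 0"
  using AE_vec_nth_neq[of 2 0] AE_sin_vec_nth_neq_0[of 3]
proof eventually_elim
  case (elim x)
  then show ?case
    using assms[of "(x $ 1)\<^sup>2 + (x $ 2)\<^sup>2"] by (auto simp: graph_chart_def graph_dom_def)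
qed

lemma polar_chart_AE:
  assumes m: "m \<ge> 1"
  shows "AE x in lborel. x \<in> polar_dom a b \<longrightarrow> Im (fst (polar_chart m x)) \<noteq> 0 \<and> Im (snd (polar_chart m x)) \<noteq> 0"
  using AE_sin_vec_nth_neq_0[of 2] AE_sin_vec_nth_neq_0[of 3]
proof eventually_elim
  case (elim x)
  have "x $ 1 ^ (2 * m) \<noteq> 1" if "0 < x $ 1" "x $ 1 < 1"
    using power_Suc_less_one[of "x $ 1" "2 * m - 1"] that m by simp
  with elim show ?case
    by (auto simp: polar_chart_def polar_dom_def)
qed

text \<open>The charts cover the boundary, and outside this null set a single polar chart suffices.\<close>

lemma real_slices_null:
  assumes m: "m \<ge> 1" and \<sigma>: "euclidean_surface_measure (frontier (dom_D m)) \<sigma>"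
  shows "{p \<in> frontier (dom_D m). Im (fst p) = 0 \<or> Im (snd p) = 0} \<in> null_sets \<sigma>"
proof -
  let ?M = "frontier (dom_D m)"
  let ?N = "{p \<in> ?M. Im (fst p) = 0 \<or> Im (snd p) = 0}"
  define C where "C = {(polar_dom a b, polar_chart m) | a b. a \<in> {0, - pi} \<and> b \<in> {0, - pi}} \<union>
    {(graph_dom a, graph_chart (\<lambda>u. (1 - u) powr (1 / (2 * real m)))) | a. a \<in> {0, - pi}} \<union>
    {(graph_dom a, \<lambda>x. prod.swap (graph_chart (\<lambda>u. sqrt (1 - u ^ m)) x)) | a. a \<in> {0, - pi}}"
  have "closed {p :: complex \<times> complex. Im (fst p) = 0 \<or> Im (snd p) = 0}"
    by (intro closed_Collect_disj closed_Collect_eq continuous_intros)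
  then have "{p :: complex \<times> complex. Im (fst p) = 0 \<or> Im (snd p) = 0} \<in> sets borel"
    by (rule borel_closed)
  moreover have "?N = ?M \<inter> {p. Im (fst p) = 0 \<or> Im (snd p) = 0}" by auto
  ultimately have N: "?N \<in> sets \<sigma>"
    unfolding sets_euclidean_surface_measure[OF \<sigma>] sets_restrict_space by blast
  have "C = (\<lambda>(a, b). (polar_dom a b, polar_chart m)) ` ({0, - pi} \<times> {0, - pi}) \<union>
    (\<lambda>a. (graph_dom a, graph_chart (\<lambda>u. (1 - u) powr (1 / (2 * real m))))) ` {0, - pi} \<union>
    (\<lambda>a. (graph_dom a, \<lambda>x. prod.swap (graph_chart (\<lambda>u. sqrt (1 - u ^ m)) x))) ` {0, - pi}"
    by (auto simp: C_def image_def)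
  then have C: "countable C"
    by (simp add: countable_finite)
  have null: "?N \<inter> \<phi> ` U \<in> null_sets \<sigma>" if "(U, \<phi>) \<in> C" for U \<phi>
  proof (rule null_in_regular_chart[OF \<sigma> _ N])
    show "regular_chart ?M U \<phi>"
      using that regular_chart_polar[OF m] regular_chart_graph_fst[OF m] regular_chart_graph_snd[OF m]
      by (auto simp: C_def)
    have pos: "(1 - u) powr (1 / (2 * real m)) > 0" "sqrt (1 - u ^ m) > 0" if "0 \<le> u" "u < 1" for u :: real
      using that m power_less_one_iff[of u m] by auto
    have g1: "AE x in lborel. x \<in> graph_dom a \<longrightarrow> Im (fst (graph_chart (\<lambda>u. (1 - u) powr (1 / (2 * real m))) x)) \<noteq> 0 \<and>
        Im (snd (graph_chart (\<lambda>u. (1 - u) powr (1 / (2 * real m))) x)) \<noteq> 0" for a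
      by (rule graph_chart_AE) (rule pos(1))
    have g2: "AE x in lborel. x \<in> graph_dom a \<longrightarrow> Im (fst (graph_chart (\<lambda>u. sqrt (1 - u ^ m)) x)) \<noteq> 0 \<and>
        Im (snd (graph_chart (\<lambda>u. sqrt (1 - u ^ m)) x)) \<noteq> 0" for a
      by (rule graph_chart_AE) (rule pos(2))
    show "AE x in lborel. x \<in> U \<longrightarrow> \<phi> x \<notin> ?N"
      using that unfolding C_def
    proof (elim UnE CollectE exE conjE)
      fix a b assume "(U, \<phi>) = (polar_dom a b, polar_chart m)"
      with polar_chart_AE[OF m, of a b] show ?thesis by (auto elim!: eventually_mono)
    next
      fix a assume "(U, \<phi>) = (graph_dom a, graph_chart (\<lambda>u. (1 - u) powr (1 / (2 * real m))))"
      with g1[of a] show ?thesis by (auto elim!: eventually_mono)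
    next
      fix a assume "(U, \<phi>) = (graph_dom a, \<lambda>x. prod.swap (graph_chart (\<lambda>u. sqrt (1 - u ^ m)) x))"
      with g2[of a] show ?thesis by (auto elim!: eventually_mono)
    qed
  qed
  have "(\<Union>c\<in>C. ?N \<inter> snd c ` fst c) \<in> null_sets \<sigma>"
    by (rule null_sets_UN'[OF C]) (simp add: null)
  moreover have "(\<Union>c\<in>C. ?N \<inter> snd c ` fst c) = ?N"
  proof
    show "?N \<subseteq> (\<Union>c\<in>C. ?N \<inter> snd c ` fst c)"
    proof
      fix p assume p: "p \<in> ?N"
      then have "p \<in> ?M" by simp
      then obtain U \<phi> where "(U, \<phi>) \<in> C" "p \<in> \<phi> ` U"
        unfolding C_def by (rule frontier_dom_D_charts[OF m])
      with p show "p \<in> (\<Union>c\<in>C. ?N \<inter> snd c ` fst c)"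
        by (intro UN_I[of "(U, \<phi>)"]) auto
    qed
  qed auto
  ultimately show ?thesis by simp
qed

section \<open>The surface measure as a push-forward from a box\<close>

text \<open>\<open>polar_chart\<close> again, but on an iterated product: charts live on
  \<open>real ^ 3\<close>, whereas Tonelli and Fubini are available for product measures.\<close>

definition polar_map :: "nat \<Rightarrow> real \<times> real \<times> real \<Rightarrow> complex \<times> complex" where
  "polar_map m = (\<lambda>(r, s, t). (of_real (sqrt (1 - r ^ (2 * m))) * cis s, of_real r * cis t))"

definition polar_box :: "(real \<times> real \<times> real) set" where
  "polar_box = {0<..<1} \<times> {0<..<2 * pi} \<times> {0<..<2 * pi}"

definition polar_weight :: "nat \<Rightarrow> real \<Rightarrow> real" where
  "polar_weight m r = ((real m)\<^sup>2 * r ^ (2 * (m - 1))) powr (1/3) * r"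

lemma box_Pair: "box (a, c) (b, d) = box a b \<times> box c d"
  by (auto simp: box_def Basis_prod_def inner_prod_def ball_Un)

lemma emeasure_lborel_Times:
  fixes A :: "'a :: euclidean_space set" and B :: "'b :: euclidean_space set"
  assumes "A \<in> sets borel" "B \<in> sets borel"
  shows "emeasure lborel (A \<times> B) = emeasure lborel A * emeasure lborel B"
  using assms by (simp add: lborel_prod[symmetric] lborel.emeasure_pair_measure_Times)

lemma vector_3_measurable: "(\<lambda>(a, b, c). vector [a, b, c] :: real ^ 3) \<in> borel_measurable borel"
proof (rule borel_measurable_continuous_onI)
  let ?T = "\<lambda>(a, b, c). vector [a, b, c] :: real ^ 3"
  have eq: "?T = (\<lambda>p. \<chi> i. if i = 1 then fst p else if i = 2 then fst (snd p) else snd (snd p))"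
    by (auto simp: fun_eq_iff vec_eq_iff forall_3)
  show "continuous_on UNIV ?T"
    unfolding eq
  proof (intro continuous_on_vec_lambda)
    fix i :: 3
    show "continuous_on UNIV (\<lambda>p::real \<times> real \<times> real. if i = 1 then fst p else if i = 2 then fst (snd p) else snd (snd p))"
      by (cases "i = 1"; cases "i = 2") (auto intro!: continuous_intros)
  qed
qed

text \<open>Lebesgue measure is determined by its values on boxes, and the preimage of a box under
  the coordinate map is the box with the same sides.\<close>

lemma lborel_eq_distr_vector_3: "(lborel :: (real ^ 3) measure) = distr lborel borel (\<lambda>(a, b, c). vector [a, b, c])"
proof (rule lborel_eqI)
  let ?T = "\<lambda>(a, b, c). vector [a, b, c] :: real ^ 3"
  note T = vector_3_measurable
  fix l u :: "real ^ 3"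
  assume le: "\<And>b. b \<in> Basis \<Longrightarrow> l \<bullet> b \<le> u \<bullet> b"
  have lu: "l $ i \<le> u $ i" for i
    using le[of "axis i 1"] by (auto simp: inner_axis Basis_vec_def)
  have "?T -` box l u = box (l $ 1, l $ 2, l $ 3) (u $ 1, u $ 2, u $ 3)"
    by (auto simp: mem_box_cart forall_3 box_Pair)
  then have "emeasure (distr lborel borel ?T) (box l u) = emeasure lborel (box (l $ 1, l $ 2, l $ 3) (u $ 1, u $ 2, u $ 3))"
    using T by (simp add: emeasure_distr)
  also have "\<dots> = ennreal ((u $ 1 - l $ 1) * ((u $ 2 - l $ 2) * (u $ 3 - l $ 3)))"
    using lu by (simp add: box_Pair emeasure_lborel_Times borel_open open_Times ennreal_mult)
  also have "(u $ 1 - l $ 1) * ((u $ 2 - l $ 2) * (u $ 3 - l $ 3)) = (\<Prod>i\<in>UNIV. (u - l) $ i)"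
    unfolding UNIV_3 by (simp add: mult.assoc)
  also have "\<dots> = (\<Prod>b\<in>Basis. (u - l) \<bullet> b)"
  proof -
    have B: "Basis = range (\<lambda>i :: 3. axis i (1 :: real))"
      by (auto simp: Basis_vec_def)
    show ?thesis
      unfolding B by (subst prod.reindex) (auto simp: inj_on_def axis_eq_axis inner_axis)
  qed
  finally show "emeasure (distr lborel borel ?T) (box l u) = ennreal (prod ((\<bullet>) (u - l)) Basis)" .
qed simp

lemma polar_chart_vector: "polar_chart m (vector [r, s, t]) = polar_map m (r, s, t)"
  by (simp add: polar_chart_def polar_map_def)

lemma polar_map_measurable:
  assumes m: "m \<ge> 1"
  shows "polar_map m \<in> restrict_space lborel polar_box \<rightarrow>\<^sub>M restrict_space borel (frontier (dom_D m))"
proof (rule measurable_restrict_space2)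
  show "polar_map m \<in> space (restrict_space lborel polar_box) \<rightarrow> frontier (dom_D m)"
    using polar_chart_rho[of "vector [r, s, t]" m for r s t]
    by (auto simp: space_restrict_space polar_box_def frontier_dom_D[OF m] polar_chart_vector)
  have "polar_map m \<in> borel_measurable borel"
    unfolding polar_map_def case_prod_beta
    by (intro borel_measurable_continuous_onI continuous_intros)
  then show "polar_map m \<in> borel_measurable (restrict_space lborel polar_box)"
    by (intro measurable_restrict_space1) simp
qed

lemma sets_polar_box [measurable]: "polar_box \<in> sets borel"
  unfolding polar_box_def by (intro borel_open open_Times) auto

lemma polar_weight_measurable:
  "(\<lambda>x. polar_weight m (fst x)) \<in> borel_measurable (restrict_space lborel polar_box)"
proof -
  have "polar_weight m \<in> borel_measurable borel"
    unfolding polar_weight_def[abs_def] by measurable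
  moreover have "fst \<in> borel_measurable (restrict_space lborel polar_box)"
    by (intro measurable_restrict_space1) (simp add: borel_measurable_continuous_onI continuous_on_fst)
  ultimately show ?thesis
    by (rule measurable_compose[rotated])
qed

lemma area_measurable:
  "(\<lambda>x. ennreal (fst x * sqrt (1 - fst x ^ (2 * m) + (real m)\<^sup>2 * fst x ^ (2 * (2 * m - 1)))))
     \<in> borel_measurable (restrict_space lborel polar_box)"
proof (intro measurable_restrict_space1)
  have "(\<lambda>x :: real \<times> real \<times> real. fst x * sqrt (1 - fst x ^ (2 * m) + (real m)\<^sup>2 * fst x ^ (2 * (2 * m - 1))))
     \<in> borel_measurable borel"
    by (intro borel_measurable_continuous_onI continuous_intros)
  then show "(\<lambda>x :: real \<times> real \<times> real. ennreal (fst x * sqrt (1 - fst x ^ (2 * m) + (real m)\<^sup>2 * fst x ^ (2 * (2 * m - 1)))))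
     \<in> borel_measurable lborel"
    by simp
qed

text \<open>The defining property fixes the measure on the image of a chart. The image of the polar
  chart with both windows starting at 0 contains every boundary point with non-real coordinates, so
  it carries all of the measure and determines it.\<close>

lemma euclidean_surface_measure_polar:
  assumes m: "m \<ge> 1" and \<sigma>: "euclidean_surface_measure (frontier (dom_D m)) \<sigma>"
  shows "\<sigma> = distr (density (restrict_space lborel polar_box)
      (\<lambda>x. ennreal (fst x * sqrt (1 - fst x ^ (2 * m) + (real m)\<^sup>2 * fst x ^ (2 * (2 * m - 1))))))
      (restrict_space borel (frontier (dom_D m))) (polar_map m)"
    (is "\<sigma> = distr (density _ ?A) _ _")
proof (rule measure_eqI)
  let ?M = "frontier (dom_D m)"
  note sets = sets_euclidean_surface_measure[OF \<sigma>]
  show "sets \<sigma> = sets (distr (density (restrict_space lborel polar_box) ?A) (restrict_space borel ?M) (polar_map m))"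
    by (simp add: sets)
  fix B assume B: "B \<in> sets \<sigma>"
  let ?U = "polar_dom 0 0" and ?\<phi> = "polar_chart m"
  let ?N = "{p \<in> ?M. Im (fst p) = 0 \<or> Im (snd p) = 0}"
  have BM: "B \<subseteq> ?M" using sets.sets_into_space[OF B] sets by simp
  have BM': "B \<in> sets (restrict_space borel ?M)" using B sets by simp
  have chart: "regular_chart ?M ?U ?\<phi>" by (rule regular_chart_polar[OF m])
  have cover: "p \<in> ?\<phi> ` ?U" if p: "p \<in> ?M" "p \<notin> ?N" for p
  proof -
    obtain z w where pzw: "p = (z, w)" by force
    have im: "Im z \<noteq> 0" "Im w \<noteq> 0" using p by (auto simp: pzw)
    have pos: "Arg2pi u > 0" "u = of_real (cmod u) * cis (Arg2pi u)" if "Im u \<noteq> 0" for u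
    proof -
      have "Arg2pi u \<noteq> 0" using that by (auto simp: Arg2pi_eq_0 complex_is_Real_iff)
      then show "Arg2pi u > 0" using Arg2pi_ge_0[of u] by linarith
      show "u = of_real (cmod u) * cis (Arg2pi u)"
        using Arg2pi_eq[of u] by (simp add: cis_conv_exp)
    qed
    have "z \<noteq> 0" "w \<noteq> 0" using im by auto
    then have "(of_real (cmod z) * cis (Arg2pi z), of_real (cmod w) * cis (Arg2pi w)) \<in> ?\<phi> ` ?U"
      using p pos[OF im(1)] pos[OF im(2)] Arg2pi_lt_2pi[of z] Arg2pi_lt_2pi[of w]
      by (intro mem_polar_chart m) (auto simp: frontier_dom_D[OF m] pzw)
    then show ?thesis using pos(2)[OF im(1)] pos(2)[OF im(2)] by (simp add: pzw)
  qed
  have N: "?N \<in> null_sets \<sigma>" by (rule real_slices_null[OF m \<sigma>])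
  have "emeasure \<sigma> B = emeasure \<sigma> (B \<inter> ?\<phi> ` ?U)"
  proof (rule emeasure_eq_AE)
    show "AE p in \<sigma>. (p \<in> B) = (p \<in> B \<inter> ?\<phi> ` ?U)"
      using AE_not_in[OF N] cover BM by (auto elim!: eventually_mono)
  qed (use B regular_chart_image_sets[OF \<sigma> chart B] in auto)
  also have "\<dots> = (\<integral>\<^sup>+x\<in>{x\<in>?U. ?\<phi> x \<in> B}. ennreal (area_element ?\<phi> x) \<partial>lborel)"
    using \<sigma> chart B by (simp add: euclidean_surface_measure_def)
  \<comment> \<open>\<open>?A\<close> depends on the radius only; the 0 fills the place of the pair
    of angles.\<close>
  also have "\<dots> = (\<integral>\<^sup>+x. ?A (x $ 1, 0) * indicator {x\<in>?U. ?\<phi> x \<in> B} x \<partial>lborel)"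
    by (intro nn_integral_cong) (auto simp: area_element_polar[OF m] polar_dom_def split: split_indicator)
  also have "\<dots> = (\<integral>\<^sup>+p. ?A p * indicator (polar_map m -` B \<inter> polar_box) p \<partial>lborel)"
  proof -
    let ?T = "\<lambda>(a, b, c). vector [a, b, c] :: real ^ 3"
    let ?S = "{x\<in>?U. ?\<phi> x \<in> B}"
    obtain C where C: "C \<in> sets borel" "B = ?M \<inter> C"
      using BM' unfolding sets_restrict_space by auto
    have "?S = ?U \<inter> ?\<phi> -` C"
      using chart C by (auto simp: regular_chart_def)
    moreover have "?\<phi> -` C \<in> sets borel"
    proof -
      have "?\<phi> \<in> borel_measurable borel"
        unfolding polar_chart_def[abs_def] by (intro borel_measurable_continuous_onI continuous_intros)
      from measurable_sets[OF this C(1)] show ?thesis by simp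
    qed
    moreover have "?U \<in> sets borel"
      using chart by (auto simp: regular_chart_def)
    ultimately have [measurable]: "?S \<in> sets borel" by simp
    have [measurable]: "(\<lambda>x::real ^ 3. x $ 1) \<in> borel_measurable borel"
      by (intro borel_measurable_continuous_onI continuous_intros)
    have "(\<integral>\<^sup>+x. ?A (x $ 1, 0) * indicator ?S x \<partial>lborel) =
        (\<integral>\<^sup>+x. ?A (x $ 1, 0) * indicator ?S x \<partial>distr lborel borel ?T)"
      by (simp only: lborel_eq_distr_vector_3[symmetric])
    also have "\<dots> = (\<integral>\<^sup>+p. ?A (?T p $ 1, 0) * indicator ?S (?T p) \<partial>lborel)"
      using vector_3_measurable by (intro nn_integral_distr) auto
    also have "\<dots> = (\<integral>\<^sup>+p. ?A p * indicator (polar_map m -` B \<inter> polar_box) p \<partial>lborel)"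
      by (intro nn_integral_cong)
        (auto simp: polar_chart_vector polar_dom_def polar_box_def split: split_indicator)
    finally show ?thesis .
  qed
  also have "\<dots> = (\<integral>\<^sup>+p. ?A p * indicator (polar_map m -` B \<inter> polar_box) p \<partial>restrict_space lborel polar_box)"
    by (subst nn_integral_restrict_space) (auto intro!: nn_integral_cong split: split_indicator)
  also have "\<dots> = emeasure (density (restrict_space lborel polar_box) ?A) (polar_map m -` B \<inter> polar_box)"
  proof (rule emeasure_density[symmetric])
    show "?A \<in> borel_measurable (restrict_space lborel polar_box)"
      by (rule area_measurable)
    show "polar_map m -` B \<inter> polar_box \<in> sets (restrict_space lborel polar_box)"
      using measurable_sets[OF polar_map_measurable[OF m] BM'] by (simp add: space_restrict_space)
  qed
  also have "\<dots> = emeasure (distr (density (restrict_space lborel polar_box) ?A) (restrict_space borel ?M) (polar_map m)) B"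
    using polar_map_measurable[OF m] BM'
    by (subst emeasure_distr) (auto simp: space_restrict_space)
  finally show "emeasure \<sigma> B = emeasure (distr (density (restrict_space lborel polar_box) ?A) (restrict_space borel ?M) (polar_map m)) B" .
qed

lemma polar_weight_pos: "m \<ge> 1 \<Longrightarrow> 0 < r \<Longrightarrow> polar_weight m r > 0"
  by (simp add: polar_weight_def)

lemma fefferman_measure_polar:
  assumes m: "m \<ge> 1" and \<sigma>: "euclidean_surface_measure (frontier (dom_D m)) \<sigma>"
  shows "fefferman_measure m \<sigma> = distr (density (restrict_space lborel polar_box)
      (\<lambda>x. ennreal (polar_weight m (fst x)))) (restrict_space borel (frontier (dom_D m))) (polar_map m)"
proof -
  let ?A = "\<lambda>x :: real \<times> real \<times> real. ennreal (fst x * sqrt (1 - fst x ^ (2 * m) + (real m)\<^sup>2 * fst x ^ (2 * (2 * m - 1))))"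
  let ?R = "restrict_space lborel polar_box" and ?N = "restrict_space borel (frontier (dom_D m))"
  let ?d = "\<lambda>x. ennreal (fefferman_density m (polar_map m x))"
  have fd: "(\<lambda>\<xi>. ennreal (fefferman_density m \<xi>)) \<in> borel_measurable ?N"
    using fefferman_density_measurable[OF m] by simp
  have A: "?A \<in> borel_measurable ?R"
    by (rule area_measurable)
  have d: "?d \<in> borel_measurable ?R"
    using measurable_compose[OF polar_map_measurable[OF m] fd] .
  have "fefferman_measure m \<sigma> = density (distr (density ?R ?A) ?N (polar_map m)) (\<lambda>\<xi>. ennreal (fefferman_density m \<xi>))"
    unfolding fefferman_measure_def using euclidean_surface_measure_polar[OF m \<sigma>] by simp
  also have "\<dots> = distr (density (density ?R ?A) ?d) ?N (polar_map m)"
    using polar_map_measurable[OF m] by (intro density_distr fd) simp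
  also have "density (density ?R ?A) ?d = density ?R (\<lambda>x. ?A x * ?d x)"
    by (rule density_density_eq[OF A d])
  also have "\<dots> = density ?R (\<lambda>x. ennreal (polar_weight m (fst x)))"
  proof (rule density_cong)
    show "(\<lambda>x. ?A x * ?d x) \<in> borel_measurable ?R" using A d by simp
    show "(\<lambda>x. ennreal (polar_weight m (fst x))) \<in> borel_measurable ?R"
      using polar_weight_measurable by simp
    show "AE x in ?R. ?A x * ?d x = ennreal (polar_weight m (fst x))"
    proof (rule AE_I2)
      fix x assume "x \<in> space ?R"
      then obtain r s t where x: "x = (r, s, t)" "0 < r" "r < 1"
        by (auto simp: space_restrict_space polar_box_def)
      have r1: "r ^ (2 * m) < 1" using x m power_Suc_less_one[of r "2 * m - 1"] by simp
      \<comment> \<open>The common factor: it multiplies the area element and divides the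
        density.\<close>
      define Q where "Q = sqrt (1 - r ^ (2 * m) + (real m)\<^sup>2 * r ^ (2 * (2 * m - 1)))"
      have Q: "Q > 0" using r1 x by (simp add: Q_def add_pos_nonneg)
      have "rho m (polar_map m x) = 0"
        using polar_chart_rho[of "vector [r, s, t]" m] x by (simp add: polar_chart_vector)
      then have "fefferman_density m (polar_map m x) = ((real m)\<^sup>2 * r ^ (2 * (m - 1))) powr (1/3) / Q"
        using x r1 unfolding polar_map_def by (simp add: fefferman_density_eq[OF m] norm_mult Q_def)
      moreover have "?A x = ennreal (r * Q)"
        by (simp only: x fst_conv Q_def)
      ultimately show "?A x * ?d x = ennreal (polar_weight m (fst x))"
        using x Q by (simp add: polar_weight_def ennreal_mult[symmetric])
    qed
  qed
  finally show ?thesis .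
qed

lemma nn_integral_fefferman_measure:
  assumes m: "m \<ge> 1" and \<sigma>: "euclidean_surface_measure (frontier (dom_D m)) \<sigma>"
    and h: "h \<in> borel_measurable (restrict_space borel (frontier (dom_D m)))"
  shows "(\<integral>\<^sup>+\<xi>. h \<xi> \<partial>fefferman_measure m \<sigma>) =
    (\<integral>\<^sup>+x. ennreal (polar_weight m (fst x)) * h (polar_map m x) \<partial>restrict_space lborel polar_box)"
proof -
  note P = polar_map_measurable[OF m]
  have W: "(\<lambda>x. ennreal (polar_weight m (fst x))) \<in> borel_measurable (restrict_space lborel polar_box)"
    using polar_weight_measurable by simp
  have "(\<lambda>x. h (polar_map m x)) \<in> borel_measurable (restrict_space lborel polar_box)"
    by (rule measurable_compose[OF P h])
  then show ?thesis
    unfolding fefferman_measure_polar[OF m \<sigma>] using P h W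
    by (simp add: nn_integral_distr nn_integral_density)
qed

text \<open>The box moves into the integrand as an indicator, which leaves an integral over a full
  product space, ready for Fubini.\<close>

lemma has_bochner_integral_fefferman_measure:
  fixes h :: "complex \<times> complex \<Rightarrow> complex"
  assumes m: "m \<ge> 1" and \<sigma>: "euclidean_surface_measure (frontier (dom_D m)) \<sigma>"
    and h: "has_bochner_integral (fefferman_measure m \<sigma>) h v"
  shows "has_bochner_integral lborel (\<lambda>x. indicator polar_box x *\<^sub>R (polar_weight m (fst x) *\<^sub>R h (polar_map m x))) v"
proof -
  let ?R = "restrict_space lborel polar_box" and ?N = "restrict_space borel (frontier (dom_D m))"
  note P = polar_map_measurable[OF m]
  let ?W = "\<lambda>x :: real \<times> real \<times> real. polar_weight m (fst x)"
  have W: "?W \<in> borel_measurable ?R"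
    using polar_weight_measurable by simp
  have W0: "AE x in ?R. 0 \<le> ?W x"
    by (rule AE_I2) (auto simp: space_restrict_space polar_box_def polar_weight_def)
  note F = fefferman_measure_polar[OF m \<sigma>]
  have hN: "h \<in> borel_measurable ?N"
    using borel_measurable_has_bochner_integral[OF h] unfolding F by simp
  have hP: "(\<lambda>x. h (polar_map m x)) \<in> borel_measurable ?R"
    by (rule measurable_compose[OF P hN])
  have P': "polar_map m \<in> density ?R (\<lambda>x. ennreal (?W x)) \<rightarrow>\<^sub>M ?N" using P by simp
  have "integrable ?R (\<lambda>x. ?W x *\<^sub>R h (polar_map m x))"
    and "integral\<^sup>L ?R (\<lambda>x. ?W x *\<^sub>R h (polar_map m x)) = v"
    using h unfolding has_bochner_integral_iff F integrable_distr_eq[OF P' hN] integral_distr[OF P' hN]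
      integrable_density[OF hP W W0] integral_density[OF hP W W0] by auto
  then show ?thesis
    unfolding has_bochner_integral_iff
    by (simp add: integrable_restrict_space integral_restrict_space)
qed

text \<open>The weight is strictly positive on the box, so null sets of the Fefferman measure pull
  back to Lebesgue null sets.\<close>

lemma AE_fefferman_measure:
  assumes m: "m \<ge> 1" and \<sigma>: "euclidean_surface_measure (frontier (dom_D m)) \<sigma>"
    and AE: "AE \<xi> in fefferman_measure m \<sigma>. Q \<xi>"
  shows "AE x in lborel. x \<in> polar_box \<longrightarrow> Q (polar_map m x)"
proof -
  let ?R = "restrict_space lborel polar_box" and ?N = "restrict_space borel (frontier (dom_D m))"
  let ?W = "\<lambda>x :: real \<times> real \<times> real. polar_weight m (fst x)"
  have W: "(\<lambda>x. ennreal (?W x)) \<in> borel_measurable ?R"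
    using polar_weight_measurable by simp
  have "polar_map m \<in> density ?R (\<lambda>x. ennreal (?W x)) \<rightarrow>\<^sub>M ?N"
    using polar_map_measurable[OF m] by simp
  from AE_distrD[OF this AE[unfolded fefferman_measure_polar[OF m \<sigma>]]]
  have "AE x in ?R. 0 < ennreal (?W x) \<longrightarrow> Q (polar_map m x)"
    by (simp add: AE_density[OF W])
  then have "AE x in lborel. x \<in> polar_box \<longrightarrow> 0 < ennreal (?W x) \<longrightarrow> Q (polar_map m x)"
    by (simp add: AE_restrict_space_iff)
  then show ?thesis
    by eventually_elim (auto simp: polar_box_def polar_weight_pos[OF m])
qed

section \<open>Identification of the kernel\<close>

lemma dom_D_snd_less_1:
  assumes "(z, w) \<in> dom_D m" "m \<ge> 1"
  shows "cmod w < 1"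
proof -
  have "(cmod z)\<^sup>2 + cmod w ^ (2 * m) < 1" using assms(1) by (simp add: dom_D_def)
  with zero_le_power2[of "cmod z"] have "cmod w ^ (2 * m) < 1" by linarith
  then show ?thesis
    using one_le_power[of "cmod w" "2 * m"] by (meson linorder_not_less)
qed

lemma sets_fefferman_measure:
  assumes "euclidean_surface_measure (frontier (dom_D m)) \<sigma>"
  shows "sets (fefferman_measure m \<sigma>) = sets (restrict_space borel (frontier (dom_D m)))"
  using sets_euclidean_surface_measure(1)[OF assms] by (simp add: fefferman_measure_def)

text \<open>The weight is bounded on the box, and the box is bounded.\<close>

lemma nn_integral_fefferman_measure_1_finite:
  assumes m: "m \<ge> 1" and \<sigma>: "euclidean_surface_measure (frontier (dom_D m)) \<sigma>"
  shows "(\<integral>\<^sup>+\<xi>. 1 \<partial>fefferman_measure m \<sigma>) < \<infinity>"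
proof -
  let ?c = "((real m)\<^sup>2) powr (1/3)"
  have "(\<integral>\<^sup>+\<xi>. 1 \<partial>fefferman_measure m \<sigma>) =
      (\<integral>\<^sup>+x. ennreal (polar_weight m (fst x)) * 1 \<partial>restrict_space lborel polar_box)"
    by (rule nn_integral_fefferman_measure[OF m \<sigma>]) simp
  also have "\<dots> \<le> (\<integral>\<^sup>+x. ennreal ?c \<partial>restrict_space lborel polar_box)"
  proof (rule nn_integral_mono)
    fix x assume "x \<in> space (restrict_space lborel polar_box)"
    then have x: "0 < fst x" "fst x < 1" by (auto simp: space_restrict_space polar_box_def)
    have "(real m)\<^sup>2 * fst x ^ (2 * (m - 1)) \<le> (real m)\<^sup>2 * 1"
      using x by (intro mult_left_mono power_le_one) auto
    then have "((real m)\<^sup>2 * fst x ^ (2 * (m - 1))) powr (1/3) \<le> ?c"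
      using x by (intro powr_mono2) auto
    then have "((real m)\<^sup>2 * fst x ^ (2 * (m - 1))) powr (1/3) * fst x \<le> ?c * 1"
      using x by (intro mult_mono) auto
    then show "ennreal (polar_weight m (fst x)) * 1 \<le> ennreal ?c"
      by (simp add: polar_weight_def ennreal_leI)
  qed
  also have "\<dots> = ennreal ?c * emeasure lborel polar_box"
    by (simp add: emeasure_restrict_space space_restrict_space)
  also have "\<dots> < \<infinity>"
  proof -
    have "polar_box \<subseteq> cbox (0, 0, 0) (1, 2 * pi, 2 * pi)"
      by (auto simp: polar_box_def cbox_Pair_eq)
    then have "emeasure lborel polar_box \<le> emeasure lborel (cbox (0, 0, 0) (1, 2 * pi, 2 * pi) :: (real \<times> real \<times> real) set)"
      by (rule emeasure_mono) simp
    also have "\<dots> < \<infinity>" by (rule emeasure_lborel_cbox_finite)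
    finally show ?thesis by (simp add: ennreal_mult_less_top)
  qed
  finally show ?thesis .
qed

text \<open>Both coordinates have modulus below 1 on the domain, so the maximal function is at most
  1, and the total mass is finite.\<close>

lemma monomial_fefferman_hardy:
  assumes m: "m \<ge> 1" and \<sigma>: "euclidean_surface_measure (frontier (dom_D m)) \<sigma>"
  shows "(\<lambda>p. fst p ^ j * snd p ^ k) \<in> fefferman_hardy m \<alpha> \<sigma>"
proof -
  let ?f = "\<lambda>p :: complex \<times> complex. fst p ^ j * snd p ^ k"
  let ?N = "nt_maximal m \<alpha> ?f"
  have "(?f has_derivative (\<lambda>h. (of_nat j * fst p ^ (j - 1) * snd p ^ k) * fst h +
      (of_nat k * snd p ^ (k - 1) * fst p ^ j) * snd h)) (at p)" for p
    by (auto intro!: derivative_eq_intros simp: algebra_simps)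
  then have "holomorphic2_on ?f (dom_D m)"
    unfolding holomorphic2_on_def by blast
  moreover have "?N \<in> borel_measurable (fefferman_measure m \<sigma>)"
    using nt_maximal_measurable[OF m] measurable_cong_sets[OF sets_fefferman_measure[OF \<sigma>] refl] by blast
  moreover have "(\<integral>\<^sup>+\<xi>. (?N \<xi>)\<^sup>2 \<partial>fefferman_measure m \<sigma>) < \<infinity>"
  proof -
    have "?N \<xi> \<le> 1" for \<xi>
      unfolding nt_maximal_def
    proof (rule SUP_least)
      fix p assume "p \<in> approach_region m \<alpha> \<xi>"
      then have "(fst p, snd p) \<in> dom_D m" by (simp add: approach_region_def)
      then have "cmod (fst p) < 1" "cmod (snd p) < 1"
        using dom_D_fst_less_1 dom_D_snd_less_1[OF _ m] by blast+
      then have "cmod (fst p) ^ j * cmod (snd p) ^ k \<le> 1 * 1"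
        by (intro mult_mono power_le_one) auto
      then show "ennreal (cmod (?f p)) \<le> 1"
        by (simp add: norm_mult norm_power)
    qed
    then have "(?N \<xi>)\<^sup>2 \<le> 1" for \<xi>
      by (simp add: power_le_one)
    then have "(\<integral>\<^sup>+\<xi>. (?N \<xi>)\<^sup>2 \<partial>fefferman_measure m \<sigma>) \<le> (\<integral>\<^sup>+\<xi>. 1 \<partial>fefferman_measure m \<sigma>)"
      by (intro nn_integral_mono) auto
    also have "\<dots> < \<infinity>" by (rule nn_integral_fefferman_measure_1_finite[OF m \<sigma>])
    finally show ?thesis .
  qed
  ultimately show ?thesis by (simp add: fefferman_hardy_def)
qed

lemma monomial_nt_boundary_value:
  assumes \<sigma>: "euclidean_surface_measure (frontier (dom_D m)) \<sigma>"
  shows "nt_boundary_value m \<alpha> \<sigma> (\<lambda>p. fst p ^ j * snd p ^ k) (\<lambda>p. fst p ^ j * snd p ^ k)"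
proof -
  let ?f = "\<lambda>p :: complex \<times> complex. fst p ^ j * snd p ^ k"
  have "?f \<in> borel_measurable (restrict_space borel (frontier (dom_D m)))"
    by (intro measurable_restrict_space1 borel_measurable_continuous_onI continuous_intros)
  then have "?f \<in> borel_measurable (fefferman_measure m \<sigma>)"
    using measurable_cong_sets[OF sets_fefferman_measure[OF \<sigma>] refl] by blast
  moreover have "(?f \<longlongrightarrow> ?f \<xi>) (at \<xi> within A)" for \<xi> A
    by (intro tendsto_intros)
  ultimately show ?thesis
    by (simp add: nt_boundary_value_def)
qed

section \<open>Fourier moments of boundary values\<close>

text \<open>Connects the Lebesgue integral over the open square of angles with the iterated
  integrals in which the torus coefficients are stated; the boundary of the square is null.\<close>

lemma integral_open_square_continuous:
  fixes F :: "real \<times> real \<Rightarrow> complex"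
  assumes "continuous_on UNIV F"
  shows "integral\<^sup>L lborel (\<lambda>x. indicator ({0<..<b} \<times> {0<..<b}) x *\<^sub>R F x) =
    integral {0..b} (\<lambda>s. integral {0..b} (\<lambda>t. F (s, t)))"
proof -
  let ?C = "cbox (0, 0) (b, b) :: (real \<times> real) set"
  have F: "continuous_on ?C F" using assms continuous_on_subset by blast
  have "?C - box (0, 0) (b, b) \<in> null_sets lborel"
  proof -
    have "negligible (?C - box (0, 0) (b, b))" by (rule negligible_frontier_interval)
    then show ?thesis
      using null_sets_completion_iff[of "?C - box (0, 0) (b, b)" lborel]
      by (simp add: negligible_iff_null_sets)
  qed
  from AE_not_in[OF this]
  have "AE x in lborel. indicator ({0<..<b} \<times> {0<..<b}) x *\<^sub>R F x = indicator ?C x *\<^sub>R F x"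
    by eventually_elim (auto simp: box_Pair cbox_Pair_eq split: split_indicator)
  moreover have int: "set_integrable lborel ?C F"
    unfolding set_integrable_def using F by (intro borel_integrable_compact) auto
  moreover have "(\<lambda>x. indicator ({0<..<b} \<times> {0<..<b}) x *\<^sub>R F x) \<in> borel_measurable lborel"
    using assms by (intro borel_measurable_scaleR) (auto simp: borel_measurable_continuous_onI borel_open open_Times)
  ultimately have "integral\<^sup>L lborel (\<lambda>x. indicator ({0<..<b} \<times> {0<..<b}) x *\<^sub>R F x) =
      integral\<^sup>L lborel (\<lambda>x. indicator ?C x *\<^sub>R F x)"
    by (intro integral_cong_AE) (auto simp: set_integrable_def)
  also have "\<dots> = integral ?C F"
    using set_borel_integral_eq_integral(2)[OF int] by (simp add: set_lebesgue_integral_def)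
  also have "\<dots> = integral {0..b} (\<lambda>s. integral {0..b} (\<lambda>t. F (s, t)))"
    using integral_prod_continuous[of 0 0 b b F] F by simp
  finally show ?thesis .
qed

text \<open>For fixed r the boundary torus with moduli \<open>sqrt (1 - r ^ (2 * m))\<close> and r
  is approached by its own dilates inside the domain, where the coefficient formula is exact.
  Dominated convergence carries it to the boundary, and integration over r turns the powers of the
  moduli into a Beta integral. The factor of \<open>a j k\<close> in the result is the squared norm
  of the monomial.\<close>

lemma boundary_moment:
  fixes a :: "nat \<Rightarrow> nat \<Rightarrow> complex"
  assumes m: "m \<ge> 1" and \<alpha>: "\<alpha> > 0" and \<sigma>: "euclidean_surface_measure (frontier (dom_D m)) \<sigma>"
    and f: "f \<in> fefferman_hardy m \<alpha> \<sigma>" and g: "nt_boundary_value m \<alpha> \<sigma> f g"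
    and a: "\<And>p q j k. 0 < p \<Longrightarrow> 0 < q \<Longrightarrow> (of_real p, of_real q) \<in> dom_D m \<Longrightarrow>
        integral {0..2 * pi} (\<lambda>s. integral {0..2 * pi}
          (\<lambda>t. f (of_real p * cis s, of_real q * cis t) * cis (- (real k * t))) * cis (- (real j * s))) =
        4 * pi\<^sup>2 * a j k * of_real p ^ j * of_real q ^ k"
    and v: "has_bochner_integral (fefferman_measure m \<sigma>) (\<lambda>\<xi>. g \<xi> * cnj (fst \<xi> ^ j * snd \<xi> ^ k)) v"
  shows "v = a j k * of_real (4 * pi\<^sup>2 * m powr (2/3) / (2 * m) *
    (fact j / pochhammer ((3 * real k + m + 2) / (3 * m)) (Suc j)))"
proof -
  define T where "T = {0<..<2 * pi} \<times> {0<..<2 * pi}"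
  have T: "T \<in> sets borel" unfolding T_def by (intro borel_open open_Times) auto
  have box: "polar_box = {0<..<1} \<times> T" by (simp add: polar_box_def T_def)
  define N where "N = nt_maximal m \<alpha> f"
  define e where "e = (\<lambda>\<xi> :: complex \<times> complex. fst \<xi> ^ j * snd \<xi> ^ k)"
  define W where "W = polar_weight m"
  have hol: "holomorphic2_on f (dom_D m)" using f by (simp add: fefferman_hardy_def)
  note contf = holomorphic2_on_imp_continuous_on[OF hol]
  define u where "u = (\<lambda>x. indicator polar_box x *\<^sub>R (W (fst x) *\<^sub>R (g (polar_map m x) * cnj (e (polar_map m x)))))"
  have u: "has_bochner_integral (lborel \<Otimes>\<^sub>M lborel) u v"
    using has_bochner_integral_fefferman_measure[OF m \<sigma> v] unfolding u_def W_def e_def lborel_prod .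
  have u_meas: "u \<in> borel_measurable (lborel \<Otimes>\<^sub>M lborel)"
    using u by (rule borel_measurable_has_bochner_integral)
  have "integrable (lborel \<Otimes>\<^sub>M lborel) u" using u by (simp add: has_bochner_integral_iff)
  from lborel_pair.integral_fst'[OF this]
  have v_eq: "v = (LBINT r. LBINT x. u (r, x))"
    using u by (simp add: has_bochner_integral_iff)
  \<comment> \<open>Fubini for null sets: on almost every torus the boundary limit exists at almost
    every point.\<close>
  have conv: "AE r in lborel. AE x in lborel. (r, x) \<in> polar_box \<longrightarrow>
      (f \<longlongrightarrow> g (polar_map m (r, x))) (at (polar_map m (r, x)) within approach_region m \<alpha> (polar_map m (r, x)))"
  proof -
    have "AE x in lborel \<Otimes>\<^sub>M lborel. x \<in> polar_box \<longrightarrow>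
        (f \<longlongrightarrow> g (polar_map m x)) (at (polar_map m x) within approach_region m \<alpha> (polar_map m x))"
      unfolding lborel_prod using g
      by (intro AE_fefferman_measure[OF m \<sigma>]) (simp add: nt_boundary_value_def)
    from lborel_pair.AE_pair[OF this] show ?thesis .
  qed
  \<comment> \<open>Tonelli for the squared maximal function: on almost every torus its integral
    over the angles is finite, which later supplies the dominating function.\<close>
  define F where "F = (\<lambda>x. ennreal (W (fst x)) * (N (polar_map m x))\<^sup>2 * indicator polar_box x)"
  have N_meas: "(\<lambda>x. N (polar_map m x)) \<in> borel_measurable (restrict_space lborel polar_box)"
    unfolding N_def by (rule measurable_compose[OF polar_map_measurable[OF m] nt_maximal_measurable[OF m]])
  have W_meas: "(\<lambda>x. W (fst x)) \<in> borel_measurable (restrict_space lborel polar_box)"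
    unfolding W_def by (rule polar_weight_measurable)
  have F_meas: "F \<in> borel_measurable (lborel \<Otimes>\<^sub>M lborel)"
  proof -
    have "(\<lambda>x. ennreal (W (fst x)) * (N (polar_map m x))\<^sup>2) \<in> borel_measurable (restrict_space lborel polar_box)"
      using N_meas W_meas by simp
    then show ?thesis
      unfolding F_def lborel_prod by (subst (asm) borel_measurable_restrict_space_iff_ennreal) auto
  qed
  have G_meas: "(\<lambda>x. N (polar_map m x) * indicator polar_box x) \<in> borel_measurable (lborel \<Otimes>\<^sub>M lborel)"
    using N_meas unfolding lborel_prod by (subst (asm) borel_measurable_restrict_space_iff_ennreal) auto
  have "(\<integral>\<^sup>+r. \<integral>\<^sup>+x. F (r, x) \<partial>lborel \<partial>lborel) = (\<integral>\<^sup>+x. F x \<partial>(lborel \<Otimes>\<^sub>M lborel))"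
    by (rule lborel.nn_integral_fst[OF F_meas])
  also have "\<dots> = (\<integral>\<^sup>+x. ennreal (W (fst x)) * (N (polar_map m x))\<^sup>2 \<partial>restrict_space lborel polar_box)"
    unfolding lborel_prod F_def by (subst nn_integral_restrict_space) auto
  also have "\<dots> = (\<integral>\<^sup>+\<xi>. (N \<xi>)\<^sup>2 \<partial>fefferman_measure m \<sigma>)"
    unfolding W_def N_def
    by (rule nn_integral_fefferman_measure[OF m \<sigma>, symmetric]) (use nt_maximal_measurable[OF m] in simp)
  also have "\<dots> < \<infinity>" using f by (simp add: fefferman_hardy_def N_def)
  finally have "AE r in lborel. (\<integral>\<^sup>+x. F (r, x) \<partial>lborel) \<noteq> \<infinity>"
    by (intro nn_integral_PInf_AE lborel.borel_measurable_nn_integral_fst F_meas) auto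
  with conv have inner: "AE r in lborel. (LBINT x. u (r, x)) =
      4 * pi\<^sup>2 * a j k * of_real (indicator {0<..<1} r *\<^sub>R (W r * (1 - r ^ (2 * m)) ^ j * r ^ (2 * k)))"
  proof eventually_elim
    case (elim r)
    show ?case
    proof (cases "r \<in> {0<..<1}")
      case False
      then have "u (r, x) = 0" for x by (simp add: u_def box indicator_times)
      then show ?thesis using False by simp
    next
      case r: True
      define p where "p = sqrt (1 - r ^ (2 * m))"
      have "r ^ (2 * m) < 1" using r m power_Suc_less_one[of r "2 * m - 1"] by simp
      then have p: "p > 0" "p\<^sup>2 = 1 - r ^ (2 * m)" by (auto simp: p_def)
      have Wr: "W r > 0" unfolding W_def using r by (intro polar_weight_pos m) auto
      define \<Phi> where "\<Phi> = (\<lambda>x. polar_map m (r, x))"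
      have \<Phi>: "\<Phi> (s, t) = (of_real p * cis s, of_real r * cis t)" for s t
        by (simp add: \<Phi>_def polar_map_def p_def)
      define \<xi> where "\<xi> = (complex_of_real p, complex_of_real r)"
      have \<Phi>_rot: "\<Phi> (s, t) = torus_rotation s t \<xi>" for s t
        by (simp add: \<Phi> \<xi>_def torus_rotation_def mult.commute)
      have rho0: "rho m \<xi> = 0" using p r by (simp add: \<xi>_def rho_def)
      obtain r0 where r0: "0 \<le> r0" "r0 < 1"
        "\<And>q s t. r0 < q \<Longrightarrow> q < 1 \<Longrightarrow> q *\<^sub>R torus_rotation s t \<xi> \<in> approach_region m \<alpha> (torus_rotation s t \<xi>)"
        using radial_approach[OF m \<alpha> rho0] by metis
      \<comment> \<open>The double \<open>Suc\<close> keeps even the first dilation factor strictly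
        above \<open>r0\<close>.\<close>
      define \<rho> where "\<rho> = (\<lambda>n. 1 - (1 - r0) / of_nat (Suc (Suc n)))"
      have \<rho>: "r0 < \<rho> n" "\<rho> n < 1" for n
      proof -
        have "(1 - r0) / of_nat (Suc (Suc n)) < 1 - r0"
          using r0 by (simp add: divide_less_eq)
        then show "r0 < \<rho> n" by (simp add: \<rho>_def)
        show "\<rho> n < 1" using r0 by (simp add: \<rho>_def)
      qed
      have \<rho>0: "0 < \<rho> n" for n using \<rho>(1)[of n] r0(1) by linarith
      have \<rho>_lim: "\<rho> \<longlonglongrightarrow> 1"
      proof -
        have "(\<lambda>n. (1 - r0) / of_nat (Suc (Suc n))) \<longlonglongrightarrow> 0"
          using LIMSEQ_Suc[OF LIMSEQ_Suc[OF lim_const_over_n[of "1 - r0"]]] .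
        from tendsto_diff[OF tendsto_const[of 1] this] show ?thesis by (simp add: \<rho>_def)
      qed
      have appr: "\<rho> n *\<^sub>R \<Phi> x \<in> approach_region m \<alpha> (\<Phi> x)" for n x
        using r0(3)[OF \<rho>] \<Phi>_rot by (cases x) simp
      then have inD: "\<rho> n *\<^sub>R \<Phi> x \<in> dom_D m" for n x
        by (auto simp: approach_region_def)
      have \<Phi>_cont: "continuous_on UNIV \<Phi>"
        unfolding \<Phi>_def polar_map_def case_prod_beta by (intro continuous_intros)
      define h where "h = (\<lambda>n x. f (\<rho> n *\<^sub>R \<Phi> x) * cnj (e (\<Phi> x)))"
      have h_cont: "continuous_on UNIV (h n)" for n
      proof -
        have "continuous_on UNIV (\<lambda>x. f (\<rho> n *\<^sub>R \<Phi> x))"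
          by (rule continuous_on_compose2[OF contf]) (auto intro!: continuous_intros \<Phi>_cont inD)
        moreover have "continuous_on UNIV (\<lambda>x. cnj (e (\<Phi> x)))"
          unfolding e_def by (intro continuous_intros \<Phi>_cont)
        ultimately show ?thesis unfolding h_def by (rule continuous_on_mult)
      qed
      define H where "H = (\<lambda>n x. W r *\<^sub>R (indicator T x *\<^sub>R h n x))"
      \<comment> \<open>Only f is dilated, while the conjugated monomial stays on the boundary
        torus. Hence the dilation enters as the single power \<open>\<rho> n ^ (j + k)\<close>,
        which tends to 1.\<close>
      have H_int: "integral\<^sup>L lborel (H n) = 4 * pi\<^sup>2 * a j k * of_real (W r * (\<rho> n ^ (j + k) * ((p\<^sup>2) ^ j * r ^ (2 * k))))" for n
      proof -
        have D: "(complex_of_real (\<rho> n * p), complex_of_real (\<rho> n * r)) \<in> dom_D m"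
          using inD[of n "(0, 0)"] by (simp add: \<Phi> scaleR_conv_of_real)
        have "integral\<^sup>L lborel (\<lambda>x. indicator T x *\<^sub>R h n x) =
            integral {0..2 * pi} (\<lambda>s. integral {0..2 * pi} (\<lambda>t. h n (s, t)))"
          unfolding T_def by (rule integral_open_square_continuous[OF h_cont])
        also have "\<dots> = integral {0..2 * pi} (\<lambda>s. integral {0..2 * pi} (\<lambda>t. (of_real (p ^ j * r ^ k) * cis (- (real j * s))) *
            (f (of_real (\<rho> n * p) * cis s, of_real (\<rho> n * r) * cis t) * cis (- (real k * t)))))"
        proof -
          have "h n (s, t) = (of_real (p ^ j * r ^ k) * cis (- (real j * s))) *
            (f (of_real (\<rho> n * p) * cis s, of_real (\<rho> n * r) * cis t) * cis (- (real k * t)))" for s t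
            unfolding h_def e_def \<Phi>
            by (simp add: scaleR_conv_of_real power_mult_distrib Complex.DeMoivre cis_cnj mult_ac)
          then show ?thesis by simp
        qed
        also have "\<dots> = integral {0..2 * pi} (\<lambda>s. of_real (p ^ j * r ^ k) * (integral {0..2 * pi}
            (\<lambda>t. f (of_real (\<rho> n * p) * cis s, of_real (\<rho> n * r) * cis t) * cis (- (real k * t))) * cis (- (real j * s))))"
          by (intro integral_cong) (simp only: integral_mult_right, simp only: mult_ac)
        also have "\<dots> = of_real (p ^ j * r ^ k) * (4 * pi\<^sup>2 * a j k * of_real (\<rho> n * p) ^ j * of_real (\<rho> n * r) ^ k)"
          unfolding integral_mult_right using \<rho>0[of n] p r by (subst a[OF _ _ D]) auto
        also have "\<dots> = 4 * pi\<^sup>2 * a j k * of_real (\<rho> n ^ (j + k) * ((p\<^sup>2) ^ j * r ^ (2 * k)))"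
        proof -
          have sq: "(p\<^sup>2) ^ j = p ^ j * p ^ j" "r ^ (2 * k) = r ^ k * r ^ k"
            by (simp_all add: power2_eq_square power_mult_distrib mult_2 power_add)
          show ?thesis
            unfolding sq by (simp add: power_mult_distrib power_add mult_ac)
        qed
        finally show ?thesis
          unfolding H_def by (simp add: scaleR_conv_of_real mult_ac)
      qed
      define G where "G = (\<lambda>x. N (\<Phi> x) * indicator T x)"
      have G_eq: "G x = N (polar_map m (r, x)) * indicator polar_box (r, x)" for x
        using r by (auto simp: G_def \<Phi>_def box split: split_indicator)
      have G_meas': "G \<in> borel_measurable lborel"
        unfolding G_eq[abs_def] using measurable_compose[OF measurable_Pair1'[of r lborel lborel] G_meas] by simp
      have G2: "(\<integral>\<^sup>+x. (G x)\<^sup>2 \<partial>lborel) < \<infinity>"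
      proof -
        have "F (r, x) = ennreal (W r) * (G x)\<^sup>2" for x
          by (auto simp: F_def G_eq split: split_indicator)
        then have eq: "ennreal (W r) * (\<integral>\<^sup>+x. (G x)\<^sup>2 \<partial>lborel) = (\<integral>\<^sup>+x. F (r, x) \<partial>lborel)"
          using G_meas' by (simp add: nn_integral_cmult)
        have "ennreal (W r) * (\<integral>\<^sup>+x. (G x)\<^sup>2 \<partial>lborel) \<noteq> \<infinity>"
          unfolding eq by (rule elim(2))
        then have "(\<integral>\<^sup>+x. (G x)\<^sup>2 \<partial>lborel) \<noteq> \<infinity>"
          using Wr by (auto simp: ennreal_mult_eq_top_iff)
        then show ?thesis
          by (simp add: less_top)
      qed
      \<comment> \<open>Square integrability gives integrability because the square of angles has
        finite measure, through y \<le> 1 + y^2.\<close>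
      have G1: "(\<integral>\<^sup>+x. G x \<partial>lborel) < \<infinity>"
      proof -
        have le: "G x \<le> indicator T x + (G x)\<^sup>2" for x
        proof (cases "x \<in> T")
          case True
          have "y \<le> 1 + y\<^sup>2" for y :: ennreal
          proof (cases "y \<le> 1")
            case True then show ?thesis by (simp add: add_increasing2)
          next
            case False
            then have "y * 1 \<le> y * y" by (intro mult_left_mono) auto
            then show ?thesis by (simp add: power2_eq_square add_increasing)
          qed
          then show ?thesis using True by simp
        qed (simp add: G_def)
        have "(\<integral>\<^sup>+x. G x \<partial>lborel) \<le> (\<integral>\<^sup>+x. indicator T x + (G x)\<^sup>2 \<partial>lborel)"
          by (intro nn_integral_mono le)
        also have "\<dots> = emeasure lborel T + (\<integral>\<^sup>+x. (G x)\<^sup>2 \<partial>lborel)"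
          using G_meas' T by (simp add: nn_integral_add)
        also have "emeasure lborel T < \<infinity>"
          unfolding T_def by (simp add: emeasure_lborel_Times ennreal_mult_less_top)
        finally show ?thesis using G2 by (simp add: less_top)
      qed
      define w where "w = (\<lambda>x. enn2real (G x))"
      have Gfin: "AE x in lborel. G x \<noteq> \<infinity>"
        using G1 G_meas' by (intro nn_integral_PInf_AE) auto
      have w_int: "integrable lborel w"
      proof (rule integrableI_nonneg)
        show "w \<in> borel_measurable lborel" unfolding w_def using G_meas' by simp
        have "(\<integral>\<^sup>+x. ennreal (w x) \<partial>lborel) = (\<integral>\<^sup>+x. G x \<partial>lborel)"
          by (rule nn_integral_cong_AE) (use Gfin in eventually_elim, simp add: w_def less_top)
        then show "(\<integral>\<^sup>+x. ennreal (w x) \<partial>lborel) < \<infinity>" using G1 by simp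
      qed (simp add: w_def)
      have e_le: "cmod (e (\<Phi> x)) \<le> p ^ j * r ^ k" for x
        using p r by (cases x) (simp add: e_def \<Phi> norm_mult norm_power)
      have lim: "(\<lambda>n. integral\<^sup>L lborel (H n)) \<longlonglongrightarrow> (LBINT x. u (r, x))"
      proof (rule integral_dominated_convergence)
        show "(\<lambda>x. u (r, x)) \<in> borel_measurable lborel"
          using measurable_compose[OF measurable_Pair1'[of r lborel lborel] u_meas] by simp
        show "H n \<in> borel_measurable lborel" for n
          unfolding H_def using T h_cont[of n]
          by (intro borel_measurable_scaleR borel_measurable_const borel_measurable_indicator)
            (auto intro: borel_measurable_continuous_onI)
        show "integrable lborel (\<lambda>x. W r * (p ^ j * r ^ k) * w x)"
          using w_int by simp
        show "AE x in lborel. (\<lambda>n. H n x) \<longlonglongrightarrow> u (r, x)"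
          using elim(1)
        proof eventually_elim
          case (elim x)
          show ?case
          proof (cases "x \<in> T")
            case True
            then have "(f \<longlongrightarrow> g (\<Phi> x)) (at (\<Phi> x) within approach_region m \<alpha> (\<Phi> x))"
              using elim r by (simp add: box \<Phi>_def)
            moreover have "filterlim (\<lambda>n. \<rho> n *\<^sub>R \<Phi> x) (at (\<Phi> x) within approach_region m \<alpha> (\<Phi> x)) sequentially"
              unfolding filterlim_at
            proof
              \<comment> \<open>The filter \<open>at\<close> is punctured, so the approaching points
                must differ from \<open>\<Phi> x\<close>; proper dilates of a nonzero point
                do.\<close>
              have "\<Phi> x \<noteq> 0" using r by (cases x) (simp add: \<Phi> zero_prod_def)
              then have "\<rho> n *\<^sub>R \<Phi> x \<noteq> \<Phi> x" for n
                using \<rho>(2)[of n] scaleR_cancel_right[of "\<rho> n" "\<Phi> x" 1] by auto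
              then show "\<forall>\<^sub>F n in sequentially. \<rho> n *\<^sub>R \<Phi> x \<in> approach_region m \<alpha> (\<Phi> x) \<and> \<rho> n *\<^sub>R \<Phi> x \<noteq> \<Phi> x"
                using appr by simp
              show "(\<lambda>n. \<rho> n *\<^sub>R \<Phi> x) \<longlonglongrightarrow> \<Phi> x"
                using tendsto_scaleR[OF \<rho>_lim tendsto_const[of "\<Phi> x"]] by simp
            qed
            ultimately have "(\<lambda>n. f (\<rho> n *\<^sub>R \<Phi> x)) \<longlonglongrightarrow> g (\<Phi> x)"
              by (rule filterlim_compose)
            then have "(\<lambda>n. H n x) \<longlonglongrightarrow> W r *\<^sub>R (indicator T x *\<^sub>R (g (\<Phi> x) * cnj (e (\<Phi> x))))"
              unfolding H_def h_def by (intro tendsto_intros)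
            then show ?thesis using True r by (simp add: u_def box \<Phi>_def indicator_times)
          qed (simp add: H_def u_def box indicator_times)
        qed
        show "AE x in lborel. norm (H n x) \<le> W r * (p ^ j * r ^ k) * w x" for n
          using Gfin
        proof eventually_elim
          case (elim x)
          show ?case
          proof (cases "x \<in> T")
            case True
            have "ennreal (cmod (f (\<rho> n *\<^sub>R \<Phi> x))) \<le> G x"
              using True appr[of n x] by (auto simp: G_def N_def nt_maximal_def intro: SUP_upper)
            then have "cmod (f (\<rho> n *\<^sub>R \<Phi> x)) \<le> w x"
              using elim unfolding w_def by (metis enn2real_ennreal enn2real_mono infinity_ennreal_def less_top norm_ge_zero)
            then have "cmod (f (\<rho> n *\<^sub>R \<Phi> x)) * cmod (e (\<Phi> x)) \<le> w x * (p ^ j * r ^ k)"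
              using e_le[of x] by (intro mult_mono) (auto simp: w_def)
            then show ?thesis
              using True Wr by (simp add: H_def h_def norm_mult mult_ac)
          qed (simp add: H_def w_def G_def)
        qed
      qed
      have "(\<lambda>n. integral\<^sup>L lborel (H n)) \<longlonglongrightarrow>
          4 * pi\<^sup>2 * a j k * of_real (W r * (1 ^ (j + k) * ((p\<^sup>2) ^ j * r ^ (2 * k))))"
        unfolding H_int by (intro tendsto_intros \<rho>_lim)
      from LIMSEQ_unique[OF lim this] show ?thesis
        using r by (simp add: p mult_ac)
    qed
  qed
  \<comment> \<open>The exponent \<open>b - 1\<close> of r collects
    \<open>(2 * m - 2) / 3 + 1\<close> from the weight and \<open>2 * k\<close> from the modulus of
    w, once from the Taylor term and once from the monomial.\<close>
  define b where "b = 2 * real k + (2 * real m - 2) / 3 + 2"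
  have b: "b > 0" using m by (simp add: b_def add_nonneg_pos)
  have b_m: "b / (2 * m) = (3 * real k + m + 2) / (3 * m)"
    using m by (simp add: b_def field_simps)
  have weight: "W r * (1 - r ^ (2 * m)) ^ j * r ^ (2 * k) = m powr (2/3) * (r powr (b - 1) * (1 - r ^ (2 * m)) ^ j)"
    if r: "0 < r" for r
  proof -
    have "W r = ((real m)\<^sup>2) powr (1/3) * (r ^ (2 * (m - 1))) powr (1/3) * r"
      using r by (simp add: W_def polar_weight_def powr_mult)
    also have "((real m)\<^sup>2) powr (1/3) = m powr (2/3)"
    proof -
      have "(real m)\<^sup>2 = real m powr real 2"
        by (rule powr_realpow[symmetric]) (use m in simp)
      then have "((real m)\<^sup>2) powr (1/3) = real m powr (real 2 * (1/3))"
        by (simp only: powr_powr)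
      then show ?thesis by simp
    qed
    also have "(r ^ (2 * (m - 1))) powr (1/3) = r powr ((2 * real m - 2) / 3)"
    proof -
      have "r ^ (2 * (m - 1)) = r powr real (2 * (m - 1))"
        by (rule powr_realpow[symmetric]) (rule r)
      then have "(r ^ (2 * (m - 1))) powr (1/3) = r powr (real (2 * (m - 1)) * (1/3))"
        by (simp only: powr_powr)
      moreover have "real (2 * (m - 1)) * (1/3) = (2 * real m - 2) / 3"
        using m by (simp add: of_nat_diff)
      ultimately show ?thesis by (simp only:)
    qed
    finally have W: "W r = m powr (2/3) * r powr ((2 * real m - 2) / 3) * r" .
    have "r powr (b - 1) = r powr ((2 * real m - 2) / 3 + 1 + real (2 * k))"
      by (simp add: b_def algebra_simps)
    also have "\<dots> = r powr ((2 * real m - 2) / 3) * r * r ^ (2 * k)"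
      using r by (simp only: powr_add powr_realpow powr_one)
    finally show ?thesis unfolding W by (simp only: mult_ac)
  qed
  have "has_bochner_integral lborel (\<lambda>r. indicator {0<..<1} r *\<^sub>R (W r * (1 - r ^ (2 * m)) ^ j * r ^ (2 * k)))
      (m powr (2/3) * (fact j / (2 * m * pochhammer (b / (2 * m)) (Suc j))))"
    (is "has_bochner_integral _ ?w ?I")
  proof -
    have "?w = (\<lambda>r. m powr (2/3) * (indicator {0<..<1} r *\<^sub>R (r powr (b - 1) * (1 - r ^ (2 * m)) ^ j)))"
      using weight by (auto simp: fun_eq_iff split: split_indicator)
    then show ?thesis
      using has_bochner_integral_mult_right[OF has_bochner_integral_beta_power[OF m b, of j], of "m powr (2/3)"]
      by simp
  qed
  from has_bochner_integral_mult_right[OF has_bochner_integral_of_real[OF this], of "4 * pi\<^sup>2 * a j k"]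
  have "has_bochner_integral lborel (\<lambda>r. 4 * pi\<^sup>2 * a j k * of_real (?w r)) (4 * pi\<^sup>2 * a j k * of_real ?I)"
    by simp
  moreover have "v = (LBINT r. 4 * pi\<^sup>2 * a j k * of_real (?w r))"
    unfolding v_eq
  proof (rule integral_cong_AE)
    show "(\<lambda>r. LBINT x. u (r, x)) \<in> borel_measurable lborel"
      using u_meas by (intro lborel.borel_measurable_lebesgue_integral) simp
    show "(\<lambda>r. 4 * pi\<^sup>2 * a j k * of_real (?w r)) \<in> borel_measurable lborel"
      using calculation by (rule borel_measurable_has_bochner_integral)
  qed (rule inner)
  ultimately have "v = 4 * pi\<^sup>2 * a j k * of_real ?I"
    by (simp add: has_bochner_integral_iff)
  then show ?thesis
    unfolding b_m by (simp add: mult_ac del: pochhammer_Suc)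
qed

text \<open>Reproducing monomials and conjugating gives the moments of the boundary value of
  \<open>cnj (S \<zeta> \<eta>)\<close>: they are the conjugated monomials at \<zeta>. By
  \<open>boundary_moment\<close> they are also Taylor coefficients times squared norms. Dividing by
  the norms yields exactly the coefficients that \<open>szego_form_sums\<close> adds up.\<close>

lemma fefferman_szego_kernel_eq:
  assumes m: "m \<ge> 1" and \<alpha>: "\<alpha> > 0" and \<sigma>: "euclidean_surface_measure (frontier (dom_D m)) \<sigma>"
    and S: "fefferman_szego_kernel m \<alpha> \<sigma> S" and \<zeta>: "\<zeta> \<in> dom_D m" and \<eta>: "\<eta> \<in> dom_D m"
  shows "cnj (S \<zeta> \<eta>) = szego_form m \<zeta> \<eta>"
proof -
  obtain z0 w0 z w where zw: "\<zeta> = (z0, w0)" "\<eta> = (z, w)"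
    by (metis surj_pair)
  let ?f = "\<lambda>\<eta>. cnj (S \<zeta> \<eta>)"
  have f: "?f \<in> fefferman_hardy m \<alpha> \<sigma>"
    using S \<zeta> by (auto simp: fefferman_szego_kernel_def)
  obtain s where s: "nt_boundary_value m \<alpha> \<sigma> (S \<zeta>) s"
    and rep: "\<And>h g. h \<in> fefferman_hardy m \<alpha> \<sigma> \<Longrightarrow> nt_boundary_value m \<alpha> \<sigma> h g \<Longrightarrow>
      has_bochner_integral (fefferman_measure m \<sigma>) (\<lambda>\<xi>. s \<xi> * g \<xi>) (h \<zeta>)"
    using S \<zeta> unfolding fefferman_szego_kernel_def by blast
  \<comment> \<open>The Hardy function is the conjugate of \<open>S \<zeta>\<close>, whereas
    \<open>s\<close> is the boundary value of \<open>S \<zeta>\<close> itself.\<close>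
  have g: "nt_boundary_value m \<alpha> \<sigma> ?f (\<lambda>\<xi>. cnj (s \<xi>))"
    unfolding nt_boundary_value_def
  proof
    have "s \<in> borel_measurable (fefferman_measure m \<sigma>)"
      using s by (simp add: nt_boundary_value_def)
    then show "(\<lambda>\<xi>. cnj (s \<xi>)) \<in> borel_measurable (fefferman_measure m \<sigma>)"
      by (rule measurable_compose) (intro borel_measurable_continuous_onI continuous_intros)
    have "AE \<xi> in fefferman_measure m \<sigma>. (S \<zeta> \<longlongrightarrow> s \<xi>) (at \<xi> within approach_region m \<alpha> \<xi>)"
      using s by (simp add: nt_boundary_value_def)
    then show "AE \<xi> in fefferman_measure m \<sigma>. (?f \<longlongrightarrow> cnj (s \<xi>)) (at \<xi> within approach_region m \<alpha> \<xi>)"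
      by eventually_elim (rule tendsto_cnj)
  qed
  have "holomorphic2_on ?f (dom_D m)" using f by (simp add: fefferman_hardy_def)
  then obtain a :: "nat \<Rightarrow> nat \<Rightarrow> complex"
    where sums: "\<And>z w. (z, w) \<in> dom_D m \<Longrightarrow> (\<lambda>k. (\<Sum>j. a j k * z ^ j) * w ^ k) sums ?f (z, w)"
      and torus: "\<And>p q j k. 0 < p \<Longrightarrow> 0 < q \<Longrightarrow> (of_real p, of_real q) \<in> dom_D m \<Longrightarrow>
        integral {0..2 * pi} (\<lambda>s. integral {0..2 * pi}
          (\<lambda>t. ?f (of_real p * cis s, of_real q * cis t) * cis (- (real k * t))) * cis (- (real j * s))) =
        4 * pi\<^sup>2 * a j k * of_real p ^ j * of_real q ^ k"
    by (rule dom_D_power_series[OF m]) (rule that)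
  define N where "N = (\<lambda>j k. 4 * pi\<^sup>2 * real m powr (2/3) / (2 * real m) *
    (fact j / pochhammer ((3 * real k + real m + 2) / (3 * real m)) (Suc j)))"
  have "a j k = of_real (2 * real m / (4 * pi\<^sup>2 * real m powr (2/3)) *
        (pochhammer ((3 * real k + real m + 2) / (3 * real m)) (Suc j) / fact j)) * (cnj z0 ^ j * cnj w0 ^ k)" for j k
  proof -
    let ?e = "\<lambda>p :: complex \<times> complex. fst p ^ j * snd p ^ k"
    have "has_bochner_integral (fefferman_measure m \<sigma>) (\<lambda>\<xi>. s \<xi> * ?e \<xi>) (?e \<zeta>)"
      by (rule rep[OF monomial_fefferman_hardy[OF m \<sigma>] monomial_nt_boundary_value[OF \<sigma>]])
    from has_bochner_integral_bounded_linear[OF bounded_linear_cnj this]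
    have "has_bochner_integral (fefferman_measure m \<sigma>) (\<lambda>\<xi>. cnj (s \<xi>) * cnj (?e \<xi>)) (cnj (?e \<zeta>))"
      by simp
    then have "cnj (?e \<zeta>) = a j k * of_real (N j k)"
      unfolding N_def by (intro boundary_moment[OF m \<alpha> \<sigma> f g]) (rule torus)
    then have eq: "cnj z0 ^ j * cnj w0 ^ k = a j k * of_real (N j k)"
      by (simp add: zw)
    have "pochhammer ((3 * real k + m + 2) / (3 * m)) (Suc j) > 0"
      using m by (intro pochhammer_pos divide_pos_pos) auto
    then have inv: "2 * real m / (4 * pi\<^sup>2 * real m powr (2/3)) *
        (pochhammer ((3 * real k + real m + 2) / (3 * real m)) (Suc j) / fact j) * N j k = 1"
      (is "?C * _ = _")
      using m unfolding N_def by (simp del: pochhammer_Suc)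
    have "of_real ?C * (a j k * of_real (N j k)) = a j k * of_real (?C * N j k)"
      by (simp only: of_real_mult mult_ac)
    then show ?thesis
      unfolding eq inv by simp
  qed
  from szego_form_sums[OF m _ _ this] \<zeta> \<eta>
  have "(\<lambda>k. (\<Sum>j. a j k * z ^ j) * w ^ k) sums szego_form m \<zeta> \<eta>"
    by (simp add: zw)
  then show ?thesis
    using sums[of z w] \<eta> sums_unique2 by (auto simp: zw)
qed

theorem proposition3p6:
  fixes m :: nat and \<alpha> :: real
    and \<sigma>E :: "(complex \<times> complex) measure"
    and S :: "complex \<times> complex \<Rightarrow> complex \<times> complex \<Rightarrow> complex"
    and P :: "(complex \<times> complex) \<times> (complex \<times> complex)"
  assumes "m \<ge> 1" and "\<alpha> > 0"
    and "euclidean_surface_measure (frontier (dom_D m)) \<sigma>E"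
    and "fefferman_szego_kernel m \<alpha> \<sigma>E S"
    and "P \<in> closure (dom_D m) \<times> closure (dom_D m)"
  shows "(P \<in> boundary_diagonal m \<longrightarrow>
            filterlim (\<lambda>(\<zeta>, \<eta>). cmod (S \<zeta> \<eta>)) at_top (at P within dom_D m \<times> dom_D m)) \<and>
         (P \<notin> boundary_diagonal m \<longrightarrow>
            (\<exists>V. open V \<and> P \<in> V \<and> bounded ((\<lambda>(\<zeta>, \<eta>). S \<zeta> \<eta>) ` (V \<inter> dom_D m \<times> dom_D m))))"
proof (intro conjI impI)
  \<comment> \<open>The conjugation that makes \<open>szego_form\<close> holomorphic in \<eta>
    disappears in the modulus, and blow-up and boundedness are statements about moduli.\<close>
  have norm: "cmod (S \<zeta> \<eta>) = cmod (szego_form m \<zeta> \<eta>)" if "\<zeta> \<in> dom_D m" "\<eta> \<in> dom_D m" for \<zeta> \<eta>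
    using fefferman_szego_kernel_eq[OF assms(1-4) that] by (metis complex_mod_cnj)
  show "filterlim (\<lambda>(\<zeta>, \<eta>). cmod (S \<zeta> \<eta>)) at_top (at P within dom_D m \<times> dom_D m)"
    if "P \<in> boundary_diagonal m"
  proof -
    define p where "p = fst P"
    have P: "P = (p, p)" and p: "p \<in> frontier (dom_D m)"
      using that by (auto simp: boundary_diagonal_def p_def)
    have "eventually (\<lambda>y. y \<in> dom_D m \<times> dom_D m) (at P within dom_D m \<times> dom_D m)"
      by (simp add: eventually_at_filter)
    then have "eventually (\<lambda>y. (\<lambda>(\<zeta>, \<eta>). cmod (szego_form m \<zeta> \<eta>)) y = (\<lambda>(\<zeta>, \<eta>). cmod (S \<zeta> \<eta>)) y)
        (at P within dom_D m \<times> dom_D m)"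
      by eventually_elim (auto simp: norm)
    with szego_form_at_top[OF assms(1) p] show ?thesis
      unfolding P using filterlim_cong[OF refl refl] by blast
  qed
  show "\<exists>V. open V \<and> P \<in> V \<and> bounded ((\<lambda>(\<zeta>, \<eta>). S \<zeta> \<eta>) ` (V \<inter> dom_D m \<times> dom_D m))"
    if nd: "P \<notin> boundary_diagonal m"
  proof -
    obtain p u where P: "P = (p, u)" "p \<in> closure (dom_D m)" "u \<in> closure (dom_D m)"
      using assms(5) by auto
    obtain V where V: "open V" "(p, u) \<in> V" and bd: "bounded ((\<lambda>(\<zeta>, \<eta>). szego_form m \<zeta> \<eta>) ` V)"
      by (rule szego_form_bounded_near[OF assms(1) P(2,3) nd[unfolded P(1)]])
    obtain B where "\<forall>y\<in>V. cmod ((\<lambda>(\<zeta>, \<eta>). szego_form m \<zeta> \<eta>) y) \<le> B"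
      using bd unfolding bounded_iff by blast
    then have B: "cmod (szego_form m \<zeta> \<eta>) \<le> B" if "(\<zeta>, \<eta>) \<in> V" for \<zeta> \<eta>
      using that by force
    have "bounded ((\<lambda>(\<zeta>, \<eta>). S \<zeta> \<eta>) ` (V \<inter> dom_D m \<times> dom_D m))"
      unfolding bounded_iff by (intro exI[of _ B]) (auto simp: norm B)
    with V P(1) show ?thesis by blast
  qed
qed

end
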